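(* Let $\mathcal E$ be a toric vector bundle over a smooth toric variety $Y(\Sigma)$ with $n$ rays, with Khovanskii basis $\mathcal B=\{b_1,\dots,b_r\}\subset E$, and let $\ell_1,\dots,\ell_d$ be a minimal generating set of linear forms of the linear ideal $L_{\mathcal B}$. With $p_1,\dots,p_d\in\mathbf k[X_1,\dots,X_n,Y_1,\dots,Y_r]$ and $m_A$ as defined in the context, the image of the map $\Phi_{\mathcal B}:\mathbf k[\overline X,\overline Y]\to\operatorname{Sym}(E)\otimes_{\mathbf k}\mathbf k[t_1^{\pm1},\dots,t_n^{\pm1}]$ is $\mathcal R(\mathcal E)$ and its kernel is $\mathcal I_{\mathcal B}=\langle p_1,\dots,p_d\rangle$ if and only if the following two conditions hold: (1) for every nonempty $A\subset\{1,\dots,n\}$, $d<|A|+m_A$; (2) for every $B\subset\{1,\dots,n\}$ with $|B|\ge2$ and every $i\in B$, $1+m_{\{i\}}<|B|+m_B$.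
   Context: $\mathbf k$ is algebraically closed, $\Sigma$ a smooth fan with primitive ray generators $\rho_1,\dots,\rho_n$, $\mathcal O_\Sigma$ the semifield of integral piecewise linear functions on $|\Sigma|$ under $\min,+$. A toric vector bundle $\mathcal E$ on $Y(\Sigma)$ with fiber $E$ over the base point of the open orbit corresponds to a valuation $\mathfrak v:\operatorname{Sym}(E)\to\mathcal O_\Sigma$ such that for every $\sigma\in\Sigma$ there is a basis $\mathcal B_\sigma$ of $E$ whose monomials form a vector space basis of $\operatorname{Sym}(E)$ with $\mathfrak v|_\sigma$ of a linear combination equal to the minimum of the values $\mathfrak v|_\sigma$ of the monomials occurring, and with $\mathfrak v(b)|_\sigma$ linear and integral for $b\in\mathcal B_\sigma$. $\mathcal B\subset E$ is a Khovanskii basis if for each $\rho\in|\Sigma|$ its classes generate the associated graded algebra of $f\mapsto\mathfrak v(f)(\rho)$. Write $\mathfrak v_i(f)=\mathfrak v(f)(\rho_i)$ and $\hat{\mathfrak v}(f)=(\mathfrak v_1(f),\dots,\mathfrak v_n(f))\in\mathbb Z^n$. $\mathcal R(\mathcal E)=\bigoplus_{\mathbf r\in\mathbb Z^n}\{f\in\operatorname{Sym}(E):\mathfrak v_i(f)\ge r_i\ \forall i\}\,t^{\mathbf r}\subset\operatorname{Sym}(E)\otimes\mathbf k[t_1^{\pm1},\dots,t_n^{\pm1}]$ (isomorphic to the Cox ring of the projectivization $\mathbb P\mathcal E$ of rank one quotients). $\Phi_{\mathcal B}$ sends $X_i\mapsto t_i^{-1}$ and $Y_j\mapsto b_j\,t^{\hat{\mathfrak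 v}(b_j)}$, and $\mathcal I_{\mathcal B}=\ker\Phi_{\mathcal B}$. The diagram $D$ is the $n\times r$ matrix with entries $\mathfrak v_i(b_j)$; without changing $\mathbb P\mathcal E$ or $\mathcal R(\mathcal E)$ up to isomorphism, the minimum entry of each row of $D$ is assumed to be $0$. $L_{\mathcal B}\subset\mathbf k[y_1,\dots,y_r]$ is the linear ideal of relations among the $b_j$, $\ell_k=\sum_{j=1}^rc_{k,j}y_j$, and $M=(c_{k,j})$ is the $d\times r$ coefficient matrix (of rank $d$). Let $\alpha_k\in\mathbb Z^n$ be the entrywise minimum of the $\hat{\mathfrak v}(b_j)$ over $j$ with $c_{k,j}\ne0$, and $p_k=X^{-\alpha_k}\sum_{j=1}^rc_{k,j}X^{\hat{\mathfrak v}(b_j)}Y_j$. For $A\subset\{1,\dots,n\}$, $M_A$ is the matrix obtained from $M$ by keeping the entry $c_{k,j}$ if $\mathfrak v_i(b_j)=(\alpha_k)_i$ for all $i\in A$ and replacing it by $0$ otherwise (the coefficient matrix of the $p_k$ after setting $X_i=0$ for $i\in A$, up to monomial factors); $m_A=\operatorname{rank}(M_A)$. *)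

theory Defs
  imports
    "HOL-Analysis.Analysis"
    "HOL-Library.Poly_Mapping"
    "HOL-Algebra.QuotRing"
    "HOL-Algebra.Generated_Rings"
    "HOL-Algebra.Algebraic_Closure_Type"
    "Jordan_Normal_Form.DL_Rank"
begin

section \<open>Smooth fans and integral piecewise linear functions\<close>

text \<open>The cocharacter lattice is \<open>int ^ 'm\<close> inside \<open>real ^ 'm\<close>.\<close>

definition lat :: "int ^ 'm \<Rightarrow> real ^ 'm" where
  "lat u = vec_lambda (\<lambda>i. real_of_int (vec_nth u i))"

definition rational_cone :: "(real ^ 'm) set \<Rightarrow> bool" where
  "rational_cone \<sigma> \<longleftrightarrow> (\<exists>S. finite S \<and> \<sigma> = convex_cone hull (lat ` S))"

text \<open>\<open>face_of\<close> admits the empty face, which is not a cone.\<close>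

definition is_fan :: "(real ^ 'm) set set \<Rightarrow> bool" where
  "is_fan \<Sigma> \<longleftrightarrow> finite \<Sigma> \<and> \<Sigma> \<noteq> {} \<and>
     (\<forall>\<sigma>\<in>\<Sigma>. rational_cone \<sigma> \<and> \<sigma> \<inter> uminus ` \<sigma> = {0}) \<and>
     (\<forall>\<sigma>\<in>\<Sigma>. \<forall>\<tau>. \<tau> face_of \<sigma> \<and> \<tau> \<noteq> {} \<longrightarrow> \<tau> \<in> \<Sigma>) \<and>
     (\<forall>\<sigma>\<in>\<Sigma>. \<forall>\<tau>\<in>\<Sigma>. \<sigma> \<inter> \<tau> face_of \<sigma> \<and> \<sigma> \<inter> \<tau> face_of \<tau>)"

definition lattice_basis :: "(int ^ 'm) set \<Rightarrow> bool" where
  "lattice_basis T \<longleftrightarrow> \<not> Modules.module.dependent (*s) T \<and> Modules.module.span (*s) T = UNIV"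

definition smooth_fan :: "(real ^ 'm) set set \<Rightarrow> bool" where
  "smooth_fan \<Sigma> \<longleftrightarrow> is_fan \<Sigma> \<and>
     (\<forall>\<sigma>\<in>\<Sigma>. \<exists>S T. lattice_basis T \<and> S \<subseteq> T \<and> \<sigma> = convex_cone hull (lat ` S))"

definition primitive_vec :: "int ^ 'm \<Rightarrow> bool" where
  "primitive_vec u \<longleftrightarrow> (\<forall>c w. u = c *s w \<longrightarrow> \<bar>c\<bar> = 1)"

definition ray_generators :: "(real ^ 'm) set set \<Rightarrow> (int ^ 'm) set" where
  "ray_generators \<Sigma> = {u. primitive_vec u \<and> convex_cone hull {lat u} \<in> \<Sigma>}"

definition integral_linear_on :: "(real ^ 'm) set \<Rightarrow> (real ^ 'm \<Rightarrow> real) \<Rightarrow> bool" where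
  "integral_linear_on \<sigma> \<phi> \<longleftrightarrow> (\<exists>u. \<forall>x\<in>\<sigma>. \<phi> x = inner (lat u) x)"

text \<open>
  The semifield of integral piecewise linear functions on the support \<open>\<Union>\<Sigma>\<close>. The domains of
  linearity need not be cones of \<open>\<Sigma>\<close>; otherwise the set would not be closed under minima.
  Functions are total, and only their values on \<open>\<Union>\<Sigma>\<close> matter.
\<close>

definition integral_PL :: "(real ^ 'm) set set \<Rightarrow> (real ^ 'm \<Rightarrow> real) set" where
  "integral_PL \<Sigma> = {\<phi>. \<exists>P. finite P \<and> \<Union>P = \<Union>\<Sigma> \<and>
     (\<forall>\<tau>\<in>P. rational_cone \<tau> \<and> integral_linear_on \<tau> \<phi>)}"


section \<open>Polynomial and Laurent polynomial rings\<close>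

text \<open>
  Polynomials are finitely supported maps from exponents to coefficients, with the convolution
  product. \<open>('x, 'a) laurent\<close> is the ring of Laurent polynomials with coefficients in \<open>'a\<close>.
\<close>

type_synonym ('x, 'k) mpoly = "('x \<Rightarrow>\<^sub>0 nat) \<Rightarrow>\<^sub>0 'k"
type_synonym ('x, 'a) laurent = "('x \<Rightarrow>\<^sub>0 int) \<Rightarrow>\<^sub>0 'a"

abbreviation const :: "'k::zero \<Rightarrow> ('e::zero \<Rightarrow>\<^sub>0 'k)" where
  "const c \<equiv> Poly_Mapping.single 0 c"

definition scale :: "'k::comm_ring_1 \<Rightarrow> ('e::comm_monoid_add \<Rightarrow>\<^sub>0 'k) \<Rightarrow> ('e \<Rightarrow>\<^sub>0 'k)" where
  "scale c f = const c * f"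

abbreviation subring_on :: "'a::ring_1 set \<Rightarrow> 'a ring" where
  "subring_on C \<equiv> ring_of_type_algebra\<lparr>carrier := C\<rparr>"

text \<open>The (Laurent) polynomial ring in the variables \<open>V\<close>.\<close>

definition poly_ring_in :: "'x set \<Rightarrow> (('x \<Rightarrow>\<^sub>0 'e::comm_monoid_add) \<Rightarrow>\<^sub>0 'a::comm_ring_1) ring" where
  "poly_ring_in V = subring_on {p. \<forall>m\<in>Poly_Mapping.keys p. Poly_Mapping.keys m \<subseteq> V}"

definition poly_subst ::
  "('k::comm_ring_1 \<Rightarrow> 'a::comm_ring_1) \<Rightarrow> ('x \<Rightarrow> 'a) \<Rightarrow> ('x, 'k) mpoly \<Rightarrow> 'a" where
  "poly_subst h g p = (\<Sum>m\<in>Poly_Mapping.keys p.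
     h (Poly_Mapping.lookup p m) * (\<Prod>x\<in>Poly_Mapping.keys m. g x ^ Poly_Mapping.lookup m x))"


section \<open>Toric vector bundles as valuations\<close>

text \<open>
  The fibre \<open>E\<close> is the vector space with basis the variables indexed by the finite type \<open>'s\<close>, and
  \<open>Sym(E)\<close> is the polynomial ring \<open>('s, 'k) mpoly\<close>, in which \<open>E\<close> is the space of linear forms.
\<close>

definition fibre :: "('s::finite, 'k::field) mpoly set" where
  "fibre = {f. \<forall>m\<in>Poly_Mapping.keys f. (\<Sum>x\<in>UNIV. Poly_Mapping.lookup m x) = 1}"

text \<open>
  A valuation \<open>Sym(E) \<rightarrow> \<O>\<^sub>\<Sigma> \<union> {\<infinity>}\<close>. The value at \<open>0\<close> is understood to be \<open>\<infinity>\<close>, so that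
  \<open>v f\<close> is used for \<open>f \<noteq> 0\<close> only.
\<close>

definition PL_valuation ::
  "(real ^ 'm) set set \<Rightarrow> (('s::finite, 'k::field) mpoly \<Rightarrow> real ^ 'm \<Rightarrow> real) \<Rightarrow> bool" where
  "PL_valuation \<Sigma> v \<longleftrightarrow>
     (\<forall>f. f \<noteq> 0 \<longrightarrow> v f \<in> integral_PL \<Sigma>) \<and>
     (\<forall>c. c \<noteq> 0 \<longrightarrow> (\<forall>x\<in>\<Union>\<Sigma>. v (const c) x = 0)) \<and>
     (\<forall>f g. f \<noteq> 0 \<and> g \<noteq> 0 \<longrightarrow> (\<forall>x\<in>\<Union>\<Sigma>. v (f * g) x = v f x + v g x)) \<and>
     (\<forall>f g. f \<noteq> 0 \<and> g \<noteq> 0 \<and> f + g \<noteq> 0 \<longrightarrow> (\<forall>x\<in>\<Union>\<Sigma>. min (v f x) (v g x) \<le> v (f + g) x))"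

definition vs_basis :: "('e::comm_monoid_add \<Rightarrow>\<^sub>0 'k::field) set \<Rightarrow> ('e \<Rightarrow>\<^sub>0 'k) set \<Rightarrow> bool" where
  "vs_basis W B \<longleftrightarrow> B \<subseteq> W \<and> \<not> Modules.module.dependent scale B \<and> Modules.module.span scale B = W"

definition monomial_in :: "('a::comm_monoid_mult \<Rightarrow>\<^sub>0 nat) \<Rightarrow> 'a" where
  "monomial_in a = (\<Prod>b\<in>Poly_Mapping.keys a. b ^ Poly_Mapping.lookup a b)"

definition adapted_basis ::
  "(('s::finite, 'k::field) mpoly \<Rightarrow> real ^ 'm \<Rightarrow> real) \<Rightarrow> (real ^ 'm) set
     \<Rightarrow> ('s, 'k) mpoly set \<Rightarrow> bool" where
  "adapted_basis v \<sigma> B \<longleftrightarrow>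
     vs_basis fibre B \<and>
     inj_on monomial_in {a. Poly_Mapping.keys a \<subseteq> B} \<and>
     vs_basis UNIV (monomial_in ` {a. Poly_Mapping.keys a \<subseteq> B}) \<and>
     (\<forall>S c. finite S \<and> S \<noteq> {} \<and> (\<forall>a\<in>S. Poly_Mapping.keys a \<subseteq> B \<and> c a \<noteq> 0) \<longrightarrow>
        (\<forall>x\<in>\<sigma>. v (\<Sum>a\<in>S. scale (c a) (monomial_in a)) x = Min ((\<lambda>a. v (monomial_in a) x) ` S))) \<and>
     (\<forall>b\<in>B. integral_linear_on \<sigma> (v b))"

definition toric_vector_bundle ::
  "(real ^ 'm) set set \<Rightarrow> (('s::finite, 'k::field) mpoly \<Rightarrow> real ^ 'm \<Rightarrow> real) \<Rightarrow> bool" where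
  "toric_vector_bundle \<Sigma> v \<longleftrightarrow> PL_valuation \<Sigma> v \<and> (\<forall>\<sigma>\<in>\<Sigma>. \<exists>B. adapted_basis v \<sigma> B)"


section \<open>Associated graded algebra and Khovanskii bases\<close>

text \<open>
  For a real valuation \<open>w\<close> (again used on nonzero elements only) with \<open>F\<^sub>\<ge>\<^sub>a = {f. w f \<ge> a}\<close> and
  \<open>F\<^sub>>\<^sub>a = {f. w f > a}\<close>, the associated graded algebra is the direct sum of the
  \<open>F\<^sub>\<ge>\<^sub>a / F\<^sub>>\<^sub>a\<close> over all real \<open>a\<close>. It is obtained as the quotient of
  the algebra of finite formal sums \<open>\<Sum>f\<^sub>a s\<^sup>a\<close> with \<open>f\<^sub>a \<in> F\<^sub>\<ge>\<^sub>a\<close>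
  by the ideal of those with \<open>f\<^sub>a \<in> F\<^sub>>\<^sub>a\<close>.
\<close>

definition filt_ring :: "('a::comm_ring_1 \<Rightarrow> real) \<Rightarrow> (real \<Rightarrow>\<^sub>0 'a) ring" where
  "filt_ring w = subring_on {F. \<forall>a\<in>Poly_Mapping.keys F. a \<le> w (Poly_Mapping.lookup F a)}"

definition filt_ideal :: "('a::comm_ring_1 \<Rightarrow> real) \<Rightarrow> (real \<Rightarrow>\<^sub>0 'a) set" where
  "filt_ideal w = {F. \<forall>a\<in>Poly_Mapping.keys F. a < w (Poly_Mapping.lookup F a)}"

definition gr_ring :: "('a::comm_ring_1 \<Rightarrow> real) \<Rightarrow> (real \<Rightarrow>\<^sub>0 'a) set ring" where
  "gr_ring w = filt_ring w Quot filt_ideal w"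

text \<open>The class of \<open>f\<close> in the graded piece of degree \<open>a\<close>.\<close>

definition gr_class :: "('a::comm_ring_1 \<Rightarrow> real) \<Rightarrow> real \<Rightarrow> 'a \<Rightarrow> (real \<Rightarrow>\<^sub>0 'a) set" where
  "gr_class w a f = filt_ideal w +>\<^bsub>filt_ring w\<^esub> Poly_Mapping.single a f"

definition khovanskii_basis ::
  "(real ^ 'm) set set \<Rightarrow> (('s::finite, 'k::field) mpoly \<Rightarrow> real ^ 'm \<Rightarrow> real)
     \<Rightarrow> ('s, 'k) mpoly set \<Rightarrow> bool" where
  "khovanskii_basis \<Sigma> v B \<longleftrightarrow> B \<subseteq> fibre \<and> 0 \<notin> B \<and>
     (\<forall>x\<in>\<Union>\<Sigma>. let w = (\<lambda>f. v f x) in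
        generate_ring (gr_ring w) (range (\<lambda>c. gr_class w 0 (const c)) \<union> (\<lambda>b. gr_class w (w b) b) ` B)
          = carrier (gr_ring w))"


section \<open>The Rees algebra, the map \<open>\<Phi>\<close> and the polynomials \<open>p\<^sub>k\<close>\<close>

text \<open>Indices of rays, basis elements and linear forms run over \<open>0, \<dots>, n - 1\<close> etc.\<close>

text \<open>
  \<open>v\<^sub>i(f)\<close> for \<open>f \<noteq> 0\<close>. The floor is only a coercion: the value of an integral
  piecewise linear function at a lattice point is an integer.
\<close>

definition ray_val ::
  "('f \<Rightarrow> real ^ 'm \<Rightarrow> real) \<Rightarrow> (nat \<Rightarrow> int ^ 'm) \<Rightarrow> nat \<Rightarrow> 'f \<Rightarrow> int" where
  "ray_val v \<rho> i f = \<lfloor>v f (lat (\<rho> i))\<rfloor>"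

definition vhat ::
  "nat \<Rightarrow> ('f \<Rightarrow> real ^ 'm \<Rightarrow> real) \<Rightarrow> (nat \<Rightarrow> int ^ 'm) \<Rightarrow> 'f \<Rightarrow> (nat \<Rightarrow>\<^sub>0 int)" where
  "vhat n v \<rho> f = (\<Sum>i<n. Poly_Mapping.single i (ray_val v \<rho> i f))"

definition rees_algebra ::
  "nat \<Rightarrow> (('s::finite, 'k::field) mpoly \<Rightarrow> real ^ 'm \<Rightarrow> real) \<Rightarrow> (nat \<Rightarrow> int ^ 'm)
     \<Rightarrow> (nat, ('s, 'k) mpoly) laurent set" where
  "rees_algebra n v \<rho> = {F. \<forall>r\<in>Poly_Mapping.keys F. Poly_Mapping.keys r \<subseteq> {..<n} \<and>
     (\<forall>i<n. Poly_Mapping.lookup r i \<le> ray_val v \<rho> i (Poly_Mapping.lookup F r))}"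

datatype var = Xvar nat | Yvar nat

definition XY_ring :: "nat \<Rightarrow> nat \<Rightarrow> (var, 'k::field) mpoly ring" where
  "XY_ring n r = poly_ring_in (Xvar ` {..<n} \<union> Yvar ` {..<r})"

definition Phi ::
  "nat \<Rightarrow> (('s::finite, 'k::field) mpoly \<Rightarrow> real ^ 'm \<Rightarrow> real) \<Rightarrow> (nat \<Rightarrow> int ^ 'm)
     \<Rightarrow> (nat \<Rightarrow> ('s, 'k) mpoly) \<Rightarrow> (var, 'k) mpoly \<Rightarrow> (nat, ('s, 'k) mpoly) laurent" where
  "Phi n v \<rho> b = poly_subst (\<lambda>c. const (const c))
     (\<lambda>z. case z of
         Xvar i \<Rightarrow> Poly_Mapping.single (Poly_Mapping.single i (-1)) 1
       | Yvar j \<Rightarrow> Poly_Mapping.single (vhat n v \<rho> (b j)) (b j))"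

definition Phi_kernel ::
  "nat \<Rightarrow> nat \<Rightarrow> (('s::finite, 'k::field) mpoly \<Rightarrow> real ^ 'm \<Rightarrow> real) \<Rightarrow> (nat \<Rightarrow> int ^ 'm)
     \<Rightarrow> (nat \<Rightarrow> ('s, 'k) mpoly) \<Rightarrow> (var, 'k) mpoly set" where
  "Phi_kernel n r v \<rho> b = a_kernel (XY_ring n r) (poly_ring_in {..<n}) (Phi n v \<rho> b)"

definition linear_form :: "nat \<Rightarrow> (nat \<Rightarrow> 'k::field) \<Rightarrow> (nat, 'k) mpoly" where
  "linear_form r a = (\<Sum>j<r. Poly_Mapping.single (Poly_Mapping.single j 1) (a j))"

text \<open>The ideal \<open>L\<^sub>\<B>\<close> of relations among \<open>b\<^sub>0, \<dots>, b\<^bsub>r-1\<^esub>\<close> in \<open>Sym(E)\<close>.\<close>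

definition relation_ideal :: "nat \<Rightarrow> (nat \<Rightarrow> ('s::finite, 'k::field) mpoly) \<Rightarrow> (nat, 'k) mpoly set" where
  "relation_ideal r b = a_kernel (poly_ring_in {..<r}) (poly_ring_in UNIV) (poly_subst const b)"

definition minimal_linear_generators ::
  "nat \<Rightarrow> nat \<Rightarrow> (nat \<Rightarrow> nat \<Rightarrow> 'k::field) \<Rightarrow> (nat, 'k) mpoly set \<Rightarrow> bool" where
  "minimal_linear_generators d r c L \<longleftrightarrow>
     Idl\<^bsub>poly_ring_in {..<r}\<^esub> ((\<lambda>k. linear_form r (c k)) ` {..<d}) = L \<and>
     (\<forall>K. K \<subset> {..<d} \<longrightarrow> Idl\<^bsub>poly_ring_in {..<r}\<^esub> ((\<lambda>k. linear_form r (c k)) ` K) \<noteq> L)"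

definition alpha ::
  "nat \<Rightarrow> ('f \<Rightarrow> real ^ 'm \<Rightarrow> real) \<Rightarrow> (nat \<Rightarrow> int ^ 'm) \<Rightarrow> (nat \<Rightarrow> 'f)
     \<Rightarrow> (nat \<Rightarrow> nat \<Rightarrow> 'k::field) \<Rightarrow> nat \<Rightarrow> nat \<Rightarrow> int" where
  "alpha r v \<rho> b c k i = Min ((\<lambda>j. ray_val v \<rho> i (b j)) ` {j. j < r \<and> c k j \<noteq> 0})"

text \<open>
  The exponent of \<open>X\<^sub>i\<close> is nonnegative whenever \<open>c k j \<noteq> 0\<close>; the other summands are \<open>0\<close>.
\<close>

definition rel_poly ::
  "nat \<Rightarrow> nat \<Rightarrow> ('f \<Rightarrow> real ^ 'm \<Rightarrow> real) \<Rightarrow> (nat \<Rightarrow> int ^ 'm) \<Rightarrow> (nat \<Rightarrow> 'f)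
     \<Rightarrow> (nat \<Rightarrow> nat \<Rightarrow> 'k::field) \<Rightarrow> nat \<Rightarrow> (var, 'k) mpoly" where
  "rel_poly n r v \<rho> b c k = (\<Sum>j<r. Poly_Mapping.single
      ((\<Sum>i<n. Poly_Mapping.single (Xvar i) (nat (ray_val v \<rho> i (b j) - alpha r v \<rho> b c k i)))
        + Poly_Mapping.single (Yvar j) 1)
      (c k j))"

definition M_mat ::
  "nat \<Rightarrow> nat \<Rightarrow> ('f \<Rightarrow> real ^ 'm \<Rightarrow> real) \<Rightarrow> (nat \<Rightarrow> int ^ 'm) \<Rightarrow> (nat \<Rightarrow> 'f)
     \<Rightarrow> (nat \<Rightarrow> nat \<Rightarrow> 'k::field) \<Rightarrow> nat set \<Rightarrow> 'k Matrix.mat" where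
  "M_mat d r v \<rho> b c A = Matrix.mat d r (\<lambda>(k, j).
     if \<forall>i\<in>A. ray_val v \<rho> i (b j) = alpha r v \<rho> b c k i then c k j else 0)"

definition m_rank ::
  "nat \<Rightarrow> nat \<Rightarrow> ('f \<Rightarrow> real ^ 'm \<Rightarrow> real) \<Rightarrow> (nat \<Rightarrow> int ^ 'm) \<Rightarrow> (nat \<Rightarrow> 'f)
     \<Rightarrow> (nat \<Rightarrow> nat \<Rightarrow> 'k::field) \<Rightarrow> nat set \<Rightarrow> nat" where
  "m_rank d r v \<rho> b c A = vec_space.rank d (M_mat d r v \<rho> b c A)"

end

theory Submission
  imports Defs
begin

text \<open>Give \<open>k[X, Y]\<close> the fine grading by the exponents of the \<open>t\<^sub>i\<close>. Then
\<open>p\<^sub>k\<close> is homogeneous, and setting all \<open>X\<^sub>i\<close> to \<open>1\<close> turns it into the linear form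
\<open>\<ell>\<^sub>k\<close>. Hence inverting all \<open>X\<^sub>i\<close> makes \<open>k[X, Y]/(p\<^sub>1, \<dots>, p\<^sub>d)\<close> a
Laurent polynomial ring over \<open>Sym(E)\<close>, and the kernel of \<open>\<Phi>\<close> is generated by the
\<open>p\<^sub>k\<close> if and only if no \<open>X\<^sub>i\<close> is a zero divisor modulo \<open>(p\<^sub>1, \<dots>, p\<^sub>d)\<close>
(lemma \<open>kernel_iff_saturated\<close>). Suppose that this holds. For a single ray the Khovanskii property
says that the Rees algebra is generated by the \<open>b\<^sub>j\<close> (lemma \<open>single_ray_image\<close>), so the image of
\<open>\<Phi>\<close> and the Rees algebra of all rays agree after inverting all \<open>X\<^sub>j\<close> with \<open>j \<noteq> i\<close>. They
agree if and only if no such \<open>X\<^sub>j\<close> is a zero divisor modulo \<open>(p\<^sub>1, \<dots>, p\<^sub>d, X\<^sub>i)\<close>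
(lemma \<open>image_iff_saturated_lead\<close>). Modulo \<open>X\<^sub>i\<close> the \<open>p\<^sub>k\<close> become
polynomials of the same kind in the remaining variables, with coefficient matrix
\<open>M\<^bsub>{i}\<^esub>\<close>.

So both conditions are instances of one statement: the \<open>X\<^sub>i\<close> are nonzero divisors modulo the
\<open>p\<^sub>k\<close>, \<open>k \<in> K\<close>, if and only if \<open>|K| < |A| + rank M\<^sub>A\<close> for every nonempty
\<open>A\<close> (theorems \<open>saturated_if_rank\<close> and \<open>rank_if_saturated\<close>). Geometrically, this compares the
dimensions of the strata of the zero set of the \<open>p\<^sub>k\<close>, which is a complete intersection and hence
unmixed. The proof below replaces the dimension theory by the Koszul cohomology of the quotient rings
with respect to the \<open>X\<^sub>i\<close>, \<open>i \<in> A\<close>. For the polynomial ring it vanishes below degree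
\<open>|A|\<close>. Dividing by forms \<open>p\<^sub>k\<close> whose rows in \<open>M\<^sub>A\<close> are independent does not
change this, and each further form costs at most one degree. If fewer than \<open>|A|\<close> further forms are
needed, then degree \<open>0\<close> still vanishes, which means that there is no torsion. Conversely, a form
whose row depends on the others lies in the ideal generated by these and by the \<open>X\<^sub>i\<close>. It
therefore acts as zero on cohomology, and the connecting map shifts a nonzero class down by one degree.
Starting from the class of \<open>1\<close> in degree \<open>|A|\<close>, one arrives after \<open>|A|\<close> such forms at a torsion
element.

The variables \<open>X\<^sub>i\<close> hardly appear. A homogeneous polynomial of degree \<open>\<delta>\<close> in
\<open>k[X, Y]\<close> amounts to a polynomial in \<open>k[Y]\<close> all of whose monomials have \<open>i\<close>-th weight at least
\<open>\<delta>\<^sub>i\<close>, and multiplication by \<open>X\<^sub>i\<close> is then an inclusion. Dropping the condition for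
some \<open>i\<close> amounts to inverting \<open>X\<^sub>i\<close>.\<close>

abbreviation keys :: "('e \<Rightarrow>\<^sub>0 'a::zero) \<Rightarrow> 'e set" where "keys \<equiv> Poly_Mapping.keys"
abbreviation lookup :: "('e \<Rightarrow>\<^sub>0 'a::zero) \<Rightarrow> 'e \<Rightarrow> 'a" where "lookup \<equiv> Poly_Mapping.lookup"

section \<open>Polynomials: restriction to sets of monomials and substitution\<close>

definition restr :: "'e set \<Rightarrow> ('e \<Rightarrow>\<^sub>0 'a::zero) \<Rightarrow> ('e \<Rightarrow>\<^sub>0 'a)" where
  "restr S g = Poly_Mapping.mapp (\<lambda>m a. a when m \<in> S) g"

lemma lookup_restr: "lookup (restr S g) m = (if m \<in> S then lookup g m else 0)"
  by (auto simp: restr_def lookup_mapp when_def in_keys_iff)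

lemma keys_restr [simp]: "keys (restr S g) = keys g \<inter> S"
  by (auto simp: in_keys_iff lookup_restr split: if_splits)

lemma restr_add: "restr S (f + g) = restr S f + restr S (g :: 'e \<Rightarrow>\<^sub>0 'a::comm_monoid_add)"
  by (rule poly_mapping_eqI) (simp add: lookup_restr lookup_add)

lemma restr_diff: "restr S (f - g) = restr S f - restr S (g :: 'e \<Rightarrow>\<^sub>0 'a::ab_group_add)"
  by (rule poly_mapping_eqI) (simp add: lookup_restr lookup_minus)

lemma restr_zero [simp]: "restr S 0 = 0"
  by (rule poly_mapping_eqI) (simp add: lookup_restr)

lemma restr_sum: "restr S (sum f I) = (\<Sum>x\<in>I. restr S (f x :: 'e \<Rightarrow>\<^sub>0 'a::comm_monoid_add))"
  by (induction I rule: infinite_finite_induct) (auto simp: restr_add)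

lemma restr_id: "keys g \<subseteq> S \<Longrightarrow> restr S g = g"
  by (rule poly_mapping_eqI) (auto simp: lookup_restr in_keys_iff)

lemma restr_eq_0: "keys g \<inter> S = {} \<Longrightarrow> restr S g = 0"
  by (rule poly_mapping_eqI) (auto simp: lookup_restr in_keys_iff)

lemma restr_split: "g = restr S g + restr (- S) (g :: 'e \<Rightarrow>\<^sub>0 'a::comm_monoid_add)"
  by (rule poly_mapping_eqI) (auto simp: lookup_restr lookup_add)

lemma keys_mult_mem:
  assumes "m \<in> keys (f * g)"
  obtains a b where "a \<in> keys f" "b \<in> keys g" "m = a + b"
  using assms keys_mult[of f g] by blast

text \<open>This is how homogeneity is used throughout: the monomials of \<open>l\<close> shift \<open>S'\<close> into \<open>S\<close> and the complement
  of \<open>S'\<close> into the complement of \<open>S\<close>.\<close>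

lemma restr_mult:
  fixes l g :: "'e::comm_monoid_add \<Rightarrow>\<^sub>0 'a::comm_ring_1"
  assumes "\<And>m m'. m \<in> keys l \<Longrightarrow> m + m' \<in> S \<longleftrightarrow> m' \<in> S'"
  shows "restr S (l * g) = l * restr S' g"
proof -
  have "l * g = l * restr S' g + l * restr (- S') g"
    using restr_split[of g S'] by (metis distrib_left)
  moreover have "restr S (l * restr S' g) = l * restr S' g"
    by (rule restr_id) (use assms in \<open>auto elim!: keys_mult_mem\<close>)
  moreover have "restr S (l * restr (- S') g) = 0"
    by (rule restr_eq_0) (use assms in \<open>auto elim!: keys_mult_mem\<close>)
  ultimately show ?thesis by (simp add: restr_add)
qed

lemma sum_singles: "p = (\<Sum>m\<in>keys p. Poly_Mapping.single m (lookup p m))"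
proof (rule poly_mapping_eqI)
  fix k
  have "lookup (\<Sum>m\<in>keys p. Poly_Mapping.single m (lookup p m)) k
      = (\<Sum>m\<in>keys p. if m = k then lookup p m else 0)"
    by (simp add: lookup_sum lookup_single when_def)
  also have "\<dots> = lookup p k"
    by (simp add: in_keys_iff)
  finally show "lookup p k = lookup (\<Sum>m\<in>keys p. Poly_Mapping.single m (lookup p m)) k" ..
qed

lemma single_sum: "Poly_Mapping.single m (sum f I) = (\<Sum>x\<in>I. Poly_Mapping.single m (f x))"
  by (induction I rule: infinite_finite_induct) (auto simp: single_add)

definition mon_eval :: "('x \<Rightarrow> 'a::comm_ring_1) \<Rightarrow> ('x \<Rightarrow>\<^sub>0 nat) \<Rightarrow> 'a" where
  "mon_eval g m = (\<Prod>x\<in>keys m. g x ^ lookup m x)"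

lemma mon_eval_superset:
  "finite S \<Longrightarrow> keys m \<subseteq> S \<Longrightarrow> mon_eval g m = (\<Prod>x\<in>S. g x ^ lookup m x)"
  unfolding mon_eval_def by (rule prod.mono_neutral_left) (auto simp: in_keys_iff)

lemma mon_eval_0 [simp]: "mon_eval g 0 = 1"
  by (simp add: mon_eval_def)

lemma mon_eval_add: "mon_eval g (m + m') = mon_eval g m * mon_eval g m'"
proof -
  let ?S = "keys m \<union> keys m'"
  have "keys (m + m') \<subseteq> ?S" by (rule keys_add)
  then show ?thesis
    by (simp add: mon_eval_superset[of ?S] lookup_add power_add prod.distrib)
qed

lemma mon_eval_single [simp]: "mon_eval g (Poly_Mapping.single x n) = g x ^ n"
  by (simp add: mon_eval_def)

lemma poly_subst_mon_eval: "poly_subst h g p = (\<Sum>m\<in>keys p. h (lookup p m) * mon_eval g m)"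
  by (simp add: poly_subst_def mon_eval_def)

locale coeff_hom =
  fixes h :: "'k::comm_ring_1 \<Rightarrow> 'a::comm_ring_1"
  assumes h_add: "h (a + b) = h a + h b" and h_mult: "h (a * b) = h a * h b" and h_1 [simp]: "h 1 = 1"
begin

lemma h_0 [simp]: "h 0 = 0"
  using h_add[of 0 0] by simp

lemma poly_subst_superset:
  "finite S \<Longrightarrow> keys p \<subseteq> S \<Longrightarrow> poly_subst h g p = (\<Sum>m\<in>S. h (lookup p m) * mon_eval g m)"
  unfolding poly_subst_mon_eval by (rule sum.mono_neutral_left) (auto simp: in_keys_iff)

lemma poly_subst_0 [simp]: "poly_subst h g 0 = 0"
  by (simp add: poly_subst_def)

lemma poly_subst_add: "poly_subst h g (p + q) = poly_subst h g p + poly_subst h g q"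
proof -
  let ?S = "keys p \<union> keys q"
  have "keys (p + q) \<subseteq> ?S" by (rule keys_add)
  then show ?thesis
    by (simp add: poly_subst_superset[of ?S] lookup_add h_add distrib_right sum.distrib)
qed

lemma poly_subst_uminus: "poly_subst h g (- p) = - poly_subst h g p"
  using poly_subst_add[of g p "- p"] by (simp add: add_eq_0_iff)

lemma poly_subst_diff: "poly_subst h g (p - q) = poly_subst h g p - poly_subst h g q"
  using poly_subst_add[of g p "- q"] by (simp add: poly_subst_uminus)

lemma poly_subst_sum: "poly_subst h g (sum f I) = (\<Sum>x\<in>I. poly_subst h g (f x))"
  by (induction I rule: infinite_finite_induct) (auto simp: poly_subst_add)

lemma poly_subst_single: "poly_subst h g (Poly_Mapping.single m a) = h a * mon_eval g m"
  by (simp add: poly_subst_mon_eval)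

lemma poly_subst_1 [simp]: "poly_subst h g 1 = 1"
  using poly_subst_single[of g 0 1] by simp

lemma poly_subst_mult: "poly_subst h g (p * q) = poly_subst h g p * poly_subst h g q"
proof -
  have "p * q = (\<Sum>m\<in>keys p. \<Sum>m'\<in>keys q. Poly_Mapping.single m (lookup p m) * Poly_Mapping.single m' (lookup q m'))"
    by (subst sum_singles[of p], subst sum_singles[of q]) (rule sum_product)
  then have "poly_subst h g (p * q) = (\<Sum>m\<in>keys p. \<Sum>m'\<in>keys q. (h (lookup p m) * mon_eval g m) * (h (lookup q m') * mon_eval g m'))"
    by (simp add: poly_subst_sum mult_single poly_subst_single h_mult mon_eval_add algebra_simps)
  also have "\<dots> = poly_subst h g p * poly_subst h g q"
    unfolding poly_subst_mon_eval by (rule sum_product[symmetric])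
  finally show ?thesis .
qed

end

interpretation const_hom: coeff_hom "const :: 'k \<Rightarrow> ('e::comm_monoid_add \<Rightarrow>\<^sub>0 'k::comm_ring_1)"
  by unfold_locales (auto simp: single_add mult_single)

abbreviation yvar :: "'x \<Rightarrow> ('x, 'k::comm_ring_1) mpoly" where
  "yvar j \<equiv> Poly_Mapping.single (Poly_Mapping.single j (Suc 0)) 1"

lemma single_mon_eval: "Poly_Mapping.single m (a::'k::comm_ring_1) = const a * mon_eval yvar m"
proof -
  have pw: "Poly_Mapping.single (Poly_Mapping.single x (Suc 0)) (1::'k) ^ n = Poly_Mapping.single (Poly_Mapping.single x n) 1" for x n
    by (induction n) (auto simp: mult_single single_add[symmetric])
  have pr: "(\<Prod>x\<in>I. Poly_Mapping.single (f x) (1::'k)) = Poly_Mapping.single (sum f I) 1" for I and f :: "'a \<Rightarrow> ('a \<Rightarrow>\<^sub>0 nat)"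
    by (induction I rule: infinite_finite_induct) (auto simp: mult_single)
  have "mon_eval yvar m = Poly_Mapping.single m (1::'k)"
    unfolding mon_eval_def pw pr by (subst (3) sum_singles) simp
  then show ?thesis by (simp add: mult_single)
qed

lemma mpoly_induct [case_names const var add mult]:
  fixes p :: "('x, 'k::comm_ring_1) mpoly"
  assumes c: "\<And>a. Q (const a)" and v: "\<And>x. Q (yvar x)"
    and a: "\<And>p q. Q p \<Longrightarrow> Q q \<Longrightarrow> Q (p + q)" and m: "\<And>p q. Q p \<Longrightarrow> Q q \<Longrightarrow> Q (p * q)"
  shows "Q p"
proof -
  have "Q 0" "Q 1" using c[of 0] c[of 1] by auto
  have pw: "Q (yvar x ^ n)" for x n by (induction n) (simp_all add: m v \<open>Q 1\<close>)
  have "Q (\<Prod>x\<in>I. yvar x ^ f x)" for I and f :: "'x \<Rightarrow> nat"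
    by (induction I rule: infinite_finite_induct) (simp_all add: m pw \<open>Q 1\<close>)
  then have s: "Q (Poly_Mapping.single k z)" for k z
    by (subst single_mon_eval, unfold mon_eval_def) (intro m c)
  have "Q (\<Sum>k\<in>I. Poly_Mapping.single k (f k))" for I and f :: "('x \<Rightarrow>\<^sub>0 nat) \<Rightarrow> 'k"
    by (induction I rule: infinite_finite_induct) (simp_all add: a s \<open>Q 0\<close>)
  then show ?thesis by (subst sum_singles)
qed

section \<open>Linear forms and their ideals\<close>

lemma linear_form_alt: "linear_form r a = (\<Sum>j<r. const (a j) * yvar j)"
  by (simp add: linear_form_def mult_single)

lemma single_var_eq_iff: "Poly_Mapping.single i (Suc 0) = Poly_Mapping.single j (Suc 0) \<longleftrightarrow> i = j"
proof
  assume "Poly_Mapping.single i (Suc 0) = Poly_Mapping.single j (Suc 0)"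
  then have "keys (Poly_Mapping.single i (Suc 0)) = keys (Poly_Mapping.single j (Suc 0))" by (rule arg_cong)
  then show "i = j" by simp
qed simp

lemma lookup_linear_form:
  "lookup (linear_form r a) m = (\<Sum>j<r. if m = Poly_Mapping.single j (Suc 0) then a j else 0)"
  by (auto simp: linear_form_def lookup_sum lookup_single when_def intro!: sum.cong)

lemma lookup_linear_form_var: "lookup (linear_form r a) (Poly_Mapping.single j (Suc 0)) = (if j < r then a j else 0)"
  by (simp add: lookup_linear_form single_var_eq_iff)

lemma keys_linear_form: "keys (linear_form r a) = (\<lambda>j. Poly_Mapping.single j (Suc 0)) ` {j. j < r \<and> a j \<noteq> 0}"
proof (rule subset_antisym; rule subsetI)
  fix m assume "m \<in> keys (linear_form r a)"
  then have "(\<Sum>j<r. if m = Poly_Mapping.single j (Suc 0) then a j else 0) \<noteq> 0"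
    by (simp add: in_keys_iff lookup_linear_form)
  then obtain j where "j \<in> {..<r}" "(if m = Poly_Mapping.single j (Suc 0) then a j else 0) \<noteq> 0"
    by (rule sum.not_neutral_contains_not_neutral)
  then show "m \<in> (\<lambda>j. Poly_Mapping.single j (Suc 0)) ` {j. j < r \<and> a j \<noteq> 0}"
    by (auto split: if_splits)
next
  fix m assume "m \<in> (\<lambda>j. Poly_Mapping.single j (Suc 0)) ` {j. j < r \<and> a j \<noteq> 0}"
  then show "m \<in> keys (linear_form r a)"
    unfolding in_keys_iff by (auto simp: lookup_linear_form_var)
qed

lemma linear_form_eq_0_iff: "linear_form r a = 0 \<longleftrightarrow> (\<forall>j<r. a j = 0)"
proof -
  have "linear_form r a = 0 \<longleftrightarrow> keys (linear_form r a) = {}" by simp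
  then show ?thesis unfolding keys_linear_form by auto
qed

lemma linear_form_add: "linear_form r (\<lambda>j. a j + b j) = linear_form r a + linear_form r b"
  by (simp add: linear_form_def single_add sum.distrib)

lemma linear_form_diff: "linear_form r (\<lambda>j. a j - b j) = linear_form r a - linear_form r b"
  by (simp add: linear_form_def single_diff sum_subtractf)

lemma linear_form_scale: "linear_form r (\<lambda>j. z * a j) = const z * linear_form r a"
  by (simp add: linear_form_def mult_single sum_distrib_left)

lemma linear_form_sum: "linear_form r (\<lambda>j. \<Sum>x\<in>I. f x j) = (\<Sum>x\<in>I. linear_form r (f x))"
proof -
  have z: "linear_form r (\<lambda>j. 0) = 0" by (simp add: linear_form_eq_0_iff)
  show ?thesis
    by (induction I rule: infinite_finite_induct) (auto simp: linear_form_add z)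
qed

lemma lookup_mult_linear_form:
  "lookup (linear_form r a * g) (Poly_Mapping.single j (Suc 0)) = (if j < r then a j * lookup g 0 else 0)"
proof -
  have g: "g = const (lookup g 0) + restr (- {0}) g"
    by (rule poly_mapping_eqI) (auto simp: lookup_add lookup_restr lookup_single)
  have nz: "Poly_Mapping.single j (Suc 0) \<notin> keys (linear_form r a * restr (- {0}) g)"
  proof
    assume "Poly_Mapping.single j (Suc 0) \<in> keys (linear_form r a * restr (- {0}) g)"
    then obtain i m where im: "Poly_Mapping.single j (Suc 0) = Poly_Mapping.single i (Suc 0) + m" "m \<noteq> 0"
      by (elim keys_mult_mem) (auto simp: keys_linear_form)
    have eq: "(Suc 0 when j = x) = (Suc 0 when i = x) + lookup m x" for x
      using arg_cong[OF im(1), of "\<lambda>q. lookup q x"] by (simp add: lookup_add lookup_single)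
    have "i = j" using eq[of i] by (cases "i = j") (auto simp: when_def)
    then have "lookup m x = 0" for x using eq[of x] by (auto simp: when_def split: if_splits)
    then show False using im(2) by (auto intro: poly_mapping_eqI)
  qed
  have "linear_form r a * g = linear_form r (\<lambda>j. lookup g 0 * a j) + linear_form r a * restr (- {0}) g"
    by (subst g) (simp add: distrib_left linear_form_scale mult.commute[of "const _"])
  then show ?thesis
    using nz by (simp add: lookup_add in_keys_iff lookup_linear_form_var mult.commute[of "lookup g 0"])
qed

definition row_indep :: "nat \<Rightarrow> (nat \<Rightarrow> nat \<Rightarrow> 'k::field) \<Rightarrow> nat set \<Rightarrow> bool" where
  "row_indep r c K \<longleftrightarrow> (\<forall>a. (\<forall>j<r. (\<Sum>k\<in>K. a k * c k j) = 0) \<longrightarrow> (\<forall>k\<in>K. a k = 0))"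

definition combos :: "nat \<Rightarrow> (nat \<Rightarrow> nat \<Rightarrow> 'k::field) \<Rightarrow> nat set \<Rightarrow> (nat, 'k) mpoly set" where
  "combos r c K = {(\<Sum>k\<in>K. linear_form r (c k) * g k) | g. True}"

lemma combos_memI: "f = (\<Sum>k\<in>K. linear_form r (c k) * g k) \<Longrightarrow> f \<in> combos r c K"
  by (auto simp: combos_def)

lemma combosE:
  assumes "f \<in> combos r c K"
  obtains g where "f = (\<Sum>k\<in>K. linear_form r (c k) * g k)"
  using assms by (auto simp: combos_def)

lemma combos_0 [simp]: "0 \<in> combos r c K"
  by (rule combos_memI[of _ r c "\<lambda>_. 0" K]) simp

lemma combos_add: "f \<in> combos r c K \<Longrightarrow> g \<in> combos r c K \<Longrightarrow> f + g \<in> combos r c K"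
proof -
  assume "f \<in> combos r c K" "g \<in> combos r c K"
  then obtain a b where "f = (\<Sum>k\<in>K. linear_form r (c k) * a k)" "g = (\<Sum>k\<in>K. linear_form r (c k) * b k)"
    by (auto elim!: combosE)
  then have "f + g = (\<Sum>k\<in>K. linear_form r (c k) * (a k + b k))"
    by (simp add: distrib_left sum.distrib)
  then show ?thesis by (rule combos_memI)
qed

lemma combos_mult: "f \<in> combos r c K \<Longrightarrow> g * f \<in> combos r c K"
proof -
  assume "f \<in> combos r c K"
  then obtain a where "f = (\<Sum>k\<in>K. linear_form r (c k) * a k)" by (auto simp: combos_def)
  then have "g * f = (\<Sum>k\<in>K. linear_form r (c k) * (g * a k))"
    by (simp add: sum_distrib_left algebra_simps)
  then show ?thesis by (rule combos_memI)
qed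

lemma combos_diff: "f \<in> combos r c K \<Longrightarrow> g \<in> combos r c K \<Longrightarrow> f - g \<in> combos r c K"
  using combos_add[of f r c K "(-1) * g"] combos_mult[of g r c K "-1"] by simp

lemma combos_form: "finite K \<Longrightarrow> k \<in> K \<Longrightarrow> linear_form r (c k) \<in> combos r c K"
  by (rule combos_memI[of _ r c "\<lambda>k'. if k' = k then 1 else 0"]) (simp add: if_distrib cong: if_cong)

lemma combos_mono:
  assumes "finite K" "K' \<subseteq> K" shows "combos r c K' \<subseteq> combos r c K"
proof
  fix f assume "f \<in> combos r c K'"
  then obtain g where f: "f = (\<Sum>k\<in>K'. linear_form r (c k) * g k)" by (auto simp: combos_def)
  have "f = (\<Sum>k\<in>K. linear_form r (c k) * (if k \<in> K' then g k else 0))"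
    unfolding f by (rule sum.mono_neutral_cong_left) (use assms in auto)
  then show "f \<in> combos r c K" by (rule combos_memI)
qed

lemma row_indepD:
  "row_indep r c K \<Longrightarrow> (\<And>j. j < r \<Longrightarrow> (\<Sum>k\<in>K. a k * c k j) = 0) \<Longrightarrow> k \<in> K \<Longrightarrow> a k = 0"
  unfolding row_indep_def by blast

lemma row_indep_subset:
  assumes "row_indep r c K" "finite K" "K' \<subseteq> K" shows "row_indep r c K'"
  unfolding row_indep_def
proof (intro allI impI ballI)
  fix a k assume a: "\<forall>j<r. (\<Sum>k\<in>K'. a k * c k j) = 0" and k: "k \<in> K'"
  have "(\<Sum>k\<in>K. (if k \<in> K' then a k else 0) * c k j) = (\<Sum>k\<in>K'. a k * c k j)" for j
    by (rule sum.mono_neutral_cong_right) (use assms in auto)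
  then have "(if k \<in> K' then a k else 0) = 0"
    by (intro row_indepD[OF assms(1), where a = "\<lambda>k. if k \<in> K' then a k else 0"])
       (use a k assms(3) in auto)
  then show "a k = 0" using k by simp
qed

text \<open>Gaussian elimination: modulo finitely many linear forms every polynomial has a normal form,
  obtained by substituting for pivot variables. The substitution identifies the quotient with a
  polynomial ring, whence the quotient is a domain.\<close>

lemma elimination:
  fixes c :: "nat \<Rightarrow> nat \<Rightarrow> 'k::field"
  assumes "finite K"
  shows "\<exists>\<phi>. (\<forall>f g. \<phi> (f + g) = \<phi> f + \<phi> g) \<and> (\<forall>f g. \<phi> (f * g) = \<phi> f * \<phi> g) \<and>
     (\<forall>f. f - \<phi> f \<in> combos r c K) \<and> (\<forall>k\<in>K. \<phi> (linear_form r (c k)) = 0) \<and>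
     (\<forall>a. \<exists>a'. \<phi> (linear_form r a) = linear_form r a')"
  using assms
proof (induction K)
  case empty
  then show ?case by (intro exI[of _ "\<lambda>f. f"]) auto
next
  case (insert k K)
  then obtain \<phi> where p: "\<And>f g. \<phi> (f + g) = \<phi> f + \<phi> g" "\<And>f g. \<phi> (f * g) = \<phi> f * \<phi> g"
     "\<And>f. f - \<phi> f \<in> combos r c K" "\<forall>k\<in>K. \<phi> (linear_form r (c k)) = 0"
     "\<And>a. \<exists>a'. \<phi> (linear_form r a) = linear_form r a'"
    by blast
  obtain e where e: "\<phi> (linear_form r (c k)) = linear_form r e" using p(5) by blast
  have sub: "combos r c K \<subseteq> combos r c (insert k K)"
    by (rule combos_mono) (use insert in auto)
  show ?case
  proof (cases "linear_form r e = 0")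
    case True
    with p e sub show ?thesis by (intro exI[of _ \<phi>]) auto
  next
    case False
    then obtain j where j: "j < r" "e j \<noteq> 0" by (auto simp: linear_form_eq_0_iff)
    define e' where "e' = (\<lambda>i. inverse (e j) * e i)"
    define \<sigma> :: "(nat, 'k) mpoly \<Rightarrow> (nat, 'k) mpoly" where
      "\<sigma> = poly_subst const (\<lambda>i. if i = j then yvar j - linear_form r e' else yvar i)"
    have s_var: "\<sigma> (yvar i) = (if i = j then yvar j - linear_form r e' else yvar i)" for i
      by (simp add: \<sigma>_def const_hom.poly_subst_single)
    have s_const: "\<sigma> (const z) = const z" for z
      by (simp add: \<sigma>_def const_hom.poly_subst_single)
    have s_add: "\<sigma> (f + g) = \<sigma> f + \<sigma> g" and s_mult: "\<sigma> (f * g) = \<sigma> f * \<sigma> g" for f g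
      by (simp_all add: \<sigma>_def const_hom.poly_subst_add const_hom.poly_subst_mult)
    have s_lf: "\<sigma> (linear_form r a) = linear_form r (\<lambda>i. a i - a j * e' i)" for a
    proof -
      have "\<sigma> (linear_form r a) = (\<Sum>i<r. const (a i) * \<sigma> (yvar i))"
        unfolding linear_form_alt
        by (simp only: \<sigma>_def const_hom.poly_subst_sum const_hom.poly_subst_mult)
           (simp only: \<sigma>_def[symmetric] s_const)
      also have "\<dots> = (\<Sum>i<r. const (a i) * yvar i - (if i = j then const (a j) * linear_form r e' else 0))"
        by (rule sum.cong) (auto simp: s_var algebra_simps)
      also have "\<dots> = linear_form r a - const (a j) * linear_form r e'"
        using j by (simp add: sum_subtractf linear_form_alt[symmetric])
      finally show ?thesis by (simp add: linear_form_diff linear_form_scale)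
    qed
    have s_e: "\<sigma> (linear_form r e) = 0"
      unfolding s_lf linear_form_eq_0_iff using j by (simp add: e'_def)
    have s_dvd: "linear_form r e dvd f - \<sigma> f" for f
    proof (induction f rule: mpoly_induct)
      case (const a) then show ?case by (simp add: s_const)
    next
      case (var x)
      have "linear_form r e' = linear_form r e * const (inverse (e j))"
        unfolding e'_def linear_form_scale by (rule mult.commute)
      then show ?case by (auto simp: s_var)
    next
      case (add p q)
      have "p + q - \<sigma> (p + q) = (p - \<sigma> p) + (q - \<sigma> q)" by (simp add: s_add)
      then show ?case using add by (metis dvd_add)
    next
      case (mult p q)
      have "p * q - \<sigma> (p * q) = (p - \<sigma> p) * q + \<sigma> p * (q - \<sigma> q)" by (simp add: s_mult algebra_simps)
      then show ?case using mult by (metis dvd_add dvd_mult dvd_mult2)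
    qed
    have e_mem: "linear_form r e \<in> combos r c (insert k K)"
    proof -
      have "linear_form r (c k) - \<phi> (linear_form r (c k)) \<in> combos r c (insert k K)"
        using p(3) sub by blast
      from combos_diff[OF combos_form[of "insert k K" k r c] this] insert e show ?thesis by simp
    qed
    show ?thesis
    proof (intro exI[of _ "\<lambda>f. \<sigma> (\<phi> f)"] conjI allI ballI)
      fix f
      obtain q where q: "\<phi> f - \<sigma> (\<phi> f) = linear_form r e * q" using s_dvd[of "\<phi> f"] by (auto elim: dvdE)
      have eq: "f - \<sigma> (\<phi> f) = (f - \<phi> f) + q * linear_form r e" using q by (simp add: algebra_simps)
      show "f - \<sigma> (\<phi> f) \<in> combos r c (insert k K)"
        unfolding eq by (intro combos_add combos_mult e_mem subsetD[OF sub] p(3))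
    next
      fix k' assume "k' \<in> insert k K"
      moreover have "\<sigma> 0 = 0" using s_const[of 0] by simp
      ultimately show "\<sigma> (\<phi> (linear_form r (c k'))) = 0"
        using p(4) by (cases "k' = k") (simp_all add: e s_e)
    next
      fix a show "\<exists>a'. \<sigma> (\<phi> (linear_form r a)) = linear_form r a'" using p(5)[of a] s_lf by metis
    qed (simp_all only: p(1,2) s_add s_mult)
  qed
qed

lemma independent_form_regular:
  fixes c :: "nat \<Rightarrow> nat \<Rightarrow> 'k::field"
  assumes K: "finite K" "k \<notin> K" and ind: "row_indep r c (insert k K)"
    and mem: "linear_form r (c k) * g \<in> combos r c K"
  shows "g \<in> combos r c K"
proof -
  obtain \<phi> where p: "\<And>f g. \<phi> (f + g) = \<phi> f + \<phi> g" "\<And>f g. \<phi> (f * g) = \<phi> f * \<phi> g"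
     "\<And>f. f - \<phi> f \<in> combos r c K" "\<And>k. k \<in> K \<Longrightarrow> \<phi> (linear_form r (c k)) = 0"
    using elimination[OF K(1), of r c] by blast
  have p0: "\<phi> 0 = 0" using p(1)[of 0 0] by (metis add_0_right add_left_imp_eq)
  have zero: "\<phi> f = 0" if f_mem: "f \<in> combos r c K" for f
  proof -
    obtain a where f: "f = (\<Sum>k\<in>K. linear_form r (c k) * a k)" using f_mem by (rule combosE)
    have "\<phi> (sum h I) = (\<Sum>x\<in>I. \<phi> (h x))" for h and I :: "nat set"
      by (induction I rule: infinite_finite_induct) (simp_all add: p(1) p0)
    then show ?thesis by (simp add: f p(2,4))
  qed
  have nz: "\<phi> (linear_form r (c k)) \<noteq> 0"
  proof
    assume "\<phi> (linear_form r (c k)) = 0"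
    then have "linear_form r (c k) \<in> combos r c K" using p(3)[of "linear_form r (c k)"] by simp
    then obtain a where a: "linear_form r (c k) = (\<Sum>k\<in>K. linear_form r (c k) * a k)"
      by (rule combosE)
    have ckj: "c k j = (\<Sum>k\<in>K. c k j * lookup (a k) 0)" if "j < r" for j
      using arg_cong[OF a, of "\<lambda>f. lookup f (Poly_Mapping.single j (Suc 0))"] that
      by (simp add: lookup_sum lookup_mult_linear_form lookup_linear_form_var)
    have "(\<Sum>k'\<in>insert k K. (if k' = k then - 1 else lookup (a k') 0) * c k' j) = 0" if "j < r" for j
    proof -
      have "(\<Sum>k'\<in>K. (if k' = k then - 1 else lookup (a k') 0) * c k' j) = (\<Sum>k'\<in>K. c k' j * lookup (a k') 0)"
        by (rule sum.cong) (use K in auto)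
      then show ?thesis using K ckj[OF that] by simp
    qed
    from row_indepD[OF ind this, of k] show False by simp
  qed
  have "\<phi> (linear_form r (c k)) * \<phi> g = 0" using zero[OF mem] by (simp only: p(2))
  then have "\<phi> g = 0" using nz by simp
  then show ?thesis using p(3)[of g] by simp
qed

section \<open>Weight filtrations on a polynomial ring\<close>

definition wt :: "(nat \<Rightarrow> int) \<Rightarrow> (nat \<Rightarrow>\<^sub>0 nat) \<Rightarrow> int" where
  "wt a m = (\<Sum>j\<in>keys m. a j * int (lookup m j))"

lemma wt_superset: "finite S \<Longrightarrow> keys m \<subseteq> S \<Longrightarrow> wt a m = (\<Sum>j\<in>S. a j * int (lookup m j))"
  unfolding wt_def by (rule sum.mono_neutral_left) (auto simp: in_keys_iff)

lemma wt_0 [simp]: "wt a 0 = 0"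
  by (simp add: wt_def)

lemma wt_add: "wt a (m + m') = wt a m + wt a m'"
proof -
  let ?S = "keys m \<union> keys m'"
  have "keys (m + m') \<subseteq> ?S" by (rule keys_add)
  then show ?thesis
    by (simp add: wt_superset[of ?S] lookup_add distrib_left sum.distrib)
qed

lemma wt_single [simp]: "wt a (Poly_Mapping.single j n) = a j * int n"
  by (simp add: wt_def)

locale weighted_forms =
  fixes r :: nat and u :: "nat \<Rightarrow> nat \<Rightarrow> int" and w :: "nat \<Rightarrow> nat \<Rightarrow> int"
begin

text \<open>The component of degree \<open>\<delta>\<close> of \<open>k[X, Y]\<close> with \<open>X\<^sub>i\<close> inverted for all \<open>i \<notin> A\<close>, after setting
  all \<open>X\<^sub>i\<close> to \<open>1\<close>. Multiplication by \<open>X\<^sub>i\<close> becomes the inclusion into the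
  space in which the bound \<open>\<delta> i\<close> is lowered by \<open>1\<close>.\<close>

definition filt :: "nat set \<Rightarrow> (nat \<Rightarrow> int) \<Rightarrow> (nat, 'k::field) mpoly set" where
  "filt A \<delta> = {g. \<forall>m\<in>keys g. keys m \<subseteq> {..<r} \<and> (\<forall>i\<in>A. \<delta> i \<le> wt (u i) m)}"

lemma filtI:
  "(\<And>m. m \<in> keys g \<Longrightarrow> keys m \<subseteq> {..<r}) \<Longrightarrow> (\<And>m i. m \<in> keys g \<Longrightarrow> i \<in> A \<Longrightarrow> \<delta> i \<le> wt (u i) m) \<Longrightarrow> g \<in> filt A \<delta>"
  by (auto simp: filt_def)

lemma filtD:
  "g \<in> filt A \<delta> \<Longrightarrow> m \<in> keys g \<Longrightarrow> keys m \<subseteq> {..<r}"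
  "g \<in> filt A \<delta> \<Longrightarrow> m \<in> keys g \<Longrightarrow> i \<in> A \<Longrightarrow> \<delta> i \<le> wt (u i) m"
  by (auto simp: filt_def)

lemma filt_0 [simp]: "0 \<in> filt A \<delta>"
  by (simp add: filt_def)

lemma filt_add: "f \<in> filt A \<delta> \<Longrightarrow> g \<in> filt A \<delta> \<Longrightarrow> f + g \<in> filt A \<delta>"
  using keys_add[of f g] unfolding filt_def by blast

lemma filt_uminus: "f \<in> filt A \<delta> \<Longrightarrow> - f \<in> filt A \<delta>"
  by (simp add: filt_def in_keys_iff)

lemma filt_diff: "f \<in> filt A \<delta> \<Longrightarrow> g \<in> filt A \<delta> \<Longrightarrow> f - g \<in> filt A \<delta>"
  using filt_add[of f A \<delta> "- g"] filt_uminus[of g A \<delta>] by simp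

lemma filt_sum: "(\<And>x. x \<in> T \<Longrightarrow> f x \<in> filt A \<delta>) \<Longrightarrow> sum f T \<in> filt A \<delta>"
  by (induction T rule: infinite_finite_induct) (simp_all add: filt_add)

lemma filt_mult:
  assumes "f \<in> filt A \<delta>" "g \<in> filt A \<epsilon>" shows "f * g \<in> filt A (\<lambda>i. \<delta> i + \<epsilon> i)"
proof (rule filtI)
  fix m assume "m \<in> keys (f * g)"
  then obtain a b where "a \<in> keys f" "b \<in> keys g" "m = a + b" by (rule keys_mult_mem)
  then show "keys m \<subseteq> {..<r}" using keys_add[of a b] filtD(1)[OF assms(1)] filtD(1)[OF assms(2)] by blast
next
  fix m i assume "m \<in> keys (f * g)" and i: "i \<in> A"
  then obtain a b where "a \<in> keys f" "b \<in> keys g" "m = a + b" by (blast elim: keys_mult_mem)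
  then show "\<delta> i + \<epsilon> i \<le> wt (u i) m"
    using filtD(2)[OF assms(1) _ i] filtD(2)[OF assms(2) _ i] by (simp add: wt_add add_mono)
qed

lemma filt_mono: "f \<in> filt A \<delta> \<Longrightarrow> A' \<subseteq> A \<Longrightarrow> (\<And>i. i \<in> A' \<Longrightarrow> \<epsilon> i \<le> \<delta> i) \<Longrightarrow> f \<in> filt A' \<epsilon>"
  unfolding filt_def by (blast intro: order_trans)

lemma filt_mult':
  "f \<in> filt A \<delta> \<Longrightarrow> g \<in> filt A \<epsilon> \<Longrightarrow> (\<And>i. i \<in> A \<Longrightarrow> \<eta> i \<le> \<delta> i + \<epsilon> i) \<Longrightarrow> f * g \<in> filt A \<eta>"
  by (rule filt_mono[OF filt_mult]) auto

lemma filt_restr: "f \<in> filt A \<delta> \<Longrightarrow> restr S f \<in> filt A \<delta>"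
  by (simp add: filt_def)

lemma filt_const: "const a \<in> filt A (\<lambda>i. 0)"
  by (rule filtI) (auto split: if_splits)

text \<open>The exponents of the \<open>X\<^sub>i\<close>, \<open>i \<in> A\<close>, in the \<open>p\<^sub>k\<close> are nonnegative.\<close>

definition admissible :: "(nat \<Rightarrow> nat \<Rightarrow> 'k::field) \<Rightarrow> nat set \<Rightarrow> nat set \<Rightarrow> bool" where
  "admissible c K A \<longleftrightarrow> (\<forall>k\<in>K. \<forall>j<r. c k j \<noteq> 0 \<longrightarrow> (\<forall>i\<in>A. w k i \<le> u i j))"

lemma admissible_mono: "admissible c K A \<Longrightarrow> K' \<subseteq> K \<Longrightarrow> A' \<subseteq> A \<Longrightarrow> admissible c K' A'"
  unfolding admissible_def by blast

lemma linear_form_filt: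
  "(\<And>j i. j < r \<Longrightarrow> a j \<noteq> 0 \<Longrightarrow> i \<in> A \<Longrightarrow> \<delta> i \<le> u i j) \<Longrightarrow> linear_form r a \<in> filt A \<delta>"
  by (rule filtI) (auto simp: keys_linear_form)

lemma form_filt: "admissible c K A \<Longrightarrow> k \<in> K \<Longrightarrow> linear_form r (c k) \<in> filt A (w k)"
  by (rule linear_form_filt) (auto simp: admissible_def)

text \<open>The component of degree \<open>\<delta>\<close> of the ideal generated by the \<open>p\<^sub>k\<close>, which are homogeneous of degree
  \<open>w k\<close>. For \<open>A = {}\<close> the degree does not matter, and the space is the ideal of the linear forms in
  the variables below \<open>r\<close>.\<close>

definition rel :: "(nat \<Rightarrow> nat \<Rightarrow> 'k::field) \<Rightarrow> nat set \<Rightarrow> nat set \<Rightarrow> (nat \<Rightarrow> int) \<Rightarrow> (nat, 'k) mpoly set" where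
  "rel c K A \<delta> = {(\<Sum>k\<in>K. linear_form r (c k) * g k) | g. \<forall>k\<in>K. g k \<in> filt A (\<lambda>i. \<delta> i - w k i)}"

lemma relI:
  "f = (\<Sum>k\<in>K. linear_form r (c k) * g k) \<Longrightarrow> (\<And>k. k \<in> K \<Longrightarrow> g k \<in> filt A (\<lambda>i. \<delta> i - w k i)) \<Longrightarrow> f \<in> rel c K A \<delta>"
  unfolding rel_def by blast

lemma relE:
  assumes "f \<in> rel c K A \<delta>"
  obtains g where "f = (\<Sum>k\<in>K. linear_form r (c k) * g k)" "\<forall>k\<in>K. g k \<in> filt A (\<lambda>i. \<delta> i - w k i)"
  using assms unfolding rel_def by blast

lemma rel_0 [simp]: "0 \<in> rel c K A \<delta>"
  by (rule relI[where g = "\<lambda>_. 0"]) auto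

lemma rel_empty_forms: "rel c {} A \<delta> = {0}"
  unfolding rel_def by auto

lemma rel_add:
  assumes "f \<in> rel c K A \<delta>" "f' \<in> rel c K A \<delta>" shows "f + f' \<in> rel c K A \<delta>"
proof -
  obtain g where g: "f = (\<Sum>k\<in>K. linear_form r (c k) * g k)" "\<forall>k\<in>K. g k \<in> filt A (\<lambda>i. \<delta> i - w k i)"
    using assms(1) by (rule relE)
  obtain g' where g': "f' = (\<Sum>k\<in>K. linear_form r (c k) * g' k)" "\<forall>k\<in>K. g' k \<in> filt A (\<lambda>i. \<delta> i - w k i)"
    using assms(2) by (rule relE)
  show ?thesis
    by (rule relI[where g = "\<lambda>k. g k + g' k"]) (simp_all add: g g' distrib_left sum.distrib filt_add)
qed

lemma rel_mult:
  assumes "f \<in> rel c K A \<delta>" "h \<in> filt A \<epsilon>" "\<And>i. i \<in> A \<Longrightarrow> \<eta> i \<le> \<delta> i + \<epsilon> i"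
  shows "h * f \<in> rel c K A \<eta>"
proof -
  obtain g where g: "f = (\<Sum>k\<in>K. linear_form r (c k) * g k)" "\<forall>k\<in>K. g k \<in> filt A (\<lambda>i. \<delta> i - w k i)"
    using assms(1) by (rule relE)
  show ?thesis
  proof (rule relI[where g = "\<lambda>k. h * g k"])
    show "h * f = (\<Sum>k\<in>K. linear_form r (c k) * (h * g k))"
      by (simp add: g(1) sum_distrib_left mult.left_commute)
    show "h * g k \<in> filt A (\<lambda>i. \<eta> i - w k i)" if "k \<in> K" for k
      by (rule filt_mult'[OF assms(2) bspec[OF g(2) that]]) (use assms(3) in force)
  qed
qed

lemma rel_uminus: "f \<in> rel c K A \<delta> \<Longrightarrow> - f \<in> rel c K A \<delta>"
  using rel_mult[of f c K A \<delta> "const (- 1)" "\<lambda>_. 0" \<delta>] filt_const[of "- 1" A]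
  by (simp add: single_uminus)

lemma rel_diff: "f \<in> rel c K A \<delta> \<Longrightarrow> g \<in> rel c K A \<delta> \<Longrightarrow> f - g \<in> rel c K A \<delta>"
  using rel_add[of f c K A \<delta> "- g"] rel_uminus[of g c K A \<delta>] by simp

lemma rel_sum: "(\<And>x. x \<in> T \<Longrightarrow> f x \<in> rel c K A \<delta>) \<Longrightarrow> sum f T \<in> rel c K A \<delta>"
  by (induction T rule: infinite_finite_induct) (simp_all add: rel_add)

lemma rel_mono:
  assumes "f \<in> rel c K A \<delta>" "A' \<subseteq> A" "\<And>i. i \<in> A' \<Longrightarrow> \<epsilon> i \<le> \<delta> i"
  shows "f \<in> rel c K A' \<epsilon>"
proof -
  obtain g where g: "f = (\<Sum>k\<in>K. linear_form r (c k) * g k)" "\<forall>k\<in>K. g k \<in> filt A (\<lambda>i. \<delta> i - w k i)"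
    using assms(1) by (rule relE)
  show ?thesis
    by (rule relI[OF g(1)], rule filt_mono[OF bspec[OF g(2)]]) (use assms in auto)
qed

lemma rel_filt:
  assumes "admissible c K A" "f \<in> rel c K A \<delta>" shows "f \<in> filt A \<delta>"
proof -
  obtain g where g: "f = (\<Sum>k\<in>K. linear_form r (c k) * g k)" "\<forall>k\<in>K. g k \<in> filt A (\<lambda>i. \<delta> i - w k i)"
    using assms(2) by (rule relE)
  show ?thesis unfolding g(1)
    by (rule filt_sum, rule filt_mult'[OF form_filt[OF assms(1)] bspec[OF g(2)]]) auto
qed

lemma rel_insertI:
  assumes "finite K" "k \<notin> K" "f - linear_form r (c k) * h \<in> rel c K A \<delta>" "h \<in> filt A (\<lambda>i. \<delta> i - w k i)"
  shows "f \<in> rel c (insert k K) A \<delta>"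
proof -
  obtain g where g: "f - linear_form r (c k) * h = (\<Sum>k\<in>K. linear_form r (c k) * g k)"
      "\<forall>k\<in>K. g k \<in> filt A (\<lambda>i. \<delta> i - w k i)"
    using assms(3) by (rule relE)
  have s: "(\<Sum>k'\<in>K. linear_form r (c k') * (if k' = k then h else g k')) = (\<Sum>k'\<in>K. linear_form r (c k') * g k')"
    by (rule sum.cong) (use assms in auto)
  show ?thesis
  proof (rule relI[where g = "\<lambda>k'. if k' = k then h else g k'"])
    show "f = (\<Sum>k'\<in>insert k K. linear_form r (c k') * (if k' = k then h else g k'))"
      using assms(1,2) g(1) by (simp add: s algebra_simps)
  qed (use g assms(4) in auto)
qed

lemma rel_insertE:
  assumes "finite K" "k \<notin> K" "f \<in> rel c (insert k K) A \<delta>"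
  obtains h where "f - linear_form r (c k) * h \<in> rel c K A \<delta>" "h \<in> filt A (\<lambda>i. \<delta> i - w k i)"
proof -
  obtain g where g: "f = (\<Sum>k\<in>insert k K. linear_form r (c k) * g k)"
      "\<forall>k'\<in>insert k K. g k' \<in> filt A (\<lambda>i. \<delta> i - w k' i)"
    using assms(3) by (rule relE)
  show ?thesis
  proof (rule that)
    show "g k \<in> filt A (\<lambda>i. \<delta> i - w k i)" using g(2) by simp
    show "f - linear_form r (c k) * g k \<in> rel c K A \<delta>"
      by (rule relI[where g = g]) (use assms g in auto)
  qed
qed

lemma rel_mono_forms:
  assumes "finite K" "K' \<subseteq> K" "f \<in> rel c K' A \<delta>" shows "f \<in> rel c K A \<delta>"
proof -
  obtain g where g: "f = (\<Sum>k\<in>K'. linear_form r (c k) * g k)" "\<forall>k\<in>K'. g k \<in> filt A (\<lambda>i. \<delta> i - w k i)"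
    using assms(3) by (rule relE)
  show ?thesis
  proof (rule relI[where g = "\<lambda>k. if k \<in> K' then g k else 0"])
    show "f = (\<Sum>k\<in>K. linear_form r (c k) * (if k \<in> K' then g k else 0))"
      unfolding g(1) by (rule sum.mono_neutral_cong_left) (use assms in auto)
  qed (use g in auto)
qed

lemma rel_combos:
  "f \<in> rel c K {} \<delta> \<longleftrightarrow> f \<in> combos r c K \<and> f \<in> filt {} \<epsilon>"
proof
  assume "f \<in> rel c K {} \<delta>"
  then obtain g where g: "f = (\<Sum>k\<in>K. linear_form r (c k) * g k)" "\<forall>k\<in>K. g k \<in> filt {} (\<lambda>i. \<delta> i - w k i)"
    by (rule relE)
  have "f \<in> filt {} \<epsilon>" unfolding g(1)
    by (rule filt_sum, rule filt_mult'[OF linear_form_filt[where \<delta> = "\<lambda>_. 0"] bspec[OF g(2)]]) auto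
  then show "f \<in> combos r c K \<and> f \<in> filt {} \<epsilon>" using combos_memI[OF g(1)] by simp
next
  assume f: "f \<in> combos r c K \<and> f \<in> filt {} \<epsilon>"
  then obtain g where g: "f = (\<Sum>k\<in>K. linear_form r (c k) * g k)" by (auto elim: combosE)
  let ?S = "{m. keys m \<subseteq> {..<r}}"
  have "f = restr ?S f" by (rule restr_id[symmetric]) (use f in \<open>auto dest: filtD\<close>)
  also have "\<dots> = (\<Sum>k\<in>K. restr ?S (linear_form r (c k) * g k))" by (simp only: g restr_sum)
  also have "\<dots> = (\<Sum>k\<in>K. linear_form r (c k) * restr ?S (g k))"
  proof (rule sum.cong[OF refl], rule restr_mult)
    fix k m and m' :: "nat \<Rightarrow>\<^sub>0 nat" assume "m \<in> keys (linear_form r (c k))"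
    then obtain j where j: "j < r" "m = Poly_Mapping.single j (Suc 0)" by (auto simp: keys_linear_form)
    have "keys (m + m') = insert j (keys m')" unfolding j
      by (auto simp: in_keys_iff lookup_add lookup_single when_def split: if_splits)
    then show "m + m' \<in> ?S \<longleftrightarrow> m' \<in> ?S" using j by auto
  qed
  finally show "f \<in> rel c K {} \<delta>"
    by (rule relI) (rule filtI, auto)
qed

lemma rel_eq_combos: "f \<in> rel c K {} \<delta> \<longleftrightarrow> f \<in> rel c K {} \<epsilon>"
  using rel_combos[of f c K \<delta> \<epsilon>] rel_combos[of f c K \<epsilon> \<epsilon>] by simp

text \<open>The \<open>X\<^sub>i\<close>, \<open>i \<in> A\<close>, are nonzero divisors modulo the ideal of the \<open>p\<^sub>k\<close>: an element that lies
  in this ideal after inverting them lies in it already.\<close>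

definition saturated :: "(nat \<Rightarrow> nat \<Rightarrow> 'k::field) \<Rightarrow> nat set \<Rightarrow> nat set \<Rightarrow> bool" where
  "saturated c K A \<longleftrightarrow> (\<forall>\<delta> f. f \<in> rel c K {} \<delta> \<longrightarrow> f \<in> filt A \<delta> \<longrightarrow> f \<in> rel c K A \<delta>)"

lemma saturated_empty: "saturated c K {}"
  by (simp add: saturated_def)

text \<open>In the directions outside \<open>A'\<close> the bounds can be chosen so low that they do not exclude any
  monomial of a given polynomial.\<close>

lemma saturated_mono:
  assumes sat: "saturated c K A" and sub: "A' \<subseteq> A" shows "saturated c K A'"
  unfolding saturated_def
proof (intro allI impI)
  fix \<delta> f assume f: "f \<in> rel c K {} \<delta>" "f \<in> filt A' \<delta>"
  define \<delta>' where "\<delta>' = (\<lambda>i. if i \<in> A' then \<delta> i else Min (insert 0 (wt (u i) ` keys f)))"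
  have "f \<in> filt A \<delta>'"
  proof (rule filtI)
    fix m i assume "m \<in> keys f" "i \<in> A"
    then show "\<delta>' i \<le> wt (u i) m" using filtD(2)[OF f(2)] by (auto simp: \<delta>'_def)
  qed (rule filtD(1)[OF f(2)])
  then have "f \<in> rel c K A \<delta>'" using sat f(1) rel_eq_combos unfolding saturated_def by blast
  then show "f \<in> rel c K A' \<delta>" by (rule rel_mono) (use sub in \<open>auto simp: \<delta>'_def\<close>)
qed

text \<open>A saturated quotient embeds into its localization, a polynomial ring modulo independent linear
  forms, which is a domain.\<close>

lemma form_regular:
  assumes "finite K" "k \<notin> K" "row_indep r c (insert k K)" "saturated c K A"
    and g: "g \<in> filt A \<delta>" and mem: "linear_form r (c k) * g \<in> rel c K A \<epsilon>"
  shows "g \<in> rel c K A \<delta>"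
proof -
  have "linear_form r (c k) * g \<in> combos r c K"
    using rel_mono[OF mem, of "{}" \<delta>] rel_combos by blast
  then have "g \<in> combos r c K" by (rule independent_form_regular[OF assms(1-3)])
  moreover have "g \<in> filt {} \<delta>" using g by (rule filt_mono) auto
  ultimately have "g \<in> rel c K {} \<delta>" using rel_combos by blast
  then show ?thesis using assms(4) g unfolding saturated_def by blast
qed

end

section \<open>Koszul cochains\<close>

definition ksign :: "nat \<Rightarrow> nat set \<Rightarrow> 'a::comm_ring_1" where
  "ksign l B = (- 1) ^ card {b \<in> B. b < l}"

text \<open>The Koszul differential. The variables act as inclusions between the filtration steps, so that
  only the signs remain.\<close>

definition cobd :: "(nat set \<Rightarrow> 'a::comm_ring_1) \<Rightarrow> nat set \<Rightarrow> 'a" where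
  "cobd x B = (\<Sum>l\<in>B. ksign l B * x (B - {l}))"

text \<open>Contraction with a basis vector, a null homotopy for multiplication by the corresponding variable.\<close>

definition contr :: "nat \<Rightarrow> (nat set \<Rightarrow> 'a::comm_ring_1) \<Rightarrow> nat set \<Rightarrow> 'a" where
  "contr l x B = (if l \<in> B then 0 else ksign l B * x (insert l B))"

lemma ksign_cases: "ksign l B = (1 :: 'a) \<or> ksign l B = (- 1 :: 'a::comm_ring_1)"
  unfolding ksign_def by (cases "even (card {b \<in> B. b < l})") simp_all

lemma ksign_sq: "ksign l B * (ksign l B * x) = (x :: 'a::comm_ring_1)"
  using ksign_cases[of l B, where ?'a = 'a] by (elim disjE) simp_all

lemma ksign_self: "ksign l (B - {l}) = (ksign l B :: 'a::comm_ring_1)" "ksign l (insert l B) = (ksign l B :: 'a::comm_ring_1)"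
proof -
  have "{b \<in> B - {l}. b < l} = {b \<in> B. b < l}" "{b \<in> insert l B. b < l} = {b \<in> B. b < l}" by auto
  then show "ksign l (B - {l}) = (ksign l B :: 'a)" "ksign l (insert l B) = (ksign l B :: 'a)"
    by (simp_all add: ksign_def)
qed

lemma ksign_remove:
  assumes "finite B" "l \<in> B" "l < l'"
  shows "ksign l' B = - (ksign l' (B - {l}) :: 'a::comm_ring_1)" "ksign l (B - {l'}) = (ksign l B :: 'a)"
proof -
  have "{b \<in> B. b < l'} = insert l {b \<in> B - {l}. b < l'}" using assms by auto
  moreover have "finite {b \<in> B - {l}. b < l'}" "l \<notin> {b \<in> B - {l}. b < l'}" using assms(1) by auto
  ultimately have "card {b \<in> B. b < l'} = Suc (card {b \<in> B - {l}. b < l'})" by simp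
  then show "ksign l' B = - (ksign l' (B - {l}) :: 'a)" by (simp add: ksign_def)
  have "{b \<in> B - {l'}. b < l} = {b \<in> B. b < l}" using assms(3) by auto
  then show "ksign l (B - {l'}) = (ksign l B :: 'a)" by (simp add: ksign_def)
qed

lemma ksign_swap:
  assumes "finite B" "l \<in> B" "l' \<in> B" "l \<noteq> l'"
  shows "ksign l B * ksign l' (B - {l}) = - (ksign l' B * ksign l (B - {l'}) :: 'a::comm_ring_1)"
proof (cases "l < l'")
  case True
  then show ?thesis using ksign_remove[OF assms(1,2) True, where ?'a = 'a] by simp
next
  case False
  then have "l' < l" using assms by simp
  then show ?thesis using ksign_remove[OF assms(1,3) \<open>l' < l\<close>, where ?'a = 'a] by simp
qed

text \<open>The pairs with \<open>l < l'\<close> cancel against those with \<open>l' < l\<close>; this way of cancelling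
  works in every characteristic.\<close>

lemma cobd_cobd:
  assumes "finite B" shows "cobd (cobd x) B = (0 :: 'a::comm_ring_1)"
proof -
  define f where "f = (\<lambda>l l'. ksign l B * ksign l' (B - {l}) * x (B - {l} - {l'}))"
  have anti: "f l' l = - f l l'" if "l \<in> B" "l' \<in> B" "l < l'" for l l'
  proof -
    have "B - {l} - {l'} = B - {l'} - {l}" by auto
    then show ?thesis using ksign_swap[OF assms that(1,2), where ?'a = 'a] that(3) by (simp add: f_def)
  qed
  have "cobd (cobd x) B = (\<Sum>l\<in>B. \<Sum>l'\<in>B - {l}. f l l')"
    by (simp add: cobd_def f_def sum_distrib_left mult.assoc)
  also have "\<dots> = (\<Sum>l\<in>B. (\<Sum>l' | l' \<in> B \<and> l < l'. f l l') + (\<Sum>l' | l' \<in> B \<and> l' < l. f l l'))"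
  proof (rule sum.cong[OF refl])
    fix l assume "l \<in> B"
    have split: "B - {l} = {l' \<in> B. l < l'} \<union> {l' \<in> B. l' < l}" by auto
    show "(\<Sum>l'\<in>B - {l}. f l l') = (\<Sum>l' | l' \<in> B \<and> l < l'. f l l') + (\<Sum>l' | l' \<in> B \<and> l' < l. f l l')"
      by (subst split, rule sum.union_disjoint) (use assms in auto)
  qed
  also have "\<dots> = (\<Sum>l\<in>B. \<Sum>l' | l' \<in> B \<and> l < l'. f l l') + (\<Sum>l\<in>B. \<Sum>l' | l' \<in> B \<and> l' < l. f l l')"
    by (rule sum.distrib)
  also have "(\<Sum>l\<in>B. \<Sum>l' | l' \<in> B \<and> l' < l. f l l') = (\<Sum>l'\<in>B. \<Sum>l | l \<in> B \<and> l' < l. f l l')"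
    by (rule sum.swap_restrict[OF assms assms])
  also have "\<dots> = (\<Sum>l\<in>B. \<Sum>l' | l' \<in> B \<and> l < l'. - f l l')"
    by (intro sum.cong refl) (auto simp: anti)
  finally show ?thesis by (simp add: sum_negf)
qed

lemma contr_homotopy:
  assumes "finite B" shows "cobd (contr l x) B + contr l (cobd x) B = (x B :: 'a::comm_ring_1)"
proof (cases "l \<in> B")
  case True
  have "cobd (contr l x) B = (\<Sum>b\<in>B. if b = l then x B else 0)"
    unfolding cobd_def
  proof (rule sum.cong[OF refl])
    fix b assume b: "b \<in> B"
    show "ksign b B * contr l x (B - {b}) = (if b = l then x B else 0)"
    proof (cases "b = l")
      case True
      then have "insert l (B - {b}) = B" using b by auto
      then show ?thesis using True by (simp add: contr_def ksign_self ksign_sq)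
    qed (use \<open>l \<in> B\<close> in \<open>simp add: contr_def\<close>)
  qed
  then show ?thesis using True assms by (simp add: contr_def)
next
  case False
  have "contr l (cobd x) B = ksign l B * (ksign l (insert l B) * x B + (\<Sum>b\<in>B. ksign b (insert l B) * x (insert l B - {b})))"
    using False assms by (simp add: contr_def cobd_def)
  also have "\<dots> = x B + (\<Sum>b\<in>B. ksign l B * ksign b (insert l B) * x (insert l B - {b}))"
    by (simp add: ksign_self ksign_sq distrib_left sum_distrib_left mult.assoc)
  also have "(\<Sum>b\<in>B. ksign l B * ksign b (insert l B) * x (insert l B - {b})) = - cobd (contr l x) B"
    unfolding cobd_def sum_negf[symmetric]
  proof (rule sum.cong[OF refl])
    fix b assume b: "b \<in> B"
    with False have bl: "b \<noteq> l" by auto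
    then have 1: "insert l (B - {b}) = insert l B - {b}" by auto
    have 2: "insert l B - {l} = B" using False by auto
    have "ksign l (insert l B) * ksign b (insert l B - {l}) = - (ksign b (insert l B) * ksign l (insert l B - {b}) :: 'a)"
      by (rule ksign_swap) (use assms b bl in auto)
    then have 3: "ksign l B * ksign b B = - (ksign b (insert l B) * ksign l (B - {b}) :: 'a)"
      unfolding 2 1[symmetric] by (simp add: ksign_self)
    have 4: "ksign l B * ksign b (insert l B) = - (ksign b B * ksign l (B - {b}) :: 'a)"
    proof -
      have "ksign l B * ksign b (insert l B) = ksign b B * (ksign b B * (ksign l B * ksign b (insert l B) :: 'a))"
        by (simp add: ksign_sq)
      also have "\<dots> = ksign b B * ksign b (insert l B) * (ksign l B * ksign b B)" by (simp add: mult_ac)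
      also have "\<dots> = - (ksign b B * ksign l (B - {b}) * (ksign b (insert l B) * (ksign b (insert l B) * 1)))"
        unfolding 3 by (simp add: mult_ac)
      finally show ?thesis by (simp only: ksign_sq) simp
    qed
    show "ksign l B * ksign b (insert l B) * x (insert l B - {b}) = - (ksign b B * contr l x (B - {b}))"
      using False 4 by (simp add: contr_def 1 mult.assoc[symmetric])
  qed
  finally show ?thesis by simp
qed

lemma cobd_add: "cobd (\<lambda>B. x B + y B) B = cobd x B + cobd y B"
  by (simp add: cobd_def distrib_left sum.distrib)

lemma cobd_diff: "cobd (\<lambda>B. x B - y B) B = cobd x B - cobd y B"
  by (simp add: cobd_def right_diff_distrib sum_subtractf)

lemma cobd_mult: "cobd (\<lambda>B. g * x B) B = g * cobd x B"
  by (simp add: cobd_def sum_distrib_left mult.left_commute)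

lemma cobd_sum: "cobd (\<lambda>B. \<Sum>i\<in>I. x i B) B = (\<Sum>i\<in>I. cobd (x i) B)"
proof -
  have "cobd (\<lambda>B. 0) B = (0 :: 'a)" for B by (simp add: cobd_def)
  then show ?thesis
    by (induction I rule: infinite_finite_induct) (simp_all add: cobd_add)
qed

lemma cobd_empty [simp]: "cobd x {} = 0"
  by (simp add: cobd_def)

lemma restr_ksign: "restr S (ksign l B * g) = ksign l B * restr S (g :: 'e::comm_monoid_add \<Rightarrow>\<^sub>0 'k::comm_ring_1)"
  using ksign_cases[of l B, where ?'a = "'e \<Rightarrow>\<^sub>0 'k"] restr_diff[of S 0 g] by (elim disjE) simp_all

lemma cobd_restr: "cobd (\<lambda>B. restr S (x B)) B = restr S (cobd x B :: 'e::comm_monoid_add \<Rightarrow>\<^sub>0 'k::comm_ring_1)"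
  by (simp add: cobd_def restr_sum restr_ksign)

text \<open>The Koszul complex in degree \<open>\<delta>\<close>: each variable indexed by \<open>B\<close> shifts the degree by one.\<close>

definition lower :: "(nat \<Rightarrow> int) \<Rightarrow> nat set \<Rightarrow> nat \<Rightarrow> int" where
  "lower \<delta> B = (\<lambda>l. \<delta> l - (if l \<in> B then 1 else 0))"

context weighted_forms
begin

lemma filt_ksign: "ksign l B * (g :: (nat, 'k::field) mpoly) \<in> filt A \<delta> \<longleftrightarrow> g \<in> filt A \<delta>"
  using ksign_cases[of l B, where ?'a = "(nat, 'k) mpoly"] filt_uminus[of g A \<delta>] filt_uminus[of "- g" A \<delta>] by (elim disjE) auto

lemma rel_ksign: "(g :: (nat, 'k::field) mpoly) \<in> rel c K A \<delta> \<Longrightarrow> ksign l B * g \<in> rel c K A \<delta>"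
  using ksign_cases[of l B, where ?'a = "(nat, 'k) mpoly"] rel_uminus[of g c K A \<delta>] by (elim disjE) auto

definition cochain :: "nat set \<Rightarrow> nat \<Rightarrow> (nat \<Rightarrow> int) \<Rightarrow> (nat set \<Rightarrow> (nat, 'k::field) mpoly) set" where
  "cochain A i \<delta> = {x. \<forall>B\<subseteq>A. card B = i \<longrightarrow> x B \<in> filt A (lower \<delta> B)}"

text \<open>Vanishing of the \<open>i\<close>-th Koszul cohomology, with respect to the variables indexed by \<open>A\<close>, of the
  quotient by the \<open>p\<^sub>k\<close>. For \<open>i = 0\<close> the primitive \<open>y\<close> is unconstrained but \<open>cobd y {} = 0\<close>.\<close>

definition koszul_acyclic :: "(nat \<Rightarrow> nat \<Rightarrow> 'k::field) \<Rightarrow> nat set \<Rightarrow> nat set \<Rightarrow> nat \<Rightarrow> bool" where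
  "koszul_acyclic c K A i \<longleftrightarrow> (\<forall>\<delta> x. x \<in> cochain A i \<delta> \<longrightarrow>
     (\<forall>B\<subseteq>A. card B = Suc i \<longrightarrow> cobd x B \<in> rel c K A (lower \<delta> B)) \<longrightarrow>
     (\<exists>y. (\<forall>B\<subseteq>A. Suc (card B) = i \<longrightarrow> y B \<in> filt A (lower \<delta> B)) \<and>
          (\<forall>B\<subseteq>A. card B = i \<longrightarrow> x B - cobd y B \<in> rel c K A (lower \<delta> B))))"

lemma cochainD: "x \<in> cochain A i \<delta> \<Longrightarrow> B \<subseteq> A \<Longrightarrow> card B = i \<Longrightarrow> x B \<in> filt A (lower \<delta> B)"
  unfolding cochain_def by blast

lemma cobd_filt:
  assumes "finite A" "B \<subseteq> A" "card B = Suc i" "x \<in> cochain A i \<delta>"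
  shows "cobd x B \<in> filt A (lower \<delta> B)"
  unfolding cobd_def
proof (rule filt_sum)
  fix l assume l: "l \<in> B"
  have "x (B - {l}) \<in> filt A (lower \<delta> (B - {l}))"
    by (rule cochainD[OF assms(4)]) (use assms l in auto)
  then have "x (B - {l}) \<in> filt A (lower \<delta> B)"
    by (rule filt_mono) (auto simp: lower_def)
  then show "ksign l B * x (B - {l}) \<in> filt A (lower \<delta> B)" by (simp add: filt_ksign)
qed

lemma cobd_rel:
  assumes "finite A" "B \<subseteq> A" "card B = Suc i"
    and x: "\<And>B. B \<subseteq> A \<Longrightarrow> card B = i \<Longrightarrow> x B \<in> rel c K A (lower \<delta> B)"
  shows "cobd x B \<in> rel c K A (lower \<delta> B)"
  unfolding cobd_def
proof (rule rel_sum)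
  fix l assume l: "l \<in> B"
  have "x (B - {l}) \<in> rel c K A (lower \<delta> (B - {l}))"
    by (rule x) (use assms l in auto)
  then have "x (B - {l}) \<in> rel c K A (lower \<delta> B)"
    by (rule rel_mono) (auto simp: lower_def)
  then show "ksign l B * x (B - {l}) \<in> rel c K A (lower \<delta> B)" by (rule rel_ksign)
qed

text \<open>Monomials that reach the bound in the direction \<open>l\<close>; taking the first such direction makes the
  slots disjoint.\<close>

definition slot :: "nat set \<Rightarrow> (nat \<Rightarrow> int) \<Rightarrow> nat \<Rightarrow> (nat \<Rightarrow>\<^sub>0 nat) set" where
  "slot A \<delta> l = {m. \<delta> l \<le> wt (u l) m \<and> (\<forall>l'\<in>A. l' < l \<longrightarrow> wt (u l') m < \<delta> l')}"

lemma slot_decomp: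
  assumes A: "finite A" and g: "\<And>m. m \<in> keys g \<Longrightarrow> \<exists>l\<in>A. \<delta> l \<le> wt (u l) m"
  shows "g = (\<Sum>l\<in>A. restr (slot A \<delta> l) g)"
proof (rule poly_mapping_eqI)
  fix m
  show "lookup g m = lookup (\<Sum>l\<in>A. restr (slot A \<delta> l) g) m"
  proof (cases "m \<in> keys g")
    case False
    then have "lookup g m = 0" by (simp add: in_keys_iff)
    then have "(\<Sum>l\<in>A. lookup (restr (slot A \<delta> l) g) m) = 0"
      by (intro sum.neutral) (auto simp: lookup_restr)
    then show ?thesis using \<open>lookup g m = 0\<close> by (simp add: lookup_sum)
  next
    case True
    let ?L = "{l \<in> A. \<delta> l \<le> wt (u l) m}"
    have L: "finite ?L" "?L \<noteq> {}" using A g[OF True] by auto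
    have "m \<in> slot A \<delta> l \<longleftrightarrow> l = Min ?L" if "l \<in> A" for l
    proof
      assume m: "m \<in> slot A \<delta> l"
      show "l = Min ?L"
      proof (rule Min_eqI[symmetric])
        fix l' assume "l' \<in> ?L"
        then show "l \<le> l'" using m by (cases "l' < l") (auto simp: slot_def)
      qed (use L m that in \<open>auto simp: slot_def\<close>)
    next
      assume l: "l = Min ?L"
      then have "l \<in> ?L" using Min_in[OF L] by simp
      moreover have "wt (u l') m < \<delta> l'" if "l' \<in> A" "l' < l" for l'
      proof (rule ccontr)
        assume "\<not> wt (u l') m < \<delta> l'"
        then have "l' \<in> ?L" using that by simp
        then show False using Min_le[OF L(1)] that(2) l by (meson leD)
      qed
      ultimately show "m \<in> slot A \<delta> l" by (auto simp: slot_def)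
    qed
    then have "(\<Sum>l\<in>A. lookup (restr (slot A \<delta> l) g) m) = (\<Sum>l\<in>A. if l = Min ?L then lookup g m else 0)"
      by (intro sum.cong refl) (auto simp: lookup_restr)
    also have "\<dots> = lookup g m" using Min_in[OF L] A by simp
    finally show ?thesis by (simp add: lookup_sum)
  qed
qed

text \<open>A monomial contributes to a cochain of less than top degree only if some direction is
  available in which it can be contracted.\<close>

lemma acyclic_no_forms:
  fixes c :: "nat \<Rightarrow> nat \<Rightarrow> 'k::field"
  assumes A: "finite A" and i: "i < card A" shows "koszul_acyclic c {} A i"
  unfolding koszul_acyclic_def
proof (intro allI impI)
  fix \<delta> and x :: "nat set \<Rightarrow> (nat, 'k) mpoly"
  assume x: "x \<in> cochain A i \<delta>" and cyc: "\<forall>B\<subseteq>A. card B = Suc i \<longrightarrow> cobd x B \<in> rel c {} A (lower \<delta> B)"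
  define xl where "xl = (\<lambda>l B. restr (slot A \<delta> l) (x B))"
  define y where "y = (\<lambda>B. \<Sum>l\<in>A. contr l (xl l) B)"
  show "\<exists>y. (\<forall>B\<subseteq>A. Suc (card B) = i \<longrightarrow> y B \<in> filt A (lower \<delta> B)) \<and>
          (\<forall>B\<subseteq>A. card B = i \<longrightarrow> x B - cobd y B \<in> rel c {} A (lower \<delta> B))"
  proof (intro exI[of _ y] conjI allI impI)
    fix B assume B: "B \<subseteq> A" "Suc (card B) = i"
    have fB: "finite B" using A B finite_subset by blast
    have "contr l (xl l) B \<in> filt A (lower \<delta> B)" if "l \<in> A" for l
    proof (cases "l \<in> B")
      case False
      have xi: "x (insert l B) \<in> filt A (lower \<delta> (insert l B))"
        by (rule cochainD[OF x]) (use False B fB that in auto)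
      have "xl l (insert l B) \<in> filt A (lower \<delta> B)"
      proof (rule filtI)
        fix m assume "m \<in> keys (xl l (insert l B))"
        then have m: "m \<in> keys (x (insert l B))" "m \<in> slot A \<delta> l" by (auto simp: xl_def)
        show "keys m \<subseteq> {..<r}" using filtD(1)[OF xi m(1)] .
        fix a assume "a \<in> A"
        then show "lower \<delta> B a \<le> wt (u a) m"
          using filtD(2)[OF xi m(1), of a] m(2) by (cases "a = l") (auto simp: lower_def slot_def)
      qed
      then show ?thesis using False by (simp add: contr_def filt_ksign)
    qed (simp add: contr_def)
    then show "y B \<in> filt A (lower \<delta> B)" unfolding y_def by (rule filt_sum)
  next
    fix B assume B: "B \<subseteq> A" "card B = i"
    have fB: "finite B" using A B finite_subset by blast
    have z: "contr l (cobd (xl l)) B = 0" if "l \<in> A" for l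
    proof (cases "l \<in> B")
      case False
      then have "cobd x (insert l B) = 0"
        using cyc B fB that by (auto simp: rel_empty_forms)
      then show ?thesis unfolding xl_def using False by (simp add: contr_def cobd_restr)
    qed (simp add: contr_def)
    have "x B = (\<Sum>l\<in>A. xl l B)"
      unfolding xl_def
    proof (rule slot_decomp[OF A])
      fix m assume m: "m \<in> keys (x B)"
      have "B \<noteq> A" using B(2) i by auto
      then obtain l where "l \<in> A" "l \<notin> B" using B by blast
      then show "\<exists>l\<in>A. \<delta> l \<le> wt (u l) m"
        using filtD(2)[OF cochainD[OF x B] m, of l] by (auto simp: lower_def intro: bexI[of _ l])
    qed
    also have "\<dots> = (\<Sum>l\<in>A. cobd (contr l (xl l)) B + contr l (cobd (xl l)) B)"
      by (simp only: contr_homotopy[OF fB])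
    also have "\<dots> = cobd y B" unfolding y_def cobd_sum by (rule sum.cong) (auto simp: z)
    finally show "x B - cobd y B \<in> rel c {} A (lower \<delta> B)" by simp
  qed
qed

text \<open>The entries of the matrix \<open>M\<^sub>A\<close>: the form \<open>lead c A k\<close> consists of the terms of \<open>\<ell>\<^sub>k\<close>
  of lowest weight in all directions of \<open>A\<close>.\<close>

definition lead :: "(nat \<Rightarrow> nat \<Rightarrow> 'k::field) \<Rightarrow> nat set \<Rightarrow> nat \<Rightarrow> nat \<Rightarrow> 'k" where
  "lead c A k j = (if \<forall>i\<in>A. u i j = w k i then c k j else 0)"

section \<open>Long exact sequence for one more form\<close>

lemma koszul_acyclicE:
  assumes "koszul_acyclic c K A i" "x \<in> cochain A i \<delta>"
    "\<And>B. B \<subseteq> A \<Longrightarrow> card B = Suc i \<Longrightarrow> cobd x B \<in> rel c K A (lower \<delta> B)"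
  obtains y where "\<And>B. B \<subseteq> A \<Longrightarrow> Suc (card B) = i \<Longrightarrow> y B \<in> filt A (lower \<delta> B)"
    "\<And>B. B \<subseteq> A \<Longrightarrow> card B = i \<Longrightarrow> x B - cobd y B \<in> rel c K A (lower \<delta> B)"
proof -
  have "\<exists>y. (\<forall>B\<subseteq>A. Suc (card B) = i \<longrightarrow> y B \<in> filt A (lower \<delta> B)) \<and>
          (\<forall>B\<subseteq>A. card B = i \<longrightarrow> x B - cobd y B \<in> rel c K A (lower \<delta> B))"
    using assms unfolding koszul_acyclic_def by blast
  then show thesis using that by blast
qed

text \<open>This is a part of the long exact cohomology sequence of multiplication by \<open>p\<^sub>k\<close>, whose
  injectivity on the ring is \<open>form_regular\<close>; the hypothesis \<open>inj\<close> is injectivity on the next cohomology group.\<close>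

lemma acyclic_insert:
  fixes c :: "nat \<Rightarrow> nat \<Rightarrow> 'k::field"
  assumes K: "finite K" "k \<notin> K" and A: "finite A"
    and ind: "row_indep r c (insert k K)" and sat: "saturated c K A" and adm: "admissible c (insert k K) A"
    and ac: "koszul_acyclic c K A i"
    and inj: "\<And>\<delta> e x. e \<in> cochain A (Suc i) \<delta> \<Longrightarrow> x \<in> cochain A i (\<lambda>i. \<delta> i + w k i) \<Longrightarrow>
       (\<And>B. B \<subseteq> A \<Longrightarrow> card B = Suc (Suc i) \<Longrightarrow> cobd e B \<in> rel c K A (lower \<delta> B)) \<Longrightarrow>
       (\<And>B. B \<subseteq> A \<Longrightarrow> card B = Suc i \<Longrightarrow> cobd x B - linear_form r (c k) * e B \<in> rel c K A (lower (\<lambda>i. \<delta> i + w k i) B)) \<Longrightarrow>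
       \<exists>y\<in>cochain A i \<delta>. \<forall>B\<subseteq>A. card B = Suc i \<longrightarrow> e B - cobd y B \<in> rel c K A (lower \<delta> B)"
  shows "koszul_acyclic c (insert k K) A i"
  unfolding koszul_acyclic_def
proof (intro allI impI)
  fix \<delta> and x :: "nat set \<Rightarrow> (nat, 'k) mpoly"
  assume x: "x \<in> cochain A i \<delta>"
    and cyc: "\<forall>B\<subseteq>A. card B = Suc i \<longrightarrow> cobd x B \<in> rel c (insert k K) A (lower \<delta> B)"
  let ?l = "linear_form r (c k)"
  define \<delta>' where "\<delta>' = (\<lambda>i. \<delta> i - w k i)"
  have low: "(\<lambda>i. lower \<delta> B i - w k i) = lower \<delta>' B" for B
    by (auto simp: lower_def \<delta>'_def)
  have dd: "(\<lambda>i. \<delta>' i + w k i) = \<delta>" by (simp add: \<delta>'_def)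
  have lf: "?l \<in> filt A (w k)" by (rule form_filt[OF adm]) simp
  have "\<forall>B. \<exists>h. B \<subseteq> A \<longrightarrow> card B = Suc i \<longrightarrow> cobd x B - ?l * h \<in> rel c K A (lower \<delta> B) \<and> h \<in> filt A (lower \<delta>' B)"
    using cyc rel_insertE[OF K, of _ c A] unfolding low[symmetric] by metis
  then obtain e where e: "\<And>B. B \<subseteq> A \<Longrightarrow> card B = Suc i \<Longrightarrow> cobd x B - ?l * e B \<in> rel c K A (lower \<delta> B)"
      "\<And>B. B \<subseteq> A \<Longrightarrow> card B = Suc i \<Longrightarrow> e B \<in> filt A (lower \<delta>' B)"
    by metis
  have e': "e \<in> cochain A (Suc i) \<delta>'" using e(2) by (simp add: cochain_def)
  have "\<exists>y\<in>cochain A i \<delta>'. \<forall>B\<subseteq>A. card B = Suc i \<longrightarrow> e B - cobd y B \<in> rel c K A (lower \<delta>' B)"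
  proof (rule inj[OF e', of x])
    fix B assume B: "B \<subseteq> A" "card B = Suc (Suc i)"
    have fB: "finite B" using B A finite_subset by blast
    have "cobd (\<lambda>B. cobd x B - ?l * e B) B \<in> rel c K A (lower \<delta> B)"
      by (rule cobd_rel[OF A B e(1)])
    then have "- (?l * cobd e B) \<in> rel c K A (lower \<delta> B)"
      by (simp add: cobd_diff cobd_mult cobd_cobd[OF fB])
    then have "?l * cobd e B \<in> rel c K A (lower \<delta> B)" using rel_uminus by fastforce
    then show "cobd e B \<in> rel c K A (lower \<delta>' B)"
      by (rule form_regular[OF K ind sat cobd_filt[OF A B e']])
  qed (use x e(1) in \<open>simp_all add: dd\<close>)
  then obtain y where y: "y \<in> cochain A i \<delta>'"
    "\<And>B. B \<subseteq> A \<Longrightarrow> card B = Suc i \<Longrightarrow> e B - cobd y B \<in> rel c K A (lower \<delta>' B)" by blast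
  have ly: "?l * y B \<in> filt A (lower \<delta> B)" if "B \<subseteq> A" "card B = i" for B
    by (rule filt_mult'[OF lf cochainD[OF y(1) that]]) (simp add: lower_def \<delta>'_def)
  \<comment> \<open>Now \<open>x\<close> lifts to a cocycle modulo the smaller family.\<close>
  define x' where "x' = (\<lambda>B. x B - ?l * y B)"
  have x': "x' \<in> cochain A i \<delta>"
    unfolding cochain_def x'_def
    by (intro CollectI allI impI filt_diff[OF cochainD[OF x] ly])
  have "cobd x' B \<in> rel c K A (lower \<delta> B)" if B: "B \<subseteq> A" "card B = Suc i" for B
  proof -
    have "?l * (e B - cobd y B) \<in> rel c K A (lower \<delta> B)"
      by (rule rel_mult[OF y(2)[OF B] lf]) (simp add: lower_def \<delta>'_def)
    from rel_add[OF e(1)[OF B] this] have "cobd x B - ?l * cobd y B \<in> rel c K A (lower \<delta> B)"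
      by (simp add: algebra_simps)
    then show ?thesis unfolding x'_def cobd_diff cobd_mult .
  qed
  then obtain z where z: "\<And>B. B \<subseteq> A \<Longrightarrow> Suc (card B) = i \<Longrightarrow> z B \<in> filt A (lower \<delta> B)"
    "\<And>B. B \<subseteq> A \<Longrightarrow> card B = i \<Longrightarrow> x' B - cobd z B \<in> rel c K A (lower \<delta> B)"
    using koszul_acyclicE[OF ac x'] by blast
  have "x B - cobd z B \<in> rel c (insert k K) A (lower \<delta> B)" if B: "B \<subseteq> A" "card B = i" for B
  proof (rule rel_insertI[OF K])
    show "x B - cobd z B - ?l * y B \<in> rel c K A (lower \<delta> B)"
      using z(2)[OF B] by (simp add: x'_def algebra_simps)
    show "y B \<in> filt A (\<lambda>i. lower \<delta> B i - w k i)"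
      unfolding low by (rule cochainD[OF y(1) B])
  qed
  with z(1) show "\<exists>y. (\<forall>B\<subseteq>A. Suc (card B) = i \<longrightarrow> y B \<in> filt A (lower \<delta> B)) \<and>
          (\<forall>B\<subseteq>A. card B = i \<longrightarrow> x B - cobd y B \<in> rel c (insert k K) A (lower \<delta> B))"
    by blast
qed

lemma acyclic_insert_lower:
  fixes c :: "nat \<Rightarrow> nat \<Rightarrow> 'k::field"
  assumes K: "finite K" "k \<notin> K" and A: "finite A"
    and ind: "row_indep r c (insert k K)" and sat: "saturated c K A" and adm: "admissible c (insert k K) A"
    and ac: "koszul_acyclic c K A i" "koszul_acyclic c K A (Suc i)"
  shows "koszul_acyclic c (insert k K) A i"
proof (rule acyclic_insert[OF K A ind sat adm ac(1)])
  fix \<delta> and e x :: "nat set \<Rightarrow> (nat, 'k) mpoly"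
  assume e: "e \<in> cochain A (Suc i) \<delta>"
    and cyc: "\<And>B. B \<subseteq> A \<Longrightarrow> card B = Suc (Suc i) \<Longrightarrow> cobd e B \<in> rel c K A (lower \<delta> B)"
  obtain y where "\<And>B. B \<subseteq> A \<Longrightarrow> Suc (card B) = Suc i \<Longrightarrow> y B \<in> filt A (lower \<delta> B)"
    "\<And>B. B \<subseteq> A \<Longrightarrow> card B = Suc i \<Longrightarrow> e B - cobd y B \<in> rel c K A (lower \<delta> B)"
    using koszul_acyclicE[OF ac(2) e cyc] by blast
  then show "\<exists>y\<in>cochain A i \<delta>. \<forall>B\<subseteq>A. card B = Suc i \<longrightarrow> e B - cobd y B \<in> rel c K A (lower \<delta> B)"
    by (intro bexI[of _ y]) (auto simp: cochain_def)
qed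

definition exact :: "nat set \<Rightarrow> (nat \<Rightarrow> int) \<Rightarrow> (nat \<Rightarrow>\<^sub>0 nat) set" where
  "exact A \<delta> = {m. \<forall>i\<in>A. wt (u i) m = \<delta> i}"

text \<open>The terms of the form that are missing from \<open>lead c A k\<close> raise the weight strictly in some
  direction of \<open>A\<close>.\<close>

lemma restr_exact_form:
  assumes adm: "admissible c K A" "k \<in> K" and g: "g \<in> filt A \<epsilon>"
    and \<eta>: "\<And>i. i \<in> A \<Longrightarrow> \<eta> i = w k i + \<epsilon> i"
  shows "restr (exact A \<eta>) (linear_form r (c k) * g) = linear_form r (lead c A k) * restr (exact A \<epsilon>) g"
proof -
  have lk: "m \<in> keys (linear_form r (lead c A k)) \<Longrightarrow> i \<in> A \<Longrightarrow> wt (u i) m = w k i" for m i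
    by (auto simp: keys_linear_form lead_def split: if_splits)
  have "restr (exact A \<eta>) (linear_form r (lead c A k) * g) = linear_form r (lead c A k) * restr (exact A \<epsilon>) g"
    by (rule restr_mult) (auto simp: exact_def wt_add lk \<eta>)
  moreover have "restr (exact A \<eta>) (linear_form r (\<lambda>j. c k j - lead c A k j) * g) = 0"
  proof (rule restr_eq_0, rule ccontr)
    assume "keys (linear_form r (\<lambda>j. c k j - lead c A k j) * g) \<inter> exact A \<eta> \<noteq> {}"
    then obtain a b where ab: "a \<in> keys (linear_form r (\<lambda>j. c k j - lead c A k j))" "b \<in> keys g" "a + b \<in> exact A \<eta>"
      by (auto elim!: keys_mult_mem)
    then obtain j where j: "j < r" "c k j - lead c A k j \<noteq> 0" "a = Poly_Mapping.single j (Suc 0)"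
      by (auto simp: keys_linear_form)
    then have "c k j \<noteq> 0" "\<exists>i\<in>A. u i j \<noteq> w k i" by (auto simp: lead_def split: if_splits)
    then obtain i where i: "i \<in> A" "w k i < u i j" using adm j(1) unfolding admissible_def by (metis le_less)
    have "\<epsilon> i \<le> wt (u i) b" using filtD(2)[OF g ab(2) i(1)] .
    moreover have "wt (u i) (a + b) = w k i + \<epsilon> i" using ab(3) i(1) \<eta> by (auto simp: exact_def)
    ultimately show False using i(2) by (simp add: wt_add j(3))
  qed
  moreover have "linear_form r (c k) = linear_form r (lead c A k) + linear_form r (\<lambda>j. c k j - lead c A k j)"
    by (simp add: linear_form_diff)
  ultimately show ?thesis by (simp add: distrib_right restr_add)
qed

lemma rel_lowest_part:
  assumes adm: "admissible c K A" and f: "f \<in> rel c K A \<delta>"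
  shows "restr (exact A \<delta>) f \<in> combos r (lead c A) K"
proof -
  obtain g where g: "f = (\<Sum>k\<in>K. linear_form r (c k) * g k)" "\<forall>k\<in>K. g k \<in> filt A (\<lambda>i. \<delta> i - w k i)"
    using f by (rule relE)
  have "restr (exact A \<delta>) f = (\<Sum>k\<in>K. linear_form r (lead c A k) * restr (exact A (\<lambda>i. \<delta> i - w k i)) (g k))"
    unfolding g(1) restr_sum
    by (rule sum.cong[OF refl], rule restr_exact_form[OF adm _ bspec[OF g(2)]]) auto
  then show ?thesis by (rule combos_memI)
qed

text \<open>In top degree only the lowest parts matter, and these form a polynomial ring modulo
  independent linear forms.\<close>

lemma top_degree_injective:
  fixes c :: "nat \<Rightarrow> nat \<Rightarrow> 'k::field"
  assumes K: "finite K" "k \<notin> K" and A: "finite A" "A \<noteq> {}" and adm: "admissible c (insert k K) A"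
    and ind: "row_indep r (lead c A) (insert k K)"
    and e: "e \<in> filt A (lower \<delta> A)" and x: "x \<in> cochain A (card A - 1) (\<lambda>i. \<delta> i + w k i)"
    and mem: "cobd x A - linear_form r (c k) * e \<in> rel c K A (lower (\<lambda>i. \<delta> i + w k i) A)"
  shows "\<exists>y\<in>cochain A (card A - 1) \<delta>. e - cobd y A \<in> rel c K A (lower \<delta> A)"
proof -
  define \<epsilon> where "\<epsilon> = lower \<delta> A"
  define \<delta>' where "\<delta>' = (\<lambda>i. \<delta> i + w k i)"
  define \<eta> where "\<eta> = lower \<delta>' A"
  have \<eta>: "\<eta> i = w k i + \<epsilon> i" for i by (simp add: \<eta>_def \<epsilon>_def \<delta>'_def lower_def)
  have adm': "admissible c K A" using adm by (rule admissible_mono) auto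
  have "restr (exact A \<eta>) (cobd x A) = 0"
    unfolding cobd_def restr_sum restr_ksign
  proof (rule sum.neutral, rule ballI)
    fix l assume l: "l \<in> A"
    have "x (A - {l}) \<in> filt A (lower \<delta>' (A - {l}))"
      by (rule cochainD[OF x[folded \<delta>'_def]]) (use A l in auto)
    from filtD(2)[OF this _ l] have "restr (exact A \<eta>) (x (A - {l})) = 0"
      by (intro restr_eq_0) (use l in \<open>force simp: exact_def \<eta>_def lower_def\<close>)
    then show "ksign l A * restr (exact A \<eta>) (x (A - {l})) = 0" by simp
  qed
  moreover have "restr (exact A \<eta>) (linear_form r (c k) * e) = linear_form r (lead c A k) * restr (exact A \<epsilon>) e"
    by (rule restr_exact_form[OF adm _ e[folded \<epsilon>_def] \<eta>]) simp
  moreover have "restr (exact A \<eta>) (cobd x A - linear_form r (c k) * e) \<in> combos r (lead c A) K"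
    by (rule rel_lowest_part[OF adm' mem[folded \<delta>'_def, folded \<eta>_def]])
  ultimately have "- (linear_form r (lead c A k) * restr (exact A \<epsilon>) e) \<in> combos r (lead c A) K"
    by (simp add: restr_diff)
  then have "linear_form r (lead c A k) * restr (exact A \<epsilon>) e \<in> combos r (lead c A) K"
    using combos_diff[OF combos_0] by fastforce
  then have "restr (exact A \<epsilon>) e \<in> combos r (lead c A) K"
    by (rule independent_form_regular[OF K ind])
  moreover have "restr (exact A \<epsilon>) e \<in> filt {} \<epsilon>"
    by (rule filt_restr, rule filt_mono[OF e]) auto
  ultimately have "restr (exact A \<epsilon>) e \<in> rel (lead c A) K {} \<epsilon>" using rel_combos by blast
  then obtain h where h: "restr (exact A \<epsilon>) e = (\<Sum>k\<in>K. linear_form r (lead c A k) * h k)"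
      "\<forall>k\<in>K. h k \<in> filt {} (\<lambda>i. \<epsilon> i - w k i)"
    by (rule relE)
  define h' where "h' = (\<lambda>k. restr (exact A (\<lambda>i. \<epsilon> i - w k i)) (h k))"
  have h'f: "h' k' \<in> filt A (\<lambda>i. \<epsilon> i - w k' i)" if "k' \<in> K" for k'
  proof (rule filtI)
    fix m assume "m \<in> keys (h' k')"
    then have "m \<in> keys (h k')" by (simp add: h'_def)
    then show "keys m \<subseteq> {..<r}" by (rule filtD(1)[OF bspec[OF h(2) that]])
  qed (auto simp: h'_def exact_def)
  have lk: "m \<in> keys (linear_form r (lead c A k')) \<Longrightarrow> i \<in> A \<Longrightarrow> wt (u i) m = w k' i" for m i k'
    by (auto simp: keys_linear_form lead_def split: if_splits)
  have e0: "restr (exact A \<epsilon>) e = (\<Sum>k\<in>K. linear_form r (lead c A k) * h' k)"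
  proof -
    have "restr (exact A \<epsilon>) e = restr (exact A \<epsilon>) (restr (exact A \<epsilon>) e)"
      by (rule restr_id[symmetric]) auto
    also have "\<dots> = (\<Sum>k\<in>K. linear_form r (lead c A k) * h' k)"
      unfolding h(1) restr_sum h'_def
      by (rule sum.cong[OF refl], rule restr_mult) (auto simp: exact_def wt_add lk)
    finally show ?thesis .
  qed
  define s where "s = (\<Sum>k\<in>K. linear_form r (c k) * h' k)"
  have s: "s \<in> rel c K A \<epsilon>" by (rule relI[OF s_def h'f])
  define t where "t = e - s"
  have tf: "t \<in> filt A \<epsilon>" unfolding t_def
    by (rule filt_diff[OF e[folded \<epsilon>_def] rel_filt[OF adm' s]])
  have "restr (exact A \<epsilon>) s = (\<Sum>k\<in>K. linear_form r (lead c A k) * h' k)"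
    unfolding s_def restr_sum
  proof (rule sum.cong[OF refl])
    fix k' assume k': "k' \<in> K"
    have "restr (exact A \<epsilon>) (linear_form r (c k') * h' k') = linear_form r (lead c A k') * restr (exact A (\<lambda>i. \<epsilon> i - w k' i)) (h' k')"
      by (rule restr_exact_form[OF adm' k' h'f[OF k']]) simp
    also have "restr (exact A (\<lambda>i. \<epsilon> i - w k' i)) (h' k') = h' k'"
      by (rule restr_id) (auto simp: h'_def)
    finally show "restr (exact A \<epsilon>) (linear_form r (c k') * h' k') = linear_form r (lead c A k') * h' k'" .
  qed
  then have t0: "restr (exact A \<epsilon>) t = 0" by (simp add: t_def restr_diff e0)
  have t_eq: "t = (\<Sum>l\<in>A. restr (slot A \<delta> l) t)"
  proof (rule slot_decomp[OF A(1)], rule ccontr)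
    fix m assume m: "m \<in> keys t" and no: "\<not> (\<exists>l\<in>A. \<delta> l \<le> wt (u l) m)"
    have "wt (u l) m = \<epsilon> l" if "l \<in> A" for l
      using filtD(2)[OF tf m that] no that by (force simp: \<epsilon>_def lower_def)
    then have "m \<in> keys (restr (exact A \<epsilon>) t)" using m by (simp add: exact_def)
    then show False unfolding t0 by simp
  qed
  define y where "y = (\<lambda>B. \<Sum>l\<in>A - B. ksign l A * restr (slot A \<delta> l) t)"
  have yl: "y (A - {l}) = ksign l A * restr (slot A \<delta> l) t" if "l \<in> A" for l
  proof -
    have "A - (A - {l}) = {l}" using that by auto
    then show ?thesis by (simp add: y_def)
  qed
  have "cobd y A = t"
  proof -
    have "cobd y A = (\<Sum>l\<in>A. restr (slot A \<delta> l) t)"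
      unfolding cobd_def by (rule sum.cong) (simp_all add: yl ksign_sq)
    then show ?thesis using t_eq by simp
  qed
  then have "e - cobd y A \<in> rel c K A (lower \<delta> A)" using s by (simp add: t_def \<epsilon>_def)
  moreover have "y \<in> cochain A (card A - 1) \<delta>"
    unfolding cochain_def
  proof (intro CollectI allI impI)
    fix B assume B: "B \<subseteq> A" "card B = card A - 1"
    have "card (A - B) = 1"
      using B A card_gt_0_iff[of A] by (simp add: card_Diff_subset finite_subset[OF B(1)])
    then obtain l where l: "A - B = {l}" by (auto simp: card_1_singleton_iff)
    then have lB: "l \<in> A" "B = A - {l}" using B by auto
    have "restr (slot A \<delta> l) t \<in> filt A (lower \<delta> B)"
    proof (rule filtI)
      fix m i assume "m \<in> keys (restr (slot A \<delta> l) t)" and i: "i \<in> A"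
      then have m: "m \<in> keys t" "m \<in> slot A \<delta> l" by auto
      show "lower \<delta> B i \<le> wt (u i) m"
        using filtD(2)[OF tf m(1) i] m(2) i by (cases "i = l") (auto simp: lower_def \<epsilon>_def slot_def lB(2))
    qed (use filtD(1)[OF tf] in auto)
    then show "y B \<in> filt A (lower \<delta> B)" unfolding lB(2) yl[OF lB(1)] by (simp add: filt_ksign)
  qed
  ultimately show ?thesis by blast
qed

lemma acyclic_insert_top:
  fixes c :: "nat \<Rightarrow> nat \<Rightarrow> 'k::field"
  assumes K: "finite K" "k \<notin> K" and A: "finite A" "card A = Suc i"
    and ind: "row_indep r c (insert k K)" and sat: "saturated c K A" and adm: "admissible c (insert k K) A"
    and lead_ind: "row_indep r (lead c A) (insert k K)"
    and ac: "koszul_acyclic c K A i"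
  shows "koszul_acyclic c (insert k K) A i"
proof (rule acyclic_insert[OF K A(1) ind sat adm ac])
  fix \<delta> and e x :: "nat set \<Rightarrow> (nat, 'k) mpoly"
  assume e: "e \<in> cochain A (Suc i) \<delta>" and x: "x \<in> cochain A i (\<lambda>i. \<delta> i + w k i)"
    and mem: "\<And>B. B \<subseteq> A \<Longrightarrow> card B = Suc i \<Longrightarrow> cobd x B - linear_form r (c k) * e B \<in> rel c K A (lower (\<lambda>i. \<delta> i + w k i) B)"
  have "A \<noteq> {}" using A by auto
  moreover have "e A \<in> filt A (lower \<delta> A)" by (rule cochainD[OF e]) (use A in auto)
  moreover have "x \<in> cochain A (card A - 1) (\<lambda>i. \<delta> i + w k i)" using x A by simp
  ultimately have "\<exists>y\<in>cochain A (card A - 1) \<delta>. e A - cobd y A \<in> rel c K A (lower \<delta> A)"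
    by (rule top_degree_injective[OF K A(1) _ adm lead_ind _ _ mem[OF order_refl A(2)]])
  moreover have "B = A" if "B \<subseteq> A" "card B = Suc i" for B
    using card_subset_eq[OF A(1)] that A(2) by auto
  ultimately show "\<exists>y\<in>cochain A i \<delta>. \<forall>B\<subseteq>A. card B = Suc i \<longrightarrow> e B - cobd y B \<in> rel c K A (lower \<delta> B)"
    using A(2) by auto
qed

end

lemma ex_maximal_row_indep:
  assumes "finite K"
  obtains K0 where "K0 \<subseteq> K" "row_indep r c K0" "\<And>k. k \<in> K - K0 \<Longrightarrow> \<not> row_indep r c (insert k K0)"
proof -
  let ?S = "{K0. K0 \<subseteq> K \<and> row_indep r c K0}"
  have "finite ?S" using assms by simp
  moreover have "{} \<in> ?S" by (simp add: row_indep_def)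
  ultimately obtain K0 where K0: "K0 \<in> ?S" "\<And>K1. K1 \<in> ?S \<Longrightarrow> K0 \<subseteq> K1 \<Longrightarrow> K0 = K1"
    using finite_has_maximal[of ?S] by (metis (no_types, lifting) empty_iff)
  show thesis
  proof (rule that)
    fix k assume k: "k \<in> K - K0"
    show "\<not> row_indep r c (insert k K0)"
    proof
      assume "row_indep r c (insert k K0)"
      then have "K0 = insert k K0" using K0(1) k by (intro K0(2)) auto
      then show False using k by auto
    qed
  qed (use K0 in auto)
qed

lemma row_dependence:
  fixes c :: "nat \<Rightarrow> nat \<Rightarrow> 'k::field"
  assumes "finite K" "k \<notin> K" "row_indep r c K" "\<not> row_indep r c (insert k K)"
  obtains a where "\<And>j. j < r \<Longrightarrow> c k j = (\<Sum>k'\<in>K. a k' * c k' j)"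
proof -
  obtain a k0 where a: "\<forall>j<r. (\<Sum>k\<in>insert k K. a k * c k j) = 0" "k0 \<in> insert k K" "a k0 \<noteq> 0"
    using assms(4) unfolding row_indep_def by blast
  have s: "a k * c k j = - (\<Sum>k\<in>K. a k * c k j)" if "j < r" for j
    using a(1) that assms(1,2) by (simp add: add_eq_0_iff2)
  have "a k \<noteq> 0"
  proof
    assume "a k = 0"
    then have "(\<Sum>k\<in>K. a k * c k j) = 0" if "j < r" for j using s[OF that] by simp
    then have "\<forall>k\<in>K. a k = 0" using row_indepD[OF assms(3)] by blast
    then show False using a(2,3) \<open>a k = 0\<close> by auto
  qed
  show thesis
  proof (rule that)
    fix j assume "j < r"
    have "c k j = (a k * c k j) / a k" using \<open>a k \<noteq> 0\<close> by simp
    also have "\<dots> = (\<Sum>k'\<in>K. (- a k' / a k) * c k' j)"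
      unfolding s[OF \<open>j < r\<close>] by (simp add: sum_divide_distrib sum_negf)
    finally show "c k j = (\<Sum>k'\<in>K. (- a k' / a k) * c k' j)" .
  qed
qed

context weighted_forms
begin

section \<open>Rank conditions imply saturation\<close>

text \<open>If \<open>f\<close> is torsion but not a filtered combination, then lowering the bounds as far as possible
  leads to a place where one further step in any direction makes \<open>f\<close> a filtered combination. There
  \<open>f\<close> is a nonzero class of degree \<open>0\<close>.\<close>

lemma saturated_if_acyclic_0:
  fixes c :: "nat \<Rightarrow> nat \<Rightarrow> 'k::field"
  assumes K: "finite K" and A: "finite A" and ac: "koszul_acyclic c K A 0"
    and loc: "\<And>l. l \<in> A \<Longrightarrow> saturated c K (A - {l})"
  shows "saturated c K A"
  unfolding saturated_def
proof (intro allI impI)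
  fix \<delta> and f :: "(nat, 'k) mpoly"
  assume f: "f \<in> rel c K {} \<delta>" "f \<in> filt A \<delta>"
  have "\<exists>N. f \<in> rel c K A (\<lambda>i. \<delta> i - (if i = l then int N else 0))" if l: "l \<in> A" for l
  proof -
    have "f \<in> rel c K (A - {l}) \<delta>"
      using loc[OF l] f(1) filt_mono[OF f(2), of "A - {l}" \<delta>] unfolding saturated_def by blast
    then obtain g where g: "f = (\<Sum>k\<in>K. linear_form r (c k) * g k)" "\<forall>k\<in>K. g k \<in> filt (A - {l}) (\<lambda>i. \<delta> i - w k i)"
      by (rule relE)
    define T where "T = insert 0 (\<Union>k\<in>K. (\<lambda>m. \<delta> l - w k l - wt (u l) m) ` keys (g k))"
    have fT: "finite T" using K by (simp add: T_def)
    have N: "\<delta> l - int (nat (Max T)) - w k l \<le> wt (u l) m" if "k \<in> K" "m \<in> keys (g k)" for k m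
    proof -
      have "\<delta> l - w k l - wt (u l) m \<in> T" using that by (auto simp: T_def)
      then have "\<delta> l - w k l - wt (u l) m \<le> Max T" using fT by simp
      then show ?thesis by linarith
    qed
    have "f \<in> rel c K A (\<lambda>i. \<delta> i - (if i = l then int (nat (Max T)) else 0))"
    proof (rule relI[OF g(1)], rule filtI)
      fix k m i assume "k \<in> K" "m \<in> keys (g k)" "i \<in> A"
      then show "\<delta> i - (if i = l then int (nat (Max T)) else 0) - w k i \<le> wt (u i) m"
        using N filtD(2)[OF bspec[OF g(2)], of k m i] by (cases "i = l") auto
    qed (use filtD(1)[OF bspec[OF g(2)]] in auto)
    then show ?thesis by blast
  qed
  then obtain N where N: "\<And>l. l \<in> A \<Longrightarrow> f \<in> rel c K A (\<lambda>i. \<delta> i - (if i = l then int (N l) else 0))"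
    by metis
  show "f \<in> rel c K A \<delta>"
  proof (rule ccontr)
    assume nf: "f \<notin> rel c K A \<delta>"
    define D where "D = (\<lambda>(s :: nat \<Rightarrow> nat) i. \<delta> i - int (s i))"
    define P where "P = (\<lambda>s. f \<notin> rel c K A (D s))"
    have "P (\<lambda>_. 0)" using nf by (simp add: P_def D_def)
    moreover have "\<forall>s. P s \<longrightarrow> sum s A < Suc (sum N A)"
    proof (intro allI impI le_imp_less_Suc sum_mono)
      fix s l assume s: "P s" and l: "l \<in> A"
      show "s l \<le> N l"
      proof (rule ccontr)
        assume "\<not> s l \<le> N l"
        then have "f \<in> rel c K A (D s)"
          by (intro rel_mono[OF N[OF l]]) (auto simp: D_def)
        then show False using s by (simp add: P_def)
      qed
    qed
    \<comment> \<open>Lower the bounds as far as possible without making \<open>f\<close> a filtered combination.\<close>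
    ultimately have "\<exists>s. P s \<and> (\<forall>s'. P s' \<longrightarrow> sum s' A \<le> sum s A)"
      by (rule Lattices_Big.ex_has_greatest_nat)
    then obtain s where s: "P s" "\<And>s'. P s' \<Longrightarrow> sum s' A \<le> sum s A"
      by blast
    have one: "f \<in> rel c K A (lower (D s) {l})" if l: "l \<in> A" for l
    proof -
      have "sum (s(l := Suc (s l))) A = Suc (sum s A)"
        using A l by (simp add: sum.remove)
      then have "\<not> P (s(l := Suc (s l)))" using s(2) by fastforce
      moreover have "D (s(l := Suc (s l))) = lower (D s) {l}" by (auto simp: D_def lower_def)
      ultimately show ?thesis by (simp add: P_def)
    qed
    define x where "x = (\<lambda>B :: nat set. f)"
    have "f \<in> filt A (D s)" by (rule filt_mono[OF f(2)]) (auto simp: D_def)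
    then have x: "x \<in> cochain A 0 (D s)"
      using A by (auto simp: cochain_def x_def lower_def finite_subset)
    have cyc: "cobd x B \<in> rel c K A (lower (D s) B)" if "B \<subseteq> A" "card B = Suc 0" for B
    proof -
      obtain l where "B = {l}" using \<open>card B = Suc 0\<close> by (auto simp: card_1_singleton_iff)
      then show ?thesis using one[of l] that(1) by (auto simp: cobd_def x_def intro!: rel_ksign)
    qed
    obtain y where "\<And>B. B \<subseteq> A \<Longrightarrow> card B = 0 \<Longrightarrow> x B - cobd y B \<in> rel c K A (lower (D s) B)"
      using koszul_acyclicE[OF ac x cyc] by blast
    from this[of "{}"] have "f \<in> rel c K A (lower (D s) {})" by (simp add: x_def)
    then show False using s(1) by (simp add: P_def lower_def)
  qed
qed

text \<open>By induction on \<open>A\<close> torsion lives where all directions of \<open>A\<close> are involved. The forms in \<open>K0\<close>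
  preserve acyclicity in all degrees below \<open>card A\<close>, each of the remaining forms may destroy the highest of these
  degrees, and there are too few of them to reach degree \<open>0\<close>.\<close>

theorem saturated_if_rank:
  fixes c :: "nat \<Rightarrow> nat \<Rightarrow> 'k::field"
  assumes "finite A" "finite K" "admissible c K A" "row_indep r c K"
    and "\<And>A'. A' \<subseteq> A \<Longrightarrow> A' \<noteq> {} \<Longrightarrow> \<exists>K0\<subseteq>K. row_indep r (lead c A') K0 \<and> card (K - K0) < card A'"
  shows "saturated c K A"
  using assms
proof (induction A arbitrary: K rule: finite_psubset_induct)
  case (psubset A)
  note A = psubset.hyps
  from psubset.prems show ?case
  proof (induction K rule: finite_psubset_induct)
    case (psubset K)
    note K = psubset.hyps and adm = psubset.prems(1) and ind = psubset.prems(2) and rank = psubset.prems(3)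
    show ?case
    proof (cases "A = {}")
      case True then show ?thesis by (simp add: saturated_empty)
    next
      case False
      obtain K0 where K0: "K0 \<subseteq> K" "row_indep r (lead c A) K0" "card (K - K0) < card A"
        using rank[OF order_refl False] by blast
      have fK: "finite K'" if "K' \<subseteq> K" for K' using K that finite_subset by blast
      have sat: "saturated c K' A" if "K' \<subset> K" for K'
      proof (rule psubset.IH[OF that])
        show "admissible c K' A" by (rule admissible_mono[OF adm]) (use that in auto)
        show "row_indep r c K'" by (rule row_indep_subset[OF ind K]) (use that in auto)
        fix A' assume "A' \<subseteq> A" "A' \<noteq> {}"
        from rank[OF this] obtain K1 where K1: "K1 \<subseteq> K" "row_indep r (lead c A') K1" "card (K - K1) < card A'" by blast
        have "row_indep r (lead c A') (K1 \<inter> K')"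
          by (rule row_indep_subset[OF K1(2) fK[OF K1(1)]]) auto
        moreover have "card (K' - K1 \<inter> K') \<le> card (K - K1)" by (rule card_mono) (use K that in auto)
        ultimately show "\<exists>K0\<subseteq>K'. row_indep r (lead c A') K0 \<and> card (K' - K0) < card A'"
          using K1(3) by (intro exI[of _ "K1 \<inter> K'"]) auto
      qed
      have adm': "admissible c K' A" if "K' \<subseteq> K" for K' by (rule admissible_mono[OF adm that]) auto
      have ind': "row_indep r c K'" if "K' \<subseteq> K" for K' by (rule row_indep_subset[OF ind K that])
      have lead_forms: "\<forall>i<card A. koszul_acyclic c K' A i" if "finite K'" "K' \<subseteq> K0" for K'
        using that
      proof (induction K')
        case empty show ?case using acyclic_no_forms[OF A] by blast
      next
        case (insert k K')
        have sub: "insert k K' \<subseteq> K" "K' \<subset> K" using insert K0(1) by auto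
        show ?case
        proof (intro allI impI)
          fix i assume i: "i < card A"
          have ac: "koszul_acyclic c K' A i" using insert i by auto
          show "koszul_acyclic c (insert k K') A i"
          proof (cases "Suc i < card A")
            case True
            then have "koszul_acyclic c K' A (Suc i)" using insert by auto
            then show ?thesis
              by (intro acyclic_insert_lower insert.hyps A ind' adm' sat sub ac)
          next
            case False
            then have "card A = Suc i" using i by simp
            moreover have "row_indep r (lead c A) (insert k K')"
              by (rule row_indep_subset[OF K0(2) fK[OF K0(1)] insert.prems])
            ultimately show ?thesis
              by (intro acyclic_insert_top insert.hyps A ind' adm' sat sub ac)
          qed
        qed
      qed
      have other_forms: "\<forall>i. i + card K' < card A \<longrightarrow> koszul_acyclic c (K0 \<union> K') A i" if "finite K'" "K' \<subseteq> K - K0" for K'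
        using that
      proof (induction K')
        case empty show ?case using lead_forms[OF fK[OF K0(1)] order_refl] by simp
      next
        case (insert k K')
        have sub: "insert k (K0 \<union> K') \<subseteq> K" "K0 \<union> K' \<subset> K" "k \<notin> K0 \<union> K'" "finite (K0 \<union> K')"
          using insert K0(1) fK by auto
        show ?case
        proof (intro allI impI)
          fix i assume "i + card (insert k K') < card A"
          then have "koszul_acyclic c (K0 \<union> K') A i" "koszul_acyclic c (K0 \<union> K') A (Suc i)" using insert by auto
          then have "koszul_acyclic c (insert k (K0 \<union> K')) A i"
            by (intro acyclic_insert_lower sub A ind' adm' sat)
          then show "koszul_acyclic c (K0 \<union> insert k K') A i" by simp
        qed
      qed
      have "K0 \<union> (K - K0) = K" using K0(1) by auto
      then have "koszul_acyclic c K A 0" using other_forms[of "K - K0"] K K0(3) by auto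
      then show ?thesis
      proof (rule saturated_if_acyclic_0[OF K A])
        fix l assume l: "l \<in> A"
        show "saturated c K (A - {l})"
        proof (rule \<open>\<And>B K. \<lbrakk>B \<subset> A; finite K; admissible c K B; row_indep r c K;
             \<And>A'. A' \<subseteq> B \<Longrightarrow> A' \<noteq> {} \<Longrightarrow> \<exists>K0\<subseteq>K. row_indep r (lead c A') K0 \<and> card (K - K0) < card A'\<rbrakk> \<Longrightarrow> saturated c K B\<close>)
          show "A - {l} \<subset> A" using l by auto
          show "admissible c K (A - {l})" by (rule admissible_mono[OF adm]) auto
        qed (use K ind rank in auto)
      qed
    qed
  qed
qed

section \<open>Saturation implies the rank conditions\<close>

text \<open>An argument in the style of Nakayama: if the form \<open>k\<close> occurs in a combination of the other
  forms, its coefficient belongs to the ideal of these as well, and has smaller degree.\<close>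

lemma saturated_subset:
  fixes c :: "nat \<Rightarrow> nat \<Rightarrow> 'k::field"
  assumes K: "finite K" "k \<notin> K" and adm: "admissible c (insert k K) A" and ind: "row_indep r c (insert k K)"
    and sat: "saturated c (insert k K) A"
  shows "saturated c K A"
proof -
  let ?l = "linear_form r (c k)"
  define S where "S = (\<lambda>N. {m :: nat \<Rightarrow>\<^sub>0 nat. wt (\<lambda>_. 1) m < int N})"
  have trunc: "restr (S (Suc N)) (linear_form r a * g) = linear_form r a * restr (S N) g" for N and a :: "nat \<Rightarrow> 'k" and g
    by (rule restr_mult) (auto simp: keys_linear_form S_def wt_add)
  have wt_nonneg: "0 \<le> wt (\<lambda>_. 1) m" for m :: "nat \<Rightarrow>\<^sub>0 nat" by (simp add: wt_def sum_nonneg)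
  have main: "f \<in> rel c K A \<delta>" if "keys f \<subseteq> S N" "f \<in> rel c K {} \<delta>" "f \<in> filt A \<delta>" for N f \<delta>
    using that
  proof (induction N arbitrary: f \<delta>)
    case 0
    have "m \<notin> keys f" for m
      using 0(1) wt_nonneg[of m] by (auto simp: S_def)
    then have "keys f = {}" by blast
    then show ?case by simp
  next
    case (Suc N)
    have "f \<in> rel c (insert k K) {} \<delta>" by (rule rel_mono_forms[OF _ _ Suc.prems(2)]) (use K in auto)
    then have "f \<in> rel c (insert k K) A \<delta>" using sat Suc.prems(3) unfolding saturated_def by blast
    then obtain h where h: "f - ?l * h \<in> rel c K A \<delta>" "h \<in> filt A (\<lambda>i. \<delta> i - w k i)"
      by (rule rel_insertE[OF K])
    define h' where "h' = restr (S N) h"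
    have h'f: "h' \<in> filt A (\<lambda>i. \<delta> i - w k i)" unfolding h'_def by (rule filt_restr[OF h(2)])
    have fh: "f - ?l * h' \<in> rel c K A \<delta>"
    proof -
      obtain g where g: "f - ?l * h = (\<Sum>k\<in>K. linear_form r (c k) * g k)" "\<forall>k\<in>K. g k \<in> filt A (\<lambda>i. \<delta> i - w k i)"
        using h(1) by (rule relE)
      have "f - ?l * h' = restr (S (Suc N)) (f - ?l * h)"
        unfolding restr_diff trunc h'_def restr_id[OF Suc.prems(1)] ..
      also have "\<dots> = (\<Sum>k\<in>K. linear_form r (c k) * restr (S N) (g k))"
        unfolding g(1) restr_sum trunc ..
      finally show ?thesis
        by (rule relI) (use g(2) filt_restr in blast)
    qed
    have "?l * h' \<in> rel c K {} \<delta>"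
      using rel_diff[OF Suc.prems(2) rel_mono[OF fh, of "{}" \<delta>]] by simp
    then have "?l * h' \<in> combos r c K" using rel_combos by blast
    then have "h' \<in> combos r c K" by (rule independent_form_regular[OF K ind])
    moreover have "h' \<in> filt {} \<delta>" by (rule filt_mono[OF h'f]) auto
    ultimately have "h' \<in> rel c K {} (\<lambda>i. \<delta> i - w k i)" using rel_combos by blast
    then have "h' \<in> rel c K A (\<lambda>i. \<delta> i - w k i)"
      by (rule Suc.IH[rotated]) (auto simp: h'_def h'f[unfolded h'_def])
    then have "?l * h' \<in> rel c K A \<delta>"
      by (rule rel_mult[OF _ form_filt[OF adm]]) auto
    from rel_add[OF fh this] show ?case by simp
  qed
  show ?thesis
    unfolding saturated_def
  proof (intro allI impI)
    fix \<delta> and f :: "(nat, 'k) mpoly" assume f: "f \<in> rel c K {} \<delta>" "f \<in> filt A \<delta>"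
    have "keys f \<subseteq> S (Suc (nat (Max (insert 0 (wt (\<lambda>_. 1) ` keys f)))))"
    proof
      fix m assume "m \<in> keys f"
      then have "wt (\<lambda>_. 1) m \<le> Max (insert 0 (wt (\<lambda>_. 1) ` keys f))" by simp
      then show "m \<in> S (Suc (nat (Max (insert 0 (wt (\<lambda>_. 1) ` keys f)))))"
        unfolding S_def by simp
    qed
    then show "f \<in> rel c K A \<delta>" using f by (rule main)
  qed
qed

lemma saturated_subset':
  assumes K: "finite K" "K' \<subseteq> K" and adm: "admissible c K A" and ind: "row_indep r c K"
    and sat: "saturated c K A"
  shows "saturated c K' A"
proof -
  have "saturated c (K - T) A" if "finite T" "T \<subseteq> K" for T
    using that
  proof (induction T)
    case (insert k T)
    have eq: "insert k (K - insert k T) = K - T" using insert by auto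
    have "admissible c (K - T) A" by (rule admissible_mono[OF adm]) auto
    moreover have "row_indep r c (K - T)" by (rule row_indep_subset[OF ind K(1)]) auto
    moreover have "saturated c (K - T) A" using insert by auto
    moreover have "finite (K - insert k T)" "k \<notin> K - insert k T" using K by auto
    ultimately show ?case using saturated_subset[of "K - insert k T" k c A] unfolding eq by blast
  qed (use sat in simp)
  from this[of "K - K'"] show ?thesis using K by (simp add: double_diff)
qed

text \<open>A form whose lowest part depends on those of the given forms acts as zero on the cohomology
  of the quotient, because every direction acts as zero by \<open>contr_homotopy\<close>. Hence the connecting
  map that lowers the degree from \<open>Suc i\<close> to \<open>i\<close> is injective.\<close>

lemma acyclic_remove:
  fixes c :: "nat \<Rightarrow> nat \<Rightarrow> 'k::field"
  assumes K: "finite K" "k \<notin> K" and A: "finite A"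
    and ind: "row_indep r c (insert k K)" and sat: "saturated c K A" and adm: "admissible c (insert k K) A"
    and dec: "linear_form r (c k) = (\<Sum>k'\<in>K. const (a k') * linear_form r (c k')) + (\<Sum>l\<in>A. q l)"
    and a: "\<And>k' i. k' \<in> K \<Longrightarrow> a k' \<noteq> 0 \<Longrightarrow> i \<in> A \<Longrightarrow> w k' i = w k i"
    and q: "\<And>l. l \<in> A \<Longrightarrow> q l \<in> filt A (\<lambda>i. w k i + (if i = l then 1 else 0))"
    and ac: "koszul_acyclic c (insert k K) A i"
  shows "koszul_acyclic c K A (Suc i)"
  unfolding koszul_acyclic_def
proof (intro allI impI)
  fix \<delta> and x :: "nat set \<Rightarrow> (nat, 'k) mpoly"
  assume x: "x \<in> cochain A (Suc i) \<delta>"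
    and cyc: "\<forall>B\<subseteq>A. card B = Suc (Suc i) \<longrightarrow> cobd x B \<in> rel c K A (lower \<delta> B)"
  let ?l = "linear_form r (c k)"
  define \<delta>' where "\<delta>' = (\<lambda>i. \<delta> i + w k i)"
  have lf: "?l \<in> filt A (w k)" by (rule form_filt[OF adm]) simp
  define s where "s = (\<Sum>k'\<in>K. const (a k') * linear_form r (c k'))"
  have s_mult: "s * g \<in> rel c K A (lower \<delta>' B)" if g: "g \<in> filt A (lower \<delta> B)" for g B
  proof (rule relI[where g = "\<lambda>k'. const (a k') * g"])
    show "s * g = (\<Sum>k'\<in>K. linear_form r (c k') * (const (a k') * g))"
      by (simp only: s_def sum_distrib_right) (simp only: mult_ac)
    fix k' assume k': "k' \<in> K"
    show "const (a k') * g \<in> filt A (\<lambda>i. lower \<delta>' B i - w k' i)"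
    proof (cases "a k' = 0")
      case False
      show ?thesis by (rule filt_mult'[OF filt_const g]) (simp add: a[OF k' False] lower_def \<delta>'_def)
    qed simp
  qed
  \<comment> \<open>A primitive of the product of the form and \<open>x\<close>.\<close>
  define z where "z = (\<lambda>B. \<Sum>l\<in>A. q l * contr l x B)"
  have z: "z \<in> cochain A i \<delta>'"
    unfolding cochain_def
  proof (intro CollectI allI impI)
    fix B assume B: "B \<subseteq> A" "card B = i"
    have fB: "finite B" using B A finite_subset by blast
    have "q l * contr l x B \<in> filt A (lower \<delta>' B)" if l: "l \<in> A" for l
    proof (cases "l \<in> B")
      case False
      have "x (insert l B) \<in> filt A (lower \<delta> (insert l B))"
        by (rule cochainD[OF x]) (use False B l fB in auto)
      then show ?thesis using False
        by (intro filt_mult'[OF q[OF l], of _ "lower \<delta> (insert l B)"]) (auto simp: contr_def filt_ksign lower_def \<delta>'_def)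
    qed (simp add: contr_def)
    then show "z B \<in> filt A (lower \<delta>' B)" unfolding z_def by (rule filt_sum)
  qed
  have z_cobd: "?l * x B - cobd z B \<in> rel c K A (lower \<delta>' B)" if B: "B \<subseteq> A" "card B = Suc i" for B
  proof -
    have fB: "finite B" using B A finite_subset by blast
    have "?l * x B = s * x B + (\<Sum>l\<in>A. q l * (cobd (contr l x) B + contr l (cobd x) B))"
      unfolding dec s_def[symmetric] by (simp only: contr_homotopy[OF fB] distrib_right sum_distrib_right)
    also have "\<dots> = s * x B + (\<Sum>l\<in>A. q l * contr l (cobd x) B) + cobd z B"
      unfolding z_def cobd_sum cobd_mult by (simp add: distrib_left sum.distrib)
    finally have eq: "?l * x B - cobd z B = s * x B + (\<Sum>l\<in>A. q l * contr l (cobd x) B)" by simp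
    have "q l * contr l (cobd x) B \<in> rel c K A (lower \<delta>' B)" if l: "l \<in> A" for l
    proof (cases "l \<in> B")
      case False
      have "cobd x (insert l B) \<in> rel c K A (lower \<delta> (insert l B))"
        using cyc False B l fB by auto
      then have "contr l (cobd x) B \<in> rel c K A (lower \<delta> (insert l B))"
        using False by (simp add: contr_def rel_ksign)
      then show ?thesis
        by (rule rel_mult[OF _ q[OF l]]) (use False in \<open>auto simp: lower_def \<delta>'_def\<close>)
    qed (simp add: contr_def)
    then show ?thesis unfolding eq by (intro rel_add s_mult cochainD[OF x B] rel_sum)
  qed
  have z_cyc: "cobd z B \<in> rel c (insert k K) A (lower \<delta>' B)" if B: "B \<subseteq> A" "card B = Suc i" for B
  proof (rule rel_insertI[OF K])
    show "cobd z B - ?l * x B \<in> rel c K A (lower \<delta>' B)"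
      using rel_uminus[OF z_cobd[OF B]] by simp
    show "x B \<in> filt A (\<lambda>i. lower \<delta>' B i - w k i)"
      by (rule filt_mono[OF cochainD[OF x B]]) (auto simp: lower_def \<delta>'_def)
  qed
  obtain y where y: "\<And>B. B \<subseteq> A \<Longrightarrow> card B = i \<Longrightarrow> z B - cobd y B \<in> rel c (insert k K) A (lower \<delta>' B)"
    using koszul_acyclicE[OF ac z z_cyc] by blast
  have "\<forall>B. \<exists>t. B \<subseteq> A \<longrightarrow> card B = i \<longrightarrow> z B - cobd y B - ?l * t \<in> rel c K A (lower \<delta>' B) \<and> t \<in> filt A (lower \<delta> B)"
  proof
    fix B
    show "\<exists>t. B \<subseteq> A \<longrightarrow> card B = i \<longrightarrow> z B - cobd y B - ?l * t \<in> rel c K A (lower \<delta>' B) \<and> t \<in> filt A (lower \<delta> B)"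
    proof (cases "B \<subseteq> A \<and> card B = i")
      case True
      then obtain t where t: "z B - cobd y B - ?l * t \<in> rel c K A (lower \<delta>' B)" "t \<in> filt A (\<lambda>i. lower \<delta>' B i - w k i)"
        using rel_insertE[OF K y] by blast
      have "t \<in> filt A (lower \<delta> B)" by (rule filt_mono[OF t(2)]) (auto simp: lower_def \<delta>'_def)
      then show ?thesis using t(1) by blast
    qed auto
  qed
  then obtain t where t: "\<And>B. B \<subseteq> A \<Longrightarrow> card B = i \<Longrightarrow> z B - cobd y B - ?l * t B \<in> rel c K A (lower \<delta>' B)"
      "\<And>B. B \<subseteq> A \<Longrightarrow> card B = i \<Longrightarrow> t B \<in> filt A (lower \<delta> B)"
    by metis
  have t_cochain: "t \<in> cochain A i \<delta>" using t(2) by (simp add: cochain_def)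
  have "x B - cobd t B \<in> rel c K A (lower \<delta> B)" if B: "B \<subseteq> A" "card B = Suc i" for B
  proof -
    have fB: "finite B" using B A finite_subset by blast
    have "cobd (\<lambda>B. z B - cobd y B - ?l * t B) B \<in> rel c K A (lower \<delta>' B)"
      by (rule cobd_rel[OF A B t(1)])
    then have "cobd z B - ?l * cobd t B \<in> rel c K A (lower \<delta>' B)"
      by (simp add: cobd_diff cobd_mult cobd_cobd[OF fB])
    from rel_add[OF z_cobd[OF B] this]
    have "?l * (x B - cobd t B) \<in> rel c K A (lower \<delta>' B)" by (simp add: algebra_simps)
    then show ?thesis
      by (rule form_regular[OF K ind sat filt_diff[OF cochainD[OF x B] cobd_filt[OF A B t_cochain]]])
  qed
  then show "\<exists>y. (\<forall>B\<subseteq>A. Suc (card B) = Suc i \<longrightarrow> y B \<in> filt A (lower \<delta> B)) \<and>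
          (\<forall>B\<subseteq>A. card B = Suc i \<longrightarrow> x B - cobd y B \<in> rel c K A (lower \<delta> B))"
    using t(2) by (intro exI[of _ t]) auto
qed

text \<open>In a dependence between lowest parts only the forms of the same weight on \<open>A\<close> count. Subtracting
  their combination leaves terms of larger weight in some direction.\<close>

lemma form_decomposition:
  fixes c :: "nat \<Rightarrow> nat \<Rightarrow> 'k::field"
  assumes A: "finite A" and adm: "admissible c (insert k K0) A"
    and dep: "\<And>j. j < r \<Longrightarrow> lead c A k j = (\<Sum>k'\<in>K0. b k' * lead c A k' j)"
  obtains a q where "linear_form r (c k) = (\<Sum>k'\<in>K0. const (a k') * linear_form r (c k')) + (\<Sum>l\<in>A. q l)"
    "\<And>k' i. a k' \<noteq> 0 \<Longrightarrow> i \<in> A \<Longrightarrow> w k' i = w k i"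
    "\<And>l. l \<in> A \<Longrightarrow> q l \<in> filt A (\<lambda>i. w k i + (if i = l then 1 else 0))"
proof -
  define a where "a = (\<lambda>k'. if \<forall>i\<in>A. w k' i = w k i then b k' else 0)"
  define e where "e = (\<lambda>j. c k j - (\<Sum>k'\<in>K0. a k' * c k' j))"
  have e: "(\<forall>i\<in>A. w k i \<le> u i j) \<and> (\<exists>i\<in>A. w k i < u i j)" if j: "j < r" "e j \<noteq> 0" for j
  proof -
    have ge: "w k i \<le> u i j" if i: "i \<in> A" for i
    proof (rule ccontr)
      assume no: "\<not> w k i \<le> u i j"
      have "c k j = 0" using adm j(1) i no unfolding admissible_def by blast
      moreover have "a k' * c k' j = 0" if "k' \<in> K0" for k'
      proof (cases "a k' = 0")
        case False
        then have "w k' i = w k i" using i by (auto simp: a_def split: if_splits)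
        moreover have "c k' j \<noteq> 0 \<Longrightarrow> w k' i \<le> u i j"
          using adm j(1) i that unfolding admissible_def by blast
        ultimately show ?thesis using no by auto
      qed simp
      ultimately show False using j(2) by (simp add: e_def)
    qed
    moreover have "\<exists>i\<in>A. u i j \<noteq> w k i"
    proof (rule ccontr)
      assume "\<not> (\<exists>i\<in>A. u i j \<noteq> w k i)"
      then have eq: "\<forall>i\<in>A. u i j = w k i" by blast
      then have "c k j = lead c A k j" by (simp add: lead_def)
      also have "\<dots> = (\<Sum>k'\<in>K0. b k' * lead c A k' j)" by (rule dep[OF j(1)])
      also have "\<dots> = (\<Sum>k'\<in>K0. a k' * c k' j)"
        by (rule sum.cong) (use eq in \<open>auto simp: lead_def a_def\<close>)
      finally show False using j(2) by (simp add: e_def)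
    qed
    ultimately show ?thesis by (metis le_less)
  qed
  define q where "q = (\<lambda>l. restr (slot A (\<lambda>i. w k i + 1) l) (linear_form r e))"
  have ef: "linear_form r e \<in> filt A (w k)" by (rule linear_form_filt) (use e in auto)
  have "linear_form r e = (\<Sum>l\<in>A. q l)"
    unfolding q_def
  proof (rule slot_decomp[OF A])
    fix m assume "m \<in> keys (linear_form r e)"
    then obtain j where "j < r" "e j \<noteq> 0" "m = Poly_Mapping.single j (Suc 0)" by (auto simp: keys_linear_form)
    then show "\<exists>l\<in>A. w k l + 1 \<le> wt (u l) m" using e[of j] by (auto simp: add1_zle_eq)
  qed
  moreover have "linear_form r e = linear_form r (c k) - (\<Sum>k'\<in>K0. const (a k') * linear_form r (c k'))"
    unfolding e_def linear_form_diff linear_form_sum linear_form_scale ..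
  ultimately have "linear_form r (c k) = (\<Sum>k'\<in>K0. const (a k') * linear_form r (c k')) + (\<Sum>l\<in>A. q l)"
    by (simp add: algebra_simps)
  moreover have "w k' i = w k i" if "a k' \<noteq> 0" "i \<in> A" for k' i
    using that by (auto simp: a_def split: if_splits)
  moreover have "q l \<in> filt A (\<lambda>i. w k i + (if i = l then 1 else 0))" for l
  proof (rule filtI)
    fix m i assume "m \<in> keys (q l)" "i \<in> A"
    then show "w k i + (if i = l then 1 else 0) \<le> wt (u i) m"
      using filtD(2)[OF ef, of m i] by (auto simp: q_def slot_def)
  qed (use filtD(1)[OF ef] in \<open>auto simp: q_def\<close>)
  ultimately show thesis by (rule that)
qed

text \<open>The constant \<open>1\<close> is not a boundary in top degree: boundaries involve only monomials of positive
  weight in some direction, and combinations of linear forms have no constant term.\<close>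

lemma not_acyclic_top:
  fixes c :: "nat \<Rightarrow> nat \<Rightarrow> 'k::field"
  assumes A: "finite A"
  shows "\<not> koszul_acyclic c K A (card A)"
proof
  assume ac: "koszul_acyclic c K A (card A)"
  define \<delta> :: "nat \<Rightarrow> int" where "\<delta> = (\<lambda>_. 1)"
  define x :: "nat set \<Rightarrow> (nat, 'k) mpoly" where "x = (\<lambda>_. 1)"
  have BA: "B = A" if "B \<subseteq> A" "card B = card A" for B using that A card_subset_eq by blast
  have "(1 :: (nat, 'k) mpoly) \<in> filt A (\<lambda>i. 0)" using filt_const[of 1 A] by simp
  then have one: "(1 :: (nat, 'k) mpoly) \<in> filt A (lower \<delta> A)"
    by (rule filt_mono) (simp_all add: lower_def \<delta>_def)
  have "x \<in> cochain A (card A) \<delta>"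
    unfolding cochain_def
  proof (intro CollectI allI impI)
    fix B assume "B \<subseteq> A" "card B = card A"
    then have "B = A" by (rule BA)
    then show "x B \<in> filt A (lower \<delta> B)" using one by (simp add: x_def)
  qed
  moreover have "cobd x B \<in> rel c K A (lower \<delta> B)" if "B \<subseteq> A" "card B = Suc (card A)" for B
    using card_mono[OF A that(1)] that(2) by simp
  ultimately obtain y where y: "\<And>B. B \<subseteq> A \<Longrightarrow> Suc (card B) = card A \<Longrightarrow> y B \<in> filt A (lower \<delta> B)"
    "\<And>B. B \<subseteq> A \<Longrightarrow> card B = card A \<Longrightarrow> x B - cobd y B \<in> rel c K A (lower \<delta> B)"
    using koszul_acyclicE[OF ac] by blast
  have "lookup (cobd y A) 0 = 0"
    unfolding cobd_def lookup_sum
  proof (rule sum.neutral, rule ballI)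
    fix l assume l: "l \<in> A"
    have "ksign l A * y (A - {l}) \<in> filt A (lower \<delta> (A - {l}))"
      unfolding filt_ksign by (rule y(1)) (use card_Suc_Diff1[OF A l] in auto)
    from filtD(2)[OF this _ l, of 0] show "lookup (ksign l A * y (A - {l})) 0 = 0"
      by (auto simp: lower_def \<delta>_def in_keys_iff)
  qed
  moreover have "lookup f 0 = 0" if f: "f \<in> rel c K A \<epsilon>" for f \<epsilon>
  proof -
    obtain g where g: "f = (\<Sum>k\<in>K. linear_form r (c k) * g k)" using f by (rule relE)
    have "0 \<notin> keys (linear_form r b * h)" for b :: "nat \<Rightarrow> 'k" and h
    proof
      assume "0 \<in> keys (linear_form r b * h)"
      then obtain m m' where m: "m \<in> keys (linear_form r b)" "0 = m + m'" by (rule keys_mult_mem)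
      from m(1) obtain j where "m = Poly_Mapping.single j (Suc 0)" by (auto simp: keys_linear_form)
      with arg_cong[OF m(2), of "\<lambda>m. lookup m j"] show False by (simp add: lookup_add)
    qed
    then show ?thesis by (simp add: g lookup_sum in_keys_iff)
  qed
  ultimately have "lookup (x A) 0 = 0" using y(2)[of A] by (force simp: lookup_minus)
  then show False by (simp add: x_def)
qed

text \<open>If there were \<open>card A\<close> forms whose lowest parts depend on those of \<open>K0\<close>, adding them one at a time
  would move the class of \<open>1\<close> from degree \<open>card A\<close> to degree \<open>0\<close>, where saturation leaves nothing.\<close>

theorem rank_if_saturated:
  fixes c :: "nat \<Rightarrow> nat \<Rightarrow> 'k::field"
  assumes A: "finite A" "A \<noteq> {}" and K: "finite K" and adm: "admissible c K A" and ind: "row_indep r c K"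
    and sat: "saturated c K A"
  shows "\<exists>K0\<subseteq>K. row_indep r (lead c A) K0 \<and> card (K - K0) < card A"
proof -
  obtain K0 where K0: "K0 \<subseteq> K" "row_indep r (lead c A) K0"
      "\<And>k. k \<in> K - K0 \<Longrightarrow> \<not> row_indep r (lead c A) (insert k K0)"
    using ex_maximal_row_indep[OF K] by blast
  have fK0: "finite K0" using K0(1) K finite_subset by blast
  have "card (K - K0) < card A"
  proof (rule ccontr)
    assume "\<not> card (K - K0) < card A"
    then obtain K1 where K1: "K1 \<subseteq> K - K0" "card K1 = card A" "finite K1"
      using obtain_subset_with_card_n[of "card A" "K - K0"] by auto
    have notac: "\<not> koszul_acyclic c (K0 \<union> K') A (card A - card K')" if "finite K'" "K' \<subseteq> K1" for K'
      using that
    proof (induction K')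
      case empty then show ?case using not_acyclic_top[OF A(1)] by simp
    next
      case (insert k K')
      have k: "k \<in> K - K0" "k \<notin> K0" "k \<notin> K0 \<union> K'" using insert K1 by auto
      have sub: "insert k (K0 \<union> K') \<subseteq> K" using insert K1 K0 by auto
      have adm': "admissible c (insert k (K0 \<union> K')) A" by (rule admissible_mono[OF adm sub order_refl])
      have ind': "row_indep r c (insert k (K0 \<union> K'))" by (rule row_indep_subset[OF ind K sub])
      have sat': "saturated c (K0 \<union> K') A"
        by (rule saturated_subset'[OF K _ adm ind sat]) (use sub in auto)
      have fin: "finite (K0 \<union> K')" using fK0 insert by auto
      obtain b where b: "\<And>j. j < r \<Longrightarrow> lead c A k j = (\<Sum>k'\<in>K0. b k' * lead c A k' j)"
        using row_dependence[OF fK0 k(2) K0(2) K0(3)[OF k(1)]] by blast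
      have "admissible c (insert k K0) A" by (rule admissible_mono[OF adm']) auto
      then obtain a q where aq: "linear_form r (c k) = (\<Sum>k'\<in>K0. const (a k') * linear_form r (c k')) + (\<Sum>l\<in>A. q l)"
        "\<And>k' i. a k' \<noteq> 0 \<Longrightarrow> i \<in> A \<Longrightarrow> w k' i = w k i"
        "\<And>l. l \<in> A \<Longrightarrow> q l \<in> filt A (\<lambda>i. w k i + (if i = l then 1 else 0))"
        using form_decomposition[OF A(1) _ b] by blast
      define a' where "a' = (\<lambda>k'. if k' \<in> K0 then a k' else 0)"
      have "(\<Sum>k'\<in>K0. const (a k') * linear_form r (c k')) = (\<Sum>k'\<in>K0 \<union> K'. const (a' k') * linear_form r (c k'))"
        by (rule sum.mono_neutral_cong_left) (use fin in \<open>auto simp: a'_def\<close>)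
      then have dec: "linear_form r (c k) = (\<Sum>k'\<in>K0 \<union> K'. const (a' k') * linear_form r (c k')) + (\<Sum>l\<in>A. q l)"
        using aq(1) by simp
      have a': "w k' i = w k i" if "k' \<in> K0 \<union> K'" "a' k' \<noteq> 0" "i \<in> A" for k' i
        using that aq(2) by (auto simp: a'_def split: if_splits)
      have "card (insert k K') \<le> card A"
        using card_mono[OF K1(3) insert.prems] K1(2) by simp
      then have deg: "card A - card K' = Suc (card A - card (insert k K'))" using insert by simp
      show ?case
      proof
        assume "koszul_acyclic c (K0 \<union> insert k K') A (card A - card (insert k K'))"
        then have ac: "koszul_acyclic c (insert k (K0 \<union> K')) A (card A - card (insert k K'))" by simp
        have "koszul_acyclic c (K0 \<union> K') A (card A - card K')"
          unfolding deg by (rule acyclic_remove[OF fin k(3) A(1) ind' sat' adm' dec _ _ ac]) (fact a', fact aq(3))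
        then show False using insert by auto
      qed
    qed
    have sat1: "saturated c (K0 \<union> K1) A"
      by (rule saturated_subset'[OF K _ adm ind sat]) (use K0 K1 in auto)
    have "koszul_acyclic c (K0 \<union> K1) A 0"
      unfolding koszul_acyclic_def
    proof (intro allI impI)
      fix \<delta> and x :: "nat set \<Rightarrow> (nat, 'k) mpoly"
      assume x: "x \<in> cochain A 0 \<delta>" and cyc: "\<forall>B\<subseteq>A. card B = Suc 0 \<longrightarrow> cobd x B \<in> rel c (K0 \<union> K1) A (lower \<delta> B)"
      obtain l where l: "l \<in> A" using A by auto
      have "ksign l {l} * cobd x {l} \<in> rel c (K0 \<union> K1) A (lower \<delta> {l})"
        using cyc l by (intro rel_ksign) auto
      then have "x {} \<in> rel c (K0 \<union> K1) A (lower \<delta> {l})" by (simp add: cobd_def ksign_sq)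
      then have "x {} \<in> rel c (K0 \<union> K1) {} (lower \<delta> {})"
        using rel_mono[of "x {}" c "K0 \<union> K1" A "lower \<delta> {l}" "{}"] by auto
      moreover have "x {} \<in> filt A (lower \<delta> {})" by (rule cochainD[OF x]) auto
      ultimately have x0: "x {} \<in> rel c (K0 \<union> K1) A (lower \<delta> {})"
        using sat1 unfolding saturated_def by blast
      show "\<exists>y. (\<forall>B\<subseteq>A. Suc (card B) = 0 \<longrightarrow> y B \<in> filt A (lower \<delta> B)) \<and>
          (\<forall>B\<subseteq>A. card B = 0 \<longrightarrow> x B - cobd y B \<in> rel c (K0 \<union> K1) A (lower \<delta> B))"
      proof (intro exI[of _ x] conjI allI impI)
        fix B assume "B \<subseteq> A" "card B = 0"
        then have "B = {}" using finite_subset[OF _ A(1)] by simp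
        then show "x B - cobd x B \<in> rel c (K0 \<union> K1) A (lower \<delta> B)" using x0 by simp
      qed simp
    qed
    then show False using notac[OF K1(3) order_refl] K1(2) by simp
  qed
  then show ?thesis using K0 by blast
qed

end

section \<open>Row rank and column rank\<close>

lemma homogeneous_system:
  fixes a :: "'i \<Rightarrow> 'j \<Rightarrow> 'k::field"
  assumes "finite I" "finite J" "card I < card J"
  shows "\<exists>x. (\<forall>i\<in>I. (\<Sum>j\<in>J. a i j * x j) = 0) \<and> (\<exists>j\<in>J. x j \<noteq> 0)"
  using assms
proof (induction I arbitrary: J a rule: finite_induct)
  case empty
  then obtain j where "j \<in> J" by fastforce
  then show ?case by (intro exI[of _ "\<lambda>_. 1"]) auto
next
  case (insert i I)
  show ?case
  proof (cases "\<forall>j\<in>J. a i j = 0")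
    case True
    have "card I < card J" using insert by simp
    then obtain x where x: "\<forall>i\<in>I. (\<Sum>j\<in>J. a i j * x j) = 0" "\<exists>j\<in>J. x j \<noteq> 0"
      using insert.IH[OF insert.prems(1), of a] by blast
    have "(\<Sum>j\<in>J. a i j * x j) = 0" using True by (intro sum.neutral) auto
    then show ?thesis using x by (intro exI[of _ x]) auto
  next
    case False
    then obtain j0 where j0: "j0 \<in> J" "a i j0 \<noteq> 0" by blast
    define a' where "a' = (\<lambda>i' j. a i' j - a i' j0 * a i j / a i j0)"
    have "card I < card (J - {j0})" using insert j0(1) by simp
    then obtain x where x: "\<forall>i\<in>I. (\<Sum>j\<in>J - {j0}. a' i j * x j) = 0" "\<exists>j\<in>J - {j0}. x j \<noteq> 0"
      using insert.IH[OF finite_Diff[OF insert.prems(1)], of "{j0}" a'] by blast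
    define s where "s = (\<Sum>j\<in>J - {j0}. a i j * x j)"
    define y where "y = (\<lambda>j. if j = j0 then - s / a i j0 else x j)"
    have split: "(\<Sum>j\<in>J. a i' j * y j) = a i' j0 * (- s / a i j0) + (\<Sum>j\<in>J - {j0}. a i' j * x j)" for i'
    proof -
      have "(\<Sum>j\<in>J. a i' j * y j) = a i' j0 * y j0 + (\<Sum>j\<in>J - {j0}. a i' j * y j)"
        by (rule sum.remove[OF insert.prems(1) j0(1)])
      also have "(\<Sum>j\<in>J - {j0}. a i' j * y j) = (\<Sum>j\<in>J - {j0}. a i' j * x j)"
        by (rule sum.cong) (auto simp: y_def)
      finally show ?thesis by (simp add: y_def)
    qed
    have "(\<Sum>j\<in>J. a i' j * y j) = 0" if "i' \<in> I" for i'
    proof -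
      have "0 = (\<Sum>j\<in>J - {j0}. a' i' j * x j)" using x(1) that by simp
      also have "\<dots> = (\<Sum>j\<in>J - {j0}. a i' j * x j - (a i' j0 / a i j0) * (a i j * x j))"
        by (rule sum.cong) (auto simp: a'_def left_diff_distrib)
      also have "\<dots> = (\<Sum>j\<in>J - {j0}. a i' j * x j) - (a i' j0 / a i j0) * s"
        by (simp only: sum_subtractf sum_distrib_left[symmetric] s_def)
      finally show ?thesis unfolding split by simp
    qed
    moreover have "(\<Sum>j\<in>J. a i j * y j) = 0" unfolding split using j0 by (simp add: s_def)
    moreover have "\<exists>j\<in>J. y j \<noteq> 0" using x(2) by (auto simp: y_def)
    ultimately show ?thesis by (intro exI[of _ y]) auto
  qed
qed

text \<open>The rank of a matrix is the dimension of its column space, whereas the arguments above concern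
  independent rows. A maximal set of independent columns mediates between the two.\<close>

lemma column_basis:
  fixes c :: "nat \<Rightarrow> nat \<Rightarrow> 'k::field"
  obtains J where "J \<subseteq> {..<r}" "card J = vec_space.rank d (Matrix.mat d r (\<lambda>(k, j). c k j))"
    "\<forall>x. (\<forall>k<d. (\<Sum>j\<in>J. x j * c k j) = 0) \<longrightarrow> (\<forall>j\<in>J. x j = 0)"
    "\<forall>j<r. \<exists>x. \<forall>k<d. c k j = (\<Sum>j'\<in>J. x j' * c k j')"
proof -
  interpret vec_space "TYPE('k)" d .
  let ?M = "Matrix.mat d r (\<lambda>(k, j). c k j)"
  have M: "?M \<in> carrier_mat d r" by simp
  have cols: "set (cols ?M) = col ?M ` {..<r}" by (auto simp: cols_def)
  have colM: "col ?M j $ k = c k j" if "k < d" "j < r" for k j using that by simp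
  have car: "set (cols ?M) \<subseteq> carrier_vec d" using cols_dim[of ?M] by simp
  obtain S where S: "maximal S (\<lambda>T. T \<subseteq> set (cols ?M) \<and> lin_indpt T)"
    using maximal_exists_superset[of "set (cols ?M)" "\<lambda>T. T \<subseteq> set (cols ?M) \<and> lin_indpt T" "{}"]
      finite_lin_indpt2[of "{}"] by auto
  have rk: "rank ?M = card S" by (rule rank_card_indpt[OF M S])
  have S1: "S \<subseteq> set (cols ?M)" "lin_indpt S" using S by (auto simp: maximal_def)
  have S2: "\<not> lin_indpt (insert v S)" if "v \<in> set (cols ?M)" "v \<notin> S" for v
    using S that S1(1) unfolding maximal_def by (metis insertI1 insert_subset subset_insertI)
  have fS: "finite S" using S1(1) finite_subset by blast
  have Sc: "S \<subseteq> carrier_vec d" using S1(1) car by blast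
  obtain J where J: "J \<subseteq> {..<r}" "inj_on (col ?M) J" "S = col ?M ` J"
    using subset_image_inj[of S "col ?M" "{..<r}"] S1(1) unfolding cols by blast
  have fJ: "finite J" using J(1) finite_subset by blast
  have sumS: "(\<Sum>v\<in>S. f v * v $ k) = (\<Sum>j\<in>J. f (col ?M j) * c k j)" if "k < d" for f k
    unfolding J(3) sum.reindex[OF J(2)] using that J(1) by (auto intro!: sum.cong)
  show thesis
  proof (rule that)
    show "J \<subseteq> {..<r}" by fact
    show "card J = rank ?M" unfolding rk J(3) by (simp add: card_image[OF J(2)])
  next
    show "\<forall>x. (\<forall>k<d. (\<Sum>j\<in>J. x j * c k j) = 0) \<longrightarrow> (\<forall>j\<in>J. x j = 0)"
    proof (intro allI impI ballI)
      fix x j assume x: "\<forall>k<d. (\<Sum>j\<in>J. x j * c k j) = 0" and j: "j \<in> J"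
      define f where "f = (\<lambda>v. x (the_inv_into J (col ?M) v))"
      have f: "f (col ?M j) = x j" if "j \<in> J" for j
        using the_inv_into_f_f[OF J(2) that] by (simp add: f_def)
      have "lincomb f S = 0\<^sub>v d"
      proof (rule eq_vecI)
        fix k assume "k < dim_vec (0\<^sub>v d)"
        then have k: "k < d" by simp
        have "lincomb f S $ k = (\<Sum>j\<in>J. f (col ?M j) * c k j)"
          using lincomb_index[OF k Sc] sumS[OF k] by simp
        also have "\<dots> = (\<Sum>j\<in>J. x j * c k j)" by (rule sum.cong) (auto simp: f)
        finally show "lincomb f S $ k = 0\<^sub>v d $ k" using x k by simp
      qed (simp add: lincomb_dim[OF fS Sc])
      then have "f (col ?M j) = 0"
        using S1(2) fS j unfolding lin_dep_def J(3) by auto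
      then show "x j = 0" using f[OF j] by simp
    qed
  next
    show "\<forall>j<r. \<exists>x. \<forall>k<d. c k j = (\<Sum>j'\<in>J. x j' * c k j')"
    proof (intro allI impI)
    fix j assume j: "j < r"
    show "\<exists>x. \<forall>k<d. c k j = (\<Sum>j'\<in>J. x j' * c k j')"
    proof (cases "col ?M j \<in> S")
      case True
      then obtain j1 where j1: "j1 \<in> J" "col ?M j = col ?M j1" unfolding J(3) by blast
      then have eq: "c k j = c k j1" if "k < d" for k using colM[OF that j] colM[OF that, of j1] J(1) by auto
      have "(\<Sum>j'\<in>J. (if j' = j1 then 1 else 0) * c k j') = c k j1" for k
        using j1(1) fJ by (simp add: if_distrib[of "\<lambda>t. t * _"] cong: if_cong)
      then show ?thesis using eq by (intro exI[of _ "\<lambda>j'. if j' = j1 then 1 else 0"]) auto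
    next
      case False
      let ?v = "col ?M j"
      have "?v \<in> set (cols ?M)" unfolding cols using j by blast
      then have "lin_dep (insert ?v S)" using S2 False by blast
      then obtain T f v where T: "finite T" "T \<subseteq> insert ?v S" "lincomb f T = 0\<^sub>v d" "v \<in> T" "f v \<noteq> 0"
        unfolding lin_dep_def by auto
      define g where "g = (\<lambda>v. if v \<in> T then f v else 0)"
      have Tc: "T \<subseteq> carrier_vec d" by (rule subset_trans[OF T(2)]) (use Sc car \<open>?v \<in> set (cols ?M)\<close> in blast)
      have g0: "g ?v * ?v $ k + (\<Sum>v\<in>S. g v * v $ k) = 0" if k: "k < d" for k
      proof -
        have "(\<Sum>v\<in>insert ?v S. g v * v $ k) = (\<Sum>v\<in>T. f v * v $ k)"
          by (rule sum.mono_neutral_cong_right) (use T fS in \<open>auto simp: g_def\<close>)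
        also have "\<dots> = 0" using lincomb_index[OF k Tc, of f] T(3) k by simp
        finally show ?thesis using False fS by simp
      qed
      have "g ?v \<noteq> 0"
      proof
        assume z: "g ?v = 0"
        have "lincomb g S = 0\<^sub>v d"
        proof (rule eq_vecI)
          fix k assume "k < dim_vec (0\<^sub>v d)"
          then have k: "k < d" by simp
          show "lincomb g S $ k = 0\<^sub>v d $ k" using lincomb_index[OF k Sc, of g] g0[OF k] z k by simp
        qed (simp add: lincomb_dim[OF fS Sc])
        then have "\<forall>v\<in>S. g v = 0" using S1(2) fS unfolding lin_dep_def by auto
        then show False using T(2,4,5) z unfolding g_def by (metis insertE subsetD)
      qed
      then have "c k j = (\<Sum>j'\<in>J. (- g (col ?M j') / g ?v) * c k j')" if k: "k < d" for k
      proof -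
        have "g ?v * c k j = - (\<Sum>j'\<in>J. g (col ?M j') * c k j')"
          using g0[OF k] unfolding sumS[OF k] colM[OF k j] by (simp add: add_eq_0_iff2)
        then have "c k j = - (\<Sum>j'\<in>J. g (col ?M j') * c k j') / g ?v"
          using \<open>g ?v \<noteq> 0\<close> by (simp add: field_simps)
        then show ?thesis by (simp add: sum_divide_distrib sum_negf)
      qed
      then show ?thesis by (intro exI[of _ "\<lambda>j'. - g (col ?M j') / g ?v"] allI impI)
    qed
    qed
  qed
qed

text \<open>Row rank equals column rank: if a maximal set of independent rows and one of independent columns
  had different sizes, one of two homogeneous systems would have more unknowns than equations.\<close>

lemma rank_le_iff_row_indep:
  fixes c :: "nat \<Rightarrow> nat \<Rightarrow> 'k::field"
  shows "(\<exists>K0\<subseteq>{..<d}. row_indep r c K0 \<and> card ({..<d} - K0) < s) \<longleftrightarrow>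
     d < s + vec_space.rank d (Matrix.mat d r (\<lambda>(k, j). c k j))"
proof -
  obtain J where J: "J \<subseteq> {..<r}" "card J = vec_space.rank d (Matrix.mat d r (\<lambda>(k, j). c k j))"
    "\<forall>x. (\<forall>k<d. (\<Sum>j\<in>J. x j * c k j) = 0) \<longrightarrow> (\<forall>j\<in>J. x j = 0)"
    "\<forall>j<r. \<exists>x. \<forall>k<d. c k j = (\<Sum>j'\<in>J. x j' * c k j')"
    by (rule column_basis[where c = c and d = d and r = r])
  have fJ: "finite J" using J(1) finite_subset by blast
  have le: "card K0 \<le> card J" if K0: "K0 \<subseteq> {..<d}" "row_indep r c K0" for K0
  proof (rule ccontr)
    assume "\<not> card K0 \<le> card J"
    then obtain y where y: "\<forall>j\<in>J. (\<Sum>k\<in>K0. c k j * y k) = 0" "\<exists>k\<in>K0. y k \<noteq> 0"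
      using homogeneous_system[OF fJ finite_subset[OF K0(1)], of "\<lambda>j k. c k j"] by auto
    have "(\<Sum>k\<in>K0. y k * c k j) = 0" if "j < r" for j
    proof -
      obtain x where x: "\<forall>k<d. c k j = (\<Sum>j'\<in>J. x j' * c k j')" using J(4) \<open>j < r\<close> by blast
      have "(\<Sum>k\<in>K0. y k * c k j) = (\<Sum>k\<in>K0. \<Sum>j'\<in>J. x j' * (c k j' * y k))"
        using x K0(1) by (intro sum.cong refl) (auto simp: sum_distrib_left mult_ac subset_eq)
      also have "\<dots> = (\<Sum>j'\<in>J. \<Sum>k\<in>K0. x j' * (c k j' * y k))" by (rule sum.swap)
      also have "\<dots> = (\<Sum>j'\<in>J. x j' * (\<Sum>k\<in>K0. c k j' * y k))" by (simp add: sum_distrib_left)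
      also have "\<dots> = 0" using y(1) by (intro sum.neutral) auto
      finally show ?thesis .
    qed
    then show False using row_indepD[OF K0(2)] y(2) by blast
  qed
  obtain K0 where K0: "K0 \<subseteq> {..<d}" "row_indep r c K0" "\<And>k. k \<in> {..<d} - K0 \<Longrightarrow> \<not> row_indep r c (insert k K0)"
    using ex_maximal_row_indep[of "{..<d}" r c] by auto
  have fK0: "finite K0" using K0(1) finite_subset by blast
  have ge: "card J \<le> card K0"
  proof (rule ccontr)
    assume "\<not> card J \<le> card K0"
    then obtain x where x: "\<forall>k\<in>K0. (\<Sum>j\<in>J. c k j * x j) = 0" "\<exists>j\<in>J. x j \<noteq> 0"
      using homogeneous_system[OF fK0 fJ, of c] by auto
    have "(\<Sum>j\<in>J. x j * c k j) = 0" if k: "k < d" for k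
    proof (cases "k \<in> K0")
      case True then show ?thesis using x(1) by (simp add: mult.commute)
    next
      case False
      obtain a where a: "\<And>j. j < r \<Longrightarrow> c k j = (\<Sum>k'\<in>K0. a k' * c k' j)"
        using row_dependence[OF fK0 False K0(2) K0(3)] k False by auto
      have "(\<Sum>j\<in>J. x j * c k j) = (\<Sum>j\<in>J. \<Sum>k'\<in>K0. a k' * (c k' j * x j))"
        using a J(1) by (intro sum.cong refl) (auto simp: sum_distrib_left mult_ac subset_eq)
      also have "\<dots> = (\<Sum>k'\<in>K0. \<Sum>j\<in>J. a k' * (c k' j * x j))" by (rule sum.swap)
      also have "\<dots> = (\<Sum>k'\<in>K0. a k' * (\<Sum>j\<in>J. c k' j * x j))" by (simp add: sum_distrib_left)
      also have "\<dots> = 0" using x(1) by (intro sum.neutral) auto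
      finally show ?thesis .
    qed
    then show False using J(3) x(2) by blast
  qed
  have card_diff: "card ({..<d} - K) + card K = d" if "K \<subseteq> {..<d}" for K
    using card_Diff_subset[OF finite_subset[OF that] that] card_mono[OF _ that] by simp
  show ?thesis
  proof
    assume "\<exists>K0\<subseteq>{..<d}. row_indep r c K0 \<and> card ({..<d} - K0) < s"
    then obtain K where K: "K \<subseteq> {..<d}" "row_indep r c K" "card ({..<d} - K) < s" by blast
    show "d < s + vec_space.rank d (Matrix.mat d r (\<lambda>(k, j). c k j))"
      using card_diff[OF K(1)] le[OF K(1,2)] K(3) J(2) by linarith
  next
    assume "d < s + vec_space.rank d (Matrix.mat d r (\<lambda>(k, j). c k j))"
    then have "card ({..<d} - K0) < s" using card_diff[OF K0(1)] ge J(2) by linarith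
    then show "\<exists>K0\<subseteq>{..<d}. row_indep r c K0 \<and> card ({..<d} - K0) < s" using K0 by blast
  qed
qed

section \<open>Subrings of a type and ideals of polynomial rings\<close>

lemma ring_of_type_algebra_simps [simp]:
  fixes x y :: "'a::comm_ring_1"
  shows "carrier (ring_of_type_algebra :: 'a ring) = UNIV"
    "x \<otimes>\<^bsub>ring_of_type_algebra\<^esub> y = x * y" "x \<oplus>\<^bsub>ring_of_type_algebra\<^esub> y = x + y"
    "\<one>\<^bsub>ring_of_type_algebra\<^esub> = (1 :: 'a)" "\<zero>\<^bsub>ring_of_type_algebra\<^esub> = (0 :: 'a)"
  by (simp_all add: ring_of_type_algebra_def)

lemma ring_subring_on:
  fixes C :: "'a::comm_ring_1 set"
  assumes "1 \<in> C" "\<And>x. x \<in> C \<Longrightarrow> - x \<in> C" "\<And>x y. x \<in> C \<Longrightarrow> y \<in> C \<Longrightarrow> x + y \<in> C"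
    "\<And>x y. x \<in> C \<Longrightarrow> y \<in> C \<Longrightarrow> x * y \<in> C"
  shows "ring (subring_on C)"
proof -
  interpret R: ring "ring_of_type_algebra :: 'a ring" by (rule ring_from_type_algebra)
  have inv: "\<ominus>\<^bsub>ring_of_type_algebra\<^esub> x = - x" for x :: 'a
    by (rule R.minus_equality) simp_all
  have "subring C (ring_of_type_algebra :: 'a ring)"
    by (rule R.subringI) (use assms inv in simp_all)
  then show ?thesis by (rule R.subring_is_ring)
qed

lemma carrier_poly_ring_in [simp]: "carrier (poly_ring_in V) = {p. \<forall>m\<in>keys p. keys m \<subseteq> V}"
  by (simp add: poly_ring_in_def)

lemma poly_ring_in_simps [simp]:
  "x \<otimes>\<^bsub>poly_ring_in V\<^esub> y = x * y" "x \<oplus>\<^bsub>poly_ring_in V\<^esub> y = x + y"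
  "\<one>\<^bsub>poly_ring_in V\<^esub> = 1" "\<zero>\<^bsub>poly_ring_in V\<^esub> = 0"
  by (simp_all add: poly_ring_in_def)

lemma poly_in_add:
  "p \<in> carrier (poly_ring_in V) \<Longrightarrow> q \<in> carrier (poly_ring_in V) \<Longrightarrow> p + q \<in> carrier (poly_ring_in V)"
  using keys_add[of p q] by auto

lemma poly_in_mult:
  assumes "p \<in> carrier (poly_ring_in V)" "q \<in> carrier (poly_ring_in V)" shows "p * q \<in> carrier (poly_ring_in V)"
proof -
  have "keys m \<subseteq> V" if m: "m \<in> keys (p * q)" for m
  proof -
    obtain a b where "a \<in> keys p" "b \<in> keys q" "m = a + b" using m by (rule keys_mult_mem)
    moreover have "keys a \<subseteq> V" "keys b \<subseteq> V" using calculation assms by simp_all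
    ultimately show ?thesis using keys_add[of a b] by blast
  qed
  then show ?thesis by simp
qed

lemma poly_in_sum:
  "(\<And>x. x \<in> T \<Longrightarrow> f x \<in> carrier (poly_ring_in V)) \<Longrightarrow> sum f T \<in> carrier (poly_ring_in V)"
  by (induction T rule: infinite_finite_induct) (simp_all add: poly_in_add del: carrier_poly_ring_in, simp_all)

lemma poly_in_uminus: "p \<in> carrier (poly_ring_in V) \<Longrightarrow> - p \<in> carrier (poly_ring_in V)"
  by (simp add: in_keys_iff)

lemma ring_poly_ring_in: "ring (poly_ring_in V)"
proof -
  have "ring (subring_on (carrier (poly_ring_in V)))"
    by (rule ring_subring_on) (simp_all only: poly_in_add poly_in_mult poly_in_uminus, simp)
  then show ?thesis by (simp add: poly_ring_in_def)
qed

lemma genideal_finite_image: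
  fixes f :: "'i \<Rightarrow> (('x \<Rightarrow>\<^sub>0 'e::comm_monoid_add) \<Rightarrow>\<^sub>0 'a::comm_ring_1)"
  assumes I: "finite I" and f: "\<And>i. i \<in> I \<Longrightarrow> f i \<in> carrier (poly_ring_in V)"
  shows "Idl\<^bsub>poly_ring_in V\<^esub> (f ` I) = {(\<Sum>i\<in>I. f i * q i) | q. \<forall>i\<in>I. q i \<in> carrier (poly_ring_in V)}"
    (is "_ = ?S")
proof -
  let ?R = "poly_ring_in V :: (('x \<Rightarrow>\<^sub>0 'e) \<Rightarrow>\<^sub>0 'a) ring"
  interpret R: ring ?R by (rule ring_poly_ring_in)
  show "Idl\<^bsub>?R\<^esub> (f ` I) = ?S"
proof
  have SI: "(\<Sum>i\<in>I. f i * q i) \<in> ?S" if "\<forall>i\<in>I. q i \<in> carrier (?R)" for q using that by blast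
  have mult_closed: "x * y \<in> ?S" if x: "x \<in> carrier (?R)" and y: "y \<in> ?S" for x y
  proof -
    obtain q where q: "y = (\<Sum>i\<in>I. f i * q i)" "\<forall>i\<in>I. q i \<in> carrier (?R)" using y by blast
    have "x * y = (\<Sum>i\<in>I. f i * (x * q i))" by (simp add: q sum_distrib_left mult.left_commute)
    moreover have "\<forall>i\<in>I. x * q i \<in> carrier (?R)" using q(2) x poly_in_mult by blast
    ultimately show ?thesis using SI[of "\<lambda>i. x * q i"] by simp
  qed
  have S_carrier: "y \<in> carrier (?R)" if y: "y \<in> ?S" for y
  proof -
    obtain q where q: "y = (\<Sum>i\<in>I. f i * q i)" "\<forall>i\<in>I. q i \<in> carrier (?R)" using y by blast
    show ?thesis unfolding q(1) by (intro poly_in_sum poly_in_mult f bspec[OF q(2)])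
  qed
  have "ideal ?S (?R)"
  proof (rule idealI[OF ring_poly_ring_in])
    show "subgroup ?S (add_monoid (?R))"
    proof (rule R.add.subgroupI)
      show "?S \<subseteq> carrier (?R)" using S_carrier by blast
      show "?S \<noteq> {}" using SI[of "\<lambda>_. 0"] by auto
    next
      fix a assume a: "a \<in> ?S"
      have car: "a \<in> carrier (?R)" using a by (rule S_carrier)
      have "\<ominus>\<^bsub>?R\<^esub> a = - a"
        by (rule R.minus_equality) (use car poly_in_uminus in \<open>simp_all del: carrier_poly_ring_in\<close>)
      moreover have "(- 1) * a \<in> ?S" by (rule mult_closed[OF _ a]) (use poly_in_uminus[of 1 V] in simp)
      ultimately show "\<ominus>\<^bsub>?R\<^esub> a \<in> ?S" by simp
    next
      fix a b assume "a \<in> ?S" "b \<in> ?S"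
      then obtain q q' where q: "a = (\<Sum>i\<in>I. f i * q i)" "\<forall>i\<in>I. q i \<in> carrier (?R)"
          "b = (\<Sum>i\<in>I. f i * q' i)" "\<forall>i\<in>I. q' i \<in> carrier (?R)" by blast
      have "a + b = (\<Sum>i\<in>I. f i * (q i + q' i))" by (simp add: q distrib_left sum.distrib)
      moreover have "\<forall>i\<in>I. q i + q' i \<in> carrier (?R)" using q poly_in_add by blast
      ultimately show "a \<oplus>\<^bsub>?R\<^esub> b \<in> ?S" using SI[of "\<lambda>i. q i + q' i"] by simp
    qed
  next
    fix a x assume ax: "a \<in> ?S" "x \<in> carrier (?R)"
    show "x \<otimes>\<^bsub>?R\<^esub> a \<in> ?S" using mult_closed[OF ax(2,1)] by simp
    show "a \<otimes>\<^bsub>?R\<^esub> x \<in> ?S" using mult_closed[OF ax(2,1)] by (simp add: mult.commute)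
  qed
  moreover have "f ` I \<subseteq> ?S"
  proof
    fix y assume "y \<in> f ` I"
    then obtain i where i: "i \<in> I" "y = f i" by blast
    have "(\<Sum>i'\<in>I. f i' * (if i' = i then 1 else 0)) = y"
      using i I by (simp add: if_distrib cong: if_cong)
    then show "y \<in> ?S" using SI[of "\<lambda>i'. if i' = i then 1 else 0"] by auto
  qed
  ultimately show "Idl\<^bsub>?R\<^esub> (f ` I) \<subseteq> ?S" by (rule R.genideal_minimal)
next
  have sub: "f ` I \<subseteq> carrier (?R)" using f by blast
  interpret J: ideal "Idl\<^bsub>?R\<^esub> (f ` I)" ?R by (rule R.genideal_ideal[OF sub])
  show "?S \<subseteq> Idl\<^bsub>?R\<^esub> (f ` I)"
  proof
    fix y assume "y \<in> ?S"
    then obtain q where q: "y = (\<Sum>i\<in>I. f i * q i)" "\<forall>i\<in>I. q i \<in> carrier (?R)" by blast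
    have mem: "f i * q i \<in> Idl\<^bsub>?R\<^esub> (f ` I)" if "i \<in> I" for i
      using J.I_r_closed[of "f i" "q i"] R.genideal_self[OF sub] q(2) that by auto
    have "(\<Sum>i\<in>T. f i * q i) \<in> Idl\<^bsub>?R\<^esub> (f ` I)" if "finite T" "T \<subseteq> I" for T
      using that
    proof (induction T)
      case empty then show ?case using J.zero_closed by simp
    next
      case (insert i T)
      then show ?case using J.a_closed[of "f i * q i"] mem by auto
    qed
    then show "y \<in> Idl\<^bsub>?R\<^esub> (f ` I)" using I q(1) by simp
  qed
qed
qed

text \<open>A linear form that depends on the others could be omitted from the generators.\<close>

lemma minimal_linear_generators_row_indep:
  fixes c :: "nat \<Rightarrow> nat \<Rightarrow> 'k::field"
  assumes "minimal_linear_generators d r c L"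
  shows "row_indep r c {..<d}"
proof (rule ccontr)
  let ?R = "poly_ring_in {..<r} :: (nat, 'k) mpoly ring"
  let ?f = "\<lambda>k. linear_form r (c k)"
  interpret R: ring ?R by (rule ring_poly_ring_in)
  have lin: "?f k \<in> carrier ?R" for k by (auto simp: keys_linear_form)
  assume "\<not> row_indep r c {..<d}"
  then obtain a k0 where a: "\<And>j. j < r \<Longrightarrow> (\<Sum>k<d. a k * c k j) = 0" "k0 < d" "a k0 \<noteq> 0"
    unfolding row_indep_def by auto
  let ?K = "{..<d} - {k0}"
  have sub: "?f ` ?K \<subseteq> carrier ?R" using lin by blast
  have "?f k0 = (\<Sum>k\<in>?K. ?f k * const (- a k / a k0))"
  proof -
    have "linear_form r (\<lambda>j. \<Sum>k<d. a k * c k j) = 0" using a(1) by (simp add: linear_form_eq_0_iff)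
    then have "(\<Sum>k<d. const (a k) * ?f k) = 0" by (simp add: linear_form_sum linear_form_scale)
    then have "const (a k0) * ?f k0 = - (\<Sum>k\<in>?K. const (a k) * ?f k)"
      using a(2) by (simp add: sum.remove[of "{..<d}" k0] add_eq_0_iff2)
    then have "const (inverse (a k0)) * (const (a k0) * ?f k0) = const (inverse (a k0)) * - (\<Sum>k\<in>?K. const (a k) * ?f k)" by simp
    then have "?f k0 = - (\<Sum>k\<in>?K. const (inverse (a k0)) * (const (a k) * ?f k))"
      using a(3) by (simp add: mult.assoc[symmetric] mult_single sum_distrib_left)
    also have "\<dots> = (\<Sum>k\<in>?K. ?f k * const (- a k / a k0))"
    proof -
      have "const (inverse (a k0)) * (const (a k) * ?f k) = - (?f k * const (- a k / a k0))" for k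
      proof -
        have "const (inverse (a k0)) * (const (a k) * ?f k) = (const (inverse (a k0)) * const (a k)) * ?f k"
          by (simp only: mult.assoc)
        also have "const (inverse (a k0)) * const (a k) = const (a k / a k0)"
          by (simp add: mult_single divide_inverse mult.commute)
        also have "const (a k / a k0) * ?f k = - (?f k * const (- a k / a k0))"
          by (simp add: single_uminus mult.commute)
        finally show ?thesis .
      qed
      then show ?thesis by (simp add: sum_negf)
    qed
    finally show ?thesis .
  qed
  then have "?f k0 \<in> Idl\<^bsub>?R\<^esub> (?f ` ?K)"
    unfolding genideal_finite_image[OF finite_Diff[OF finite_lessThan] lin]
    by (intro CollectI exI[of _ "\<lambda>k. const (- a k / a k0)"]) auto
  moreover have "?f ` ?K \<subseteq> Idl\<^bsub>?R\<^esub> (?f ` ?K)" by (rule R.genideal_self[OF sub])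
  ultimately have "?f ` {..<d} \<subseteq> Idl\<^bsub>?R\<^esub> (?f ` ?K)" by blast
  then have "Idl\<^bsub>?R\<^esub> (?f ` {..<d}) \<subseteq> Idl\<^bsub>?R\<^esub> (?f ` ?K)"
    by (rule R.genideal_minimal[OF R.genideal_ideal[OF sub]])
  moreover have "Idl\<^bsub>?R\<^esub> (?f ` ?K) \<subseteq> Idl\<^bsub>?R\<^esub> (?f ` {..<d})"
  proof (rule R.genideal_minimal[OF R.genideal_ideal])
    show all: "?f ` {..<d} \<subseteq> carrier ?R" using lin by blast
    show "?f ` ?K \<subseteq> Idl\<^bsub>?R\<^esub> (?f ` {..<d})" using R.genideal_self[OF all] by blast
  qed
  moreover have "?K \<subset> {..<d}" using a(2) by auto
  ultimately show False using assms unfolding minimal_linear_generators_def by blast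
qed

section \<open>Homogeneous components in the Laurent polynomial ring\<close>

lemma lookup_single_mult:
  fixes F :: "'e::ab_group_add \<Rightarrow>\<^sub>0 'a::comm_ring_1"
  shows "lookup (Poly_Mapping.single a x * F) \<delta> = x * lookup F (\<delta> - a)"
proof -
  have "Poly_Mapping.single a x * F = (\<Sum>m\<in>keys F. Poly_Mapping.single (a + m) (x * lookup F m))"
    by (subst sum_singles[of F]) (simp add: sum_distrib_left mult_single)
  then have "lookup (Poly_Mapping.single a x * F) \<delta> = (\<Sum>m\<in>keys F. if m = \<delta> - a then x * lookup F m else 0)"
    by (simp add: lookup_sum lookup_single when_def eq_diff_eq add.commute)
  also have "\<dots> = x * lookup F (\<delta> - a)" by (simp add: in_keys_iff)
  finally show ?thesis .
qed

definition expo :: "('x \<Rightarrow> 'e::comm_monoid_add) \<Rightarrow> ('x \<Rightarrow>\<^sub>0 nat) \<Rightarrow> 'e" where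
  "expo E m = (\<Sum>z\<in>keys m. \<Sum>_<lookup m z. E z)"

lemma lookup_expo_sum:
  fixes E :: "'x \<Rightarrow> ('i \<Rightarrow>\<^sub>0 'c::comm_semiring_1)"
  shows "lookup (expo E m) i = (\<Sum>z\<in>keys m. of_nat (lookup m z) * lookup (E z) i)"
  by (simp only: expo_def lookup_sum sum_constant card_lessThan)

lemma mon_eval_single_family:
  fixes G :: "'a \<Rightarrow> 'c::comm_ring_1" and E :: "'a \<Rightarrow> 'b::comm_monoid_add"
  shows "mon_eval (\<lambda>z. Poly_Mapping.single (E z) (G z)) m = Poly_Mapping.single (expo E m) (mon_eval G m)"
proof -
  have pw: "Poly_Mapping.single e g ^ k = Poly_Mapping.single (\<Sum>_<k. e) (g ^ k)" for e :: "'b" and g :: 'c and k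
    by (induction k) (auto simp: mult_single add.commute lessThan_Suc)
  have pr: "(\<Prod>z\<in>S. Poly_Mapping.single (e z) (g z)) = Poly_Mapping.single (sum e S) (prod g S)"
    for e :: "'a \<Rightarrow> 'b" and g :: "'a \<Rightarrow> 'c" and S
    by (induction S rule: infinite_finite_induct) (auto simp: mult_single)
  show ?thesis unfolding mon_eval_def expo_def pw pr ..
qed

interpretation cc_hom: coeff_hom "\<lambda>c :: 'k::comm_ring_1. const (const c) :: 'e::comm_monoid_add \<Rightarrow>\<^sub>0 ('f::comm_monoid_add \<Rightarrow>\<^sub>0 'k)"
  by unfold_locales (simp_all add: single_add mult_single)

definition lattice_pt :: "nat \<Rightarrow> (nat \<Rightarrow> int) \<Rightarrow> (nat \<Rightarrow>\<^sub>0 int)" where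
  "lattice_pt n \<delta> = (\<Sum>i<n. Poly_Mapping.single i (\<delta> i))"

lemma lookup_lattice_pt: "lookup (lattice_pt n \<delta>) i = (if i < n then \<delta> i else 0)"
  by (simp add: lattice_pt_def lookup_sum lookup_single when_def)

lemma keys_lattice_pt: "keys (lattice_pt n \<delta>) \<subseteq> {..<n}"
  by (auto simp: in_keys_iff lookup_lattice_pt split: if_splits)

definition ypart :: "(var \<Rightarrow>\<^sub>0 nat) \<Rightarrow> (nat \<Rightarrow>\<^sub>0 nat)" where
  "ypart m = Poly_Mapping.map_key Yvar m"

lemma lookup_ypart: "lookup (ypart m) j = lookup m (Yvar j)"
  unfolding ypart_def by (subst map_key.rep_eq) (auto simp: inj_def)

locale rees_data = weighted_forms r u w
  for r :: nat and u :: "nat \<Rightarrow> nat \<Rightarrow> int" and w :: "nat \<Rightarrow> nat \<Rightarrow> int" +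
  fixes n :: nat and b :: "nat \<Rightarrow> ('s::finite, 'k::field) mpoly"
begin

definition xy_expo :: "var \<Rightarrow> (nat \<Rightarrow>\<^sub>0 int)" where
  "xy_expo z = (case z of Xvar i \<Rightarrow> Poly_Mapping.single i (- 1) | Yvar j \<Rightarrow> lattice_pt n (\<lambda>i. u i j))"

definition xy_poly :: "(nat \<Rightarrow> 'a) \<Rightarrow> var \<Rightarrow> 'a::comm_ring_1" where
  "xy_poly g z = (case z of Xvar i \<Rightarrow> 1 | Yvar j \<Rightarrow> g j)"

definition phi :: "(var, 'k) mpoly \<Rightarrow> (nat, ('s, 'k) mpoly) laurent" where
  "phi = poly_subst (\<lambda>c. const (const c)) (\<lambda>z. Poly_Mapping.single (xy_expo z) (xy_poly b z))"

text \<open>The lift of \<open>\<Phi>\<close> along the evaluation \<open>Y\<^sub>j \<mapsto> b\<^sub>j\<close>. It records the homogeneous components of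
  a polynomial in the fine grading, each with the \<open>X\<^sub>i\<close> set to \<open>1\<close>.\<close>

definition psi :: "(var, 'k) mpoly \<Rightarrow> (nat, (nat, 'k) mpoly) laurent" where
  "psi = poly_subst (\<lambda>c. const (const c)) (\<lambda>z. Poly_Mapping.single (xy_expo z) (xy_poly yvar z))"

definition ev :: "(nat, 'k) mpoly \<Rightarrow> ('s, 'k) mpoly" where
  "ev = poly_subst const b"

lemma ev_add: "ev (f + g) = ev f + ev g" and ev_mult: "ev (f * g) = ev f * ev g"
  and ev_diff: "ev (f - g) = ev f - ev g" and ev_sum: "ev (sum h I) = (\<Sum>x\<in>I. ev (h x))"
  and ev_0 [simp]: "ev 0 = 0"
  by (simp_all add: ev_def const_hom.poly_subst_add const_hom.poly_subst_mult const_hom.poly_subst_diff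
      const_hom.poly_subst_sum)

lemma mon_eval_xy_yvar: "mon_eval (xy_poly yvar) m = Poly_Mapping.single (ypart m) (1 :: 'a::comm_ring_1)"
proof -
  have *: "xy_poly yvar = (\<lambda>z. Poly_Mapping.single (case z of Xvar i \<Rightarrow> 0 | Yvar j \<Rightarrow> Poly_Mapping.single j (Suc 0)) (1::'a))"
    by (auto simp: xy_poly_def fun_eq_iff split: var.splits)
  have "expo (\<lambda>z. case z of Xvar i \<Rightarrow> 0 | Yvar j \<Rightarrow> Poly_Mapping.single j (Suc 0)) m = ypart m"
  proof (rule poly_mapping_eqI)
    fix j
    have "lookup (expo (\<lambda>z. case z of Xvar i \<Rightarrow> 0 | Yvar j \<Rightarrow> Poly_Mapping.single j (Suc 0)) m) j
       = (\<Sum>z\<in>keys m. if z = Yvar j then lookup m z else 0)"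
      unfolding lookup_expo_sum by (rule sum.cong) (auto simp: lookup_single when_def split: var.splits)
    also have "\<dots> = lookup (ypart m) j" by (simp add: lookup_ypart in_keys_iff)
    finally show "lookup (expo (\<lambda>z. case z of Xvar i \<Rightarrow> 0 | Yvar j \<Rightarrow> Poly_Mapping.single j (Suc 0)) m) j = lookup (ypart m) j" .
  qed
  then show ?thesis unfolding * mon_eval_single_family by (simp add: mon_eval_def)
qed

lemma psi_single: "psi (Poly_Mapping.single m a) = Poly_Mapping.single (expo xy_expo m) (Poly_Mapping.single (ypart m) a)"
  unfolding psi_def cc_hom.poly_subst_single mon_eval_single_family mon_eval_xy_yvar
  by (simp add: mult_single)

lemma psi_sum: "psi (sum f I) = (\<Sum>x\<in>I. psi (f x))" and psi_mult: "psi (p * q) = psi p * psi q"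
  and psi_diff: "psi (p - q) = psi p - psi q"
  by (simp_all add: psi_def cc_hom.poly_subst_sum cc_hom.poly_subst_mult cc_hom.poly_subst_diff)

lemma phi_sum: "phi (sum f I) = (\<Sum>x\<in>I. phi (f x))" and phi_mult: "phi (p * q) = phi p * phi q"
  by (simp_all add: phi_def cc_hom.poly_subst_sum cc_hom.poly_subst_mult)

lemma lookup_phi: "lookup (phi p) \<delta> = ev (lookup (psi p) \<delta>)"
proof -
  have ev_mon: "ev (mon_eval (xy_poly yvar) m) = mon_eval (xy_poly b) m" for m
  proof -
    have pw: "ev (g ^ k) = ev g ^ k" for g k
      by (induction k) (simp_all add: ev_mult, simp add: ev_def)
    have pr: "ev (prod g S) = (\<Prod>x\<in>S. ev (g x))" for g and S :: "var set"
      by (induction S rule: infinite_finite_induct) (simp_all add: ev_mult, simp_all add: ev_def)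
    have "ev (xy_poly yvar z) = xy_poly b z" for z
      by (cases z) (simp_all add: xy_poly_def ev_def const_hom.poly_subst_single)
    then show ?thesis by (simp add: mon_eval_def pr pw)
  qed
  have single: "lookup (phi (Poly_Mapping.single m a)) \<delta> = ev (lookup (psi (Poly_Mapping.single m a)) \<delta>)" for m a
  proof -
    have "ev (const a * mon_eval (xy_poly yvar) m) = const a * mon_eval (xy_poly b) m"
      unfolding ev_mult ev_mon by (simp add: ev_def const_hom.poly_subst_single)
    then show ?thesis
      unfolding phi_def psi_def cc_hom.poly_subst_single mon_eval_single_family
      by (simp add: mult_single lookup_single when_def)
  qed
  have "lookup (phi p) \<delta> = (\<Sum>m\<in>keys p. lookup (phi (Poly_Mapping.single m (lookup p m))) \<delta>)"
    by (subst sum_singles[of p]) (simp add: phi_sum lookup_sum)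
  also have "\<dots> = ev (lookup (\<Sum>m\<in>keys p. psi (Poly_Mapping.single m (lookup p m))) \<delta>)"
    by (simp only: single lookup_sum ev_sum)
  also have "(\<Sum>m\<in>keys p. psi (Poly_Mapping.single m (lookup p m))) = psi p"
    using psi_sum[of "\<lambda>m. Poly_Mapping.single m (lookup p m)" "keys p"] sum_singles[of p] by simp
  finally show ?thesis .
qed

lemma lookup_expo:
  "lookup (expo xy_expo m) i = - int (lookup m (Xvar i)) + (if i < n then wt (u i) (ypart m) else 0)"
proof -
  have fin: "finite {j. Yvar j \<in> keys m}"
    by (rule finite_subset[OF _ finite_vimageI[of "keys m" Yvar]]) (auto simp: inj_def)
  have keysy: "keys (ypart m) = {j. Yvar j \<in> keys m}" by (auto simp: in_keys_iff lookup_ypart)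
  have "lookup (expo xy_expo m) i = (\<Sum>z\<in>keys m. int (lookup m z) * lookup (xy_expo z) i)"
    by (simp add: lookup_expo_sum)
  also have "\<dots> = (\<Sum>z\<in>keys m. (if z = Xvar i then - int (lookup m z) else 0)
       + (case z of Xvar _ \<Rightarrow> 0 | Yvar j \<Rightarrow> int (lookup m z) * (if i < n then u i j else 0)))"
    by (rule sum.cong) (auto simp: xy_expo_def lookup_single lookup_lattice_pt when_def split: var.splits)
  also have "\<dots> = - int (lookup m (Xvar i)) + (\<Sum>z\<in>keys m. (case z of Xvar _ \<Rightarrow> 0 | Yvar j \<Rightarrow> int (lookup m z) * (if i < n then u i j else 0)))"
    by (simp add: sum.distrib in_keys_iff)
  also have "(\<Sum>z\<in>keys m. (case z of Xvar _ \<Rightarrow> 0 | Yvar j \<Rightarrow> int (lookup m z) * (if i < n then u i j else 0)))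
     = (\<Sum>z\<in>Yvar ` {j. Yvar j \<in> keys m}. (case z of Xvar _ \<Rightarrow> 0 | Yvar j \<Rightarrow> int (lookup m z) * (if i < n then u i j else 0)))"
    by (rule sum.mono_neutral_right) (auto split: var.splits)
  also have "\<dots> = (\<Sum>j\<in>{j. Yvar j \<in> keys m}. int (lookup m (Yvar j)) * (if i < n then u i j else 0))"
    by (subst sum.reindex) (auto simp: inj_on_def)
  also have "\<dots> = (if i < n then wt (u i) (ypart m) else 0)"
    by (simp add: wt_def keysy lookup_ypart mult.commute)
  finally show ?thesis .
qed

text \<open>The \<open>Y\<close>-part of a monomial contributes a known amount to its degree; the rest of the degree
  consists of the exponents of the \<open>X\<^sub>i\<close>.\<close>

lemma expo_ypart_inj: "expo xy_expo m = expo xy_expo m' \<Longrightarrow> ypart m = ypart m' \<Longrightarrow> m = m'"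
proof (rule poly_mapping_eqI)
  fix z assume e: "expo xy_expo m = expo xy_expo m'" and y: "ypart m = ypart m'"
  show "lookup m z = lookup m' z"
  proof (cases z)
    case (Xvar i)
    have "- int (lookup m (Xvar i)) = - int (lookup m' (Xvar i))"
      using arg_cong[OF e, of "\<lambda>q. lookup q i"] unfolding lookup_expo y by simp
    then show ?thesis by (simp add: Xvar)
  next
    case (Yvar j)
    then show ?thesis using arg_cong[OF y, of "\<lambda>y. lookup y j"] by (simp add: lookup_ypart)
  qed
qed

lemma psi_expand: "psi p = (\<Sum>m\<in>keys p. Poly_Mapping.single (expo xy_expo m) (Poly_Mapping.single (ypart m) (lookup p m)))"
  using psi_sum[of "\<lambda>m. Poly_Mapping.single m (lookup p m)" "keys p"] sum_singles[of p] by (simp add: psi_single)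

lemma psi_inj: assumes "psi p = psi q" shows "p = q"
proof -
  have "p - q = 0"
  proof (rule poly_mapping_eqI)
    fix m
    have "lookup (lookup (psi (p - q)) (expo xy_expo m)) (ypart m)
       = (\<Sum>m'\<in>keys (p - q). if m' = m then lookup (p - q) m' else 0)"
      unfolding psi_expand lookup_sum
      by (rule sum.cong) (auto simp: lookup_single when_def dest: expo_ypart_inj)
    also have "\<dots> = lookup (p - q) m" by (simp add: in_keys_iff)
    finally show "lookup (p - q) m = lookup 0 m" using assms by (simp add: psi_diff)
  qed
  then show ?thesis by simp
qed

abbreviation xy_carrier :: "(var, 'k) mpoly set" where
  "xy_carrier \<equiv> carrier (XY_ring n r)"

lemma xy_carrier: "p \<in> xy_carrier \<longleftrightarrow> (\<forall>m\<in>keys p. keys m \<subseteq> Xvar ` {..<n} \<union> Yvar ` {..<r})"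
  by (simp add: XY_ring_def)

lemma psi_filt:
  assumes p: "p \<in> xy_carrier"
  shows "lookup (psi p) \<delta> \<in> filt {..<n} (lookup \<delta>)" "\<delta> \<in> keys (psi p) \<Longrightarrow> keys \<delta> \<subseteq> {..<n}"
proof -
  have ex: "\<exists>m\<in>keys p. expo xy_expo m = \<delta> \<and> (y \<in> keys (lookup (psi p) \<delta>) \<longrightarrow> ypart m = y)"
    if y: "y \<in> keys (lookup (psi p) \<delta>)" for y
  proof -
    have "lookup (lookup (psi p) \<delta>) y \<noteq> 0" using y by (simp add: in_keys_iff)
    then have "(\<Sum>m\<in>keys p. lookup (lookup (Poly_Mapping.single (expo xy_expo m) (Poly_Mapping.single (ypart m) (lookup p m))) \<delta>) y) \<noteq> 0"
      unfolding psi_expand by (simp add: lookup_sum)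
    then obtain m where "m \<in> keys p" "lookup (lookup (Poly_Mapping.single (expo xy_expo m) (Poly_Mapping.single (ypart m) (lookup p m))) \<delta>) y \<noteq> 0"
      by (rule sum.not_neutral_contains_not_neutral)
    then show ?thesis by (intro bexI[of _ m]) (auto simp: lookup_single when_def split: if_splits)
  qed
  show "lookup (psi p) \<delta> \<in> filt {..<n} (lookup \<delta>)"
  proof (rule filtI)
    fix y assume "y \<in> keys (lookup (psi p) \<delta>)"
    from ex[OF this] obtain m where m: "m \<in> keys p" "ypart m = y" using \<open>y \<in> _\<close> by blast
    show "keys y \<subseteq> {..<r}"
    proof
      fix j assume "j \<in> keys y"
      then have "Yvar j \<in> keys m" using m(2) by (auto simp: in_keys_iff lookup_ypart)
      then show "j \<in> {..<r}" using p m(1) unfolding xy_carrier by blast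
    qed
  next
    fix y i assume "y \<in> keys (lookup (psi p) \<delta>)" "i \<in> {..<n}"
    from ex[OF this(1)] obtain m where m: "m \<in> keys p" "expo xy_expo m = \<delta>" "ypart m = y" using \<open>y \<in> _\<close> by blast
    then show "lookup \<delta> i \<le> wt (u i) y" using lookup_expo[of m i] \<open>i \<in> {..<n}\<close> by simp
  qed
  show "keys \<delta> \<subseteq> {..<n}" if "\<delta> \<in> keys (psi p)"
  proof
    fix i assume i: "i \<in> keys \<delta>"
    have "lookup (psi p) \<delta> \<noteq> 0" using \<open>\<delta> \<in> keys (psi p)\<close> by (simp add: in_keys_iff)
    then obtain y where y: "y \<in> keys (lookup (psi p) \<delta>)" using keys_eq_empty by blast
    from ex[OF this] obtain m where m: "m \<in> keys p" "expo xy_expo m = \<delta>" by blast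
    show "i \<in> {..<n}"
    proof (rule ccontr)
      assume "i \<notin> {..<n}"
      then have "Xvar i \<notin> keys m" using p m(1) unfolding xy_carrier by blast
      then show False using lookup_expo[of m i] m(2) i \<open>i \<notin> {..<n}\<close> by (simp add: in_keys_iff)
    qed
  qed
qed

lemma psi_surj:
  assumes g: "g \<in> filt {..<n} (lookup \<delta>)" and \<delta>: "keys \<delta> \<subseteq> {..<n}"
  obtains q where "q \<in> xy_carrier" "psi q = Poly_Mapping.single \<delta> g"
proof -
  \<comment> \<open>The exponents of the \<open>X\<^sub>i\<close> make up for the excess of the weight over the degree.\<close>
  define xy where "xy = (\<lambda>y. (\<Sum>i<n. Poly_Mapping.single (Xvar i) (nat (wt (u i) y - lookup \<delta> i)))
      + (\<Sum>j\<in>keys y. Poly_Mapping.single (Yvar j) (lookup y j)))"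
  have lx: "lookup (xy y) (Xvar i) = (if i < n then nat (wt (u i) y - lookup \<delta> i) else 0)" for y i
    by (simp add: xy_def lookup_add lookup_sum lookup_single when_def)
  have ly: "lookup (xy y) (Yvar j) = lookup y j" for y j
    by (simp add: xy_def lookup_add lookup_sum lookup_single when_def in_keys_iff)
  have yp: "ypart (xy y) = y" for y by (rule poly_mapping_eqI) (simp add: lookup_ypart ly)
  have ex: "expo xy_expo (xy y) = \<delta>" if y: "y \<in> keys g" for y
  proof (rule poly_mapping_eqI)
    fix i
    show "lookup (expo xy_expo (xy y)) i = lookup \<delta> i"
    proof (cases "i < n")
      case True
      then show ?thesis using filtD(2)[OF g y, of i] by (simp add: lookup_expo lx yp)
    next
      case False
      then have "lookup \<delta> i = 0" using \<delta> by (auto simp: in_keys_iff)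
      then show ?thesis using False by (simp add: lookup_expo lx)
    qed
  qed
  define q where "q = (\<Sum>y\<in>keys g. Poly_Mapping.single (xy y) (lookup g y))"
  have "psi q = (\<Sum>y\<in>keys g. Poly_Mapping.single \<delta> (Poly_Mapping.single y (lookup g y)))"
    unfolding q_def psi_sum psi_single by (rule sum.cong) (auto simp: ex yp)
  then have "psi q = Poly_Mapping.single \<delta> g"
    using single_sum[of \<delta> "\<lambda>y. Poly_Mapping.single y (lookup g y)" "keys g"] sum_singles[of g] by simp
  moreover have "q \<in> xy_carrier"
    unfolding q_def XY_ring_def
  proof (rule poly_in_sum)
    fix y assume y: "y \<in> keys g"
    have "keys (xy y) \<subseteq> Xvar ` {..<n} \<union> Yvar ` {..<r}"
    proof
      fix z assume z: "z \<in> keys (xy y)"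
      show "z \<in> Xvar ` {..<n} \<union> Yvar ` {..<r}"
      proof (cases z)
        case (Xvar i) then show ?thesis using z lx[of y i] by (auto simp: in_keys_iff split: if_splits)
      next
        case (Yvar j)
        then have "j \<in> keys y" using z by (simp add: in_keys_iff ly)
        then show ?thesis using filtD(1)[OF g y] Yvar by auto
      qed
    qed
    then show "Poly_Mapping.single (xy y) (lookup g y) \<in> carrier (poly_ring_in (Xvar ` {..<n} \<union> Yvar ` {..<r}))"
      by simp
  qed
  ultimately show thesis using that by blast
qed

definition xy_form :: "(nat \<Rightarrow> nat \<Rightarrow> 'k) \<Rightarrow> nat \<Rightarrow> (var, 'k) mpoly" where
  "xy_form c k = (\<Sum>j<r. Poly_Mapping.single
      ((\<Sum>i<n. Poly_Mapping.single (Xvar i) (nat (u i j - w k i))) + Poly_Mapping.single (Yvar j) 1) (c k j))"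

lemma xy_form_carrier: "xy_form c k \<in> xy_carrier"
  unfolding xy_form_def XY_ring_def
proof (rule poly_in_sum)
  fix j assume j: "j \<in> {..<r}"
  let ?m = "(\<Sum>i<n. Poly_Mapping.single (Xvar i) (nat (u i j - w k i))) + Poly_Mapping.single (Yvar j) 1"
  have "keys ?m \<subseteq> Xvar ` {..<n} \<union> Yvar ` {..<r}"
  proof
    fix z assume "z \<in> keys ?m"
    then have z: "lookup ?m z \<noteq> 0" by (simp add: in_keys_iff)
    show "z \<in> Xvar ` {..<n} \<union> Yvar ` {..<r}"
      using z j by (cases z) (auto simp: lookup_add lookup_sum lookup_single when_def split: if_splits)
  qed
  then show "Poly_Mapping.single ?m (c k j) \<in> carrier (poly_ring_in (Xvar ` {..<n} \<union> Yvar ` {..<r}))"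
    by simp
qed

lemma psi_xy_form:
  assumes adm: "admissible c K {..<n}" "k \<in> K"
  shows "psi (xy_form c k) = Poly_Mapping.single (lattice_pt n (w k)) (linear_form r (c k))"
proof -
  have t: "psi (Poly_Mapping.single ((\<Sum>i<n. Poly_Mapping.single (Xvar i) (nat (u i j - w k i))) + Poly_Mapping.single (Yvar j) 1) (c k j))
     = Poly_Mapping.single (lattice_pt n (w k)) (Poly_Mapping.single (Poly_Mapping.single j 1) (c k j))" if j: "j < r" for j
  proof (cases "c k j = 0")
    case True then show ?thesis by (simp add: psi_def)
  next
    case False
    let ?m = "(\<Sum>i<n. Poly_Mapping.single (Xvar i) (nat (u i j - w k i))) + Poly_Mapping.single (Yvar j) 1"
    have yp: "ypart ?m = Poly_Mapping.single j 1"
      by (rule poly_mapping_eqI) (simp add: lookup_ypart lookup_add lookup_sum lookup_single when_def)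
    have "expo xy_expo ?m = lattice_pt n (w k)"
    proof (rule poly_mapping_eqI)
      fix i
      have lm: "lookup ?m (Xvar i) = (if i < n then nat (u i j - w k i) else 0)"
        by (simp add: lookup_add lookup_sum lookup_single when_def)
      have "i < n \<Longrightarrow> w k i \<le> u i j" using adm j False unfolding admissible_def by blast
      then show "lookup (expo xy_expo ?m) i = lookup (lattice_pt n (w k)) i"
        unfolding lookup_expo lm yp lookup_lattice_pt by simp
    qed
    then show ?thesis by (simp only: psi_single yp)
  qed
  have "psi (xy_form c k) = (\<Sum>j<r. Poly_Mapping.single (lattice_pt n (w k)) (Poly_Mapping.single (Poly_Mapping.single j 1) (c k j)))"
    unfolding xy_form_def psi_sum by (rule sum.cong) (simp_all only: t lessThan_iff)
  then show ?thesis by (simp only: linear_form_def single_sum)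
qed

text \<open>Compare components under \<open>psi\<close>: those of the kernel are the filtered polynomials in the
  ideal of the linear forms, those of the ideal of the \<open>p\<^sub>k\<close> are the filtered combinations.\<close>

lemma kernel_iff_saturated:
  assumes adm: "admissible c {..<d} {..<n}"
    and L: "\<And>f \<delta>. f \<in> filt {} \<delta> \<Longrightarrow> ev f = 0 \<longleftrightarrow> f \<in> rel c {..<d} {} \<delta>"
  shows "{p \<in> xy_carrier. phi p = 0} = {(\<Sum>k<d. xy_form c k * q k) | q. \<forall>k\<in>{..<d}. q k \<in> xy_carrier}
     \<longleftrightarrow> saturated c {..<d} {..<n}" (is "?Ker = ?Idl \<longleftrightarrow> _")
proof
  assume eq: "?Ker = ?Idl"
  show "saturated c {..<d} {..<n}"
    unfolding saturated_def
  proof (intro allI impI)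
    fix \<delta> and f :: "(nat, 'k) mpoly" assume f: "f \<in> rel c {..<d} {} \<delta>" "f \<in> filt {..<n} \<delta>"
    let ?d = "lattice_pt n \<delta>"
    have "f \<in> filt {..<n} (lookup ?d)" by (rule filt_mono[OF f(2)]) (auto simp: lookup_lattice_pt)
    then obtain p where p: "p \<in> xy_carrier" "psi p = Poly_Mapping.single ?d f"
      by (rule psi_surj[OF _ keys_lattice_pt])
    have "ev f = 0" using L[OF filt_mono[OF f(2), of "{}" \<delta>]] f(1) by auto
    then have "phi p = 0"
      by (intro poly_mapping_eqI) (simp add: lookup_phi p(2) lookup_single when_def)
    then have "p \<in> ?Idl" using p(1) eq by blast
    then obtain q where q: "p = (\<Sum>k<d. xy_form c k * q k)" "\<forall>k\<in>{..<d}. q k \<in> xy_carrier" by blast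
    have "f = lookup (psi p) ?d" by (simp add: p(2))
    also have "\<dots> = (\<Sum>k<d. lookup (psi (xy_form c k) * psi (q k)) ?d)"
      by (simp only: q(1) psi_sum psi_mult lookup_sum)
    also have "\<dots> = (\<Sum>k<d. linear_form r (c k) * lookup (psi (q k)) (?d - lattice_pt n (w k)))"
      by (rule sum.cong) (simp_all only: psi_xy_form[OF adm] lookup_single_mult)
    finally show "f \<in> rel c {..<d} {..<n} \<delta>"
    proof (rule relI)
      fix k assume "k \<in> {..<d}"
      then have "lookup (psi (q k)) (?d - lattice_pt n (w k)) \<in> filt {..<n} (lookup (?d - lattice_pt n (w k)))"
        using q(2) psi_filt(1) by blast
      then show "lookup (psi (q k)) (?d - lattice_pt n (w k)) \<in> filt {..<n} (\<lambda>i. \<delta> i - w k i)"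
        by (rule filt_mono) (auto simp: lookup_lattice_pt lookup_minus)
    qed
  qed
next
  assume sat: "saturated c {..<d} {..<n}"
  show "?Ker = ?Idl"
  proof (rule subset_antisym; rule subsetI)
    fix p assume "p \<in> ?Idl"
    then obtain q where q: "p = (\<Sum>k<d. xy_form c k * q k)" "\<forall>k\<in>{..<d}. q k \<in> xy_carrier" by blast
    have "phi (xy_form c k) = 0" if k: "k < d" for k
    proof -
      have "linear_form r (c k) \<in> filt {} (\<lambda>_. 0)" by (rule linear_form_filt) auto
      moreover from this have "linear_form r (c k) \<in> rel c {..<d} {} (\<lambda>_. 0)"
        using rel_combos combos_form[of "{..<d}" k r c] k by blast
      ultimately have "ev (linear_form r (c k)) = 0" using L by blast
      then show ?thesis using k
        by (intro poly_mapping_eqI) (simp add: lookup_phi psi_xy_form[OF adm] lookup_single when_def)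
    qed
    then have "phi p = 0" unfolding q(1) phi_sum phi_mult by (intro sum.neutral) auto
    moreover have "p \<in> xy_carrier"
      unfolding q(1) XY_ring_def
      by (intro poly_in_sum poly_in_mult xy_form_carrier[unfolded XY_ring_def] bspec[OF q(2), unfolded XY_ring_def])
    ultimately show "p \<in> ?Ker" by blast
  next
    fix p assume p: "p \<in> ?Ker"
    then have pc: "p \<in> xy_carrier" and p0: "phi p = 0" by auto
    have "\<exists>g. lookup (psi p) \<delta> = (\<Sum>k<d. linear_form r (c k) * g k) \<and>
        (\<forall>k\<in>{..<d}. g k \<in> filt {..<n} (\<lambda>i. lookup \<delta> i - w k i))" for \<delta>
    proof -
      have f: "lookup (psi p) \<delta> \<in> filt {..<n} (lookup \<delta>)" by (rule psi_filt(1)[OF pc])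
      have "ev (lookup (psi p) \<delta>) = 0" using p0 by (simp add: lookup_phi[symmetric])
      then have "lookup (psi p) \<delta> \<in> rel c {..<d} {} (lookup \<delta>)"
        using L[OF filt_mono[OF f, of "{}" "lookup \<delta>"]] by auto
      then have "lookup (psi p) \<delta> \<in> rel c {..<d} {..<n} (lookup \<delta>)" using sat f unfolding saturated_def by blast
      then show ?thesis by (rule relE) blast
    qed
    then have "\<exists>g. \<forall>\<delta>. lookup (psi p) \<delta> = (\<Sum>k<d. linear_form r (c k) * g \<delta> k) \<and>
        (\<forall>k\<in>{..<d}. g \<delta> k \<in> filt {..<n} (\<lambda>i. lookup \<delta> i - w k i))"
      by (intro choice allI)
    then obtain g where g0: "\<forall>\<delta>. lookup (psi p) \<delta> = (\<Sum>k<d. linear_form r (c k) * g \<delta> k) \<and>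
        (\<forall>k\<in>{..<d}. g \<delta> k \<in> filt {..<n} (\<lambda>i. lookup \<delta> i - w k i))" ..
    then have g: "lookup (psi p) \<delta> = (\<Sum>k<d. linear_form r (c k) * g \<delta> k)"
        "k < d \<Longrightarrow> g \<delta> k \<in> filt {..<n} (\<lambda>i. lookup \<delta> i - w k i)" for \<delta> k
      by simp_all
    have q_ex: "\<exists>q. q \<in> xy_carrier \<and> psi q = Poly_Mapping.single (\<delta> - lattice_pt n (w k)) (g \<delta> k)"
      if \<delta>: "\<delta> \<in> keys (psi p)" and k: "k < d" for \<delta> k
    proof -
      have "g \<delta> k \<in> filt {..<n} (lookup (\<delta> - lattice_pt n (w k)))"
        by (rule filt_mono[OF g(2)[OF k]]) (auto simp: lookup_minus lookup_lattice_pt)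
      moreover have "keys (\<delta> - lattice_pt n (w k)) \<subseteq> {..<n}"
        using psi_filt(2)[OF pc \<delta>] by (auto simp: in_keys_iff lookup_minus lookup_lattice_pt split: if_splits)
      ultimately obtain q where "q \<in> xy_carrier" "psi q = Poly_Mapping.single (\<delta> - lattice_pt n (w k)) (g \<delta> k)"
        by (rule psi_surj)
      then show ?thesis by blast
    qed
    define q where "q = (\<lambda>\<delta> k. SOME q. q \<in> xy_carrier \<and> psi q = Poly_Mapping.single (\<delta> - lattice_pt n (w k)) (g \<delta> k))"
    have q: "q \<delta> k \<in> xy_carrier" "psi (q \<delta> k) = Poly_Mapping.single (\<delta> - lattice_pt n (w k)) (g \<delta> k)"
      if "\<delta> \<in> keys (psi p)" "k < d" for \<delta> k
      using someI_ex[OF q_ex[OF that]] by (simp_all only: q_def)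
    define Q where "Q = (\<lambda>k. \<Sum>\<delta>\<in>keys (psi p). q \<delta> k)"
    have "psi (\<Sum>k<d. xy_form c k * Q k) = (\<Sum>k<d. \<Sum>\<delta>\<in>keys (psi p). Poly_Mapping.single \<delta> (linear_form r (c k) * g \<delta> k))"
      unfolding psi_sum psi_mult Q_def
      by (rule sum.cong) (simp_all add: psi_xy_form[OF adm] q(2) sum_distrib_left mult_single)
    also have "\<dots> = (\<Sum>\<delta>\<in>keys (psi p). \<Sum>k<d. Poly_Mapping.single \<delta> (linear_form r (c k) * g \<delta> k))"
      by (rule sum.swap)
    also have "\<dots> = (\<Sum>\<delta>\<in>keys (psi p). Poly_Mapping.single \<delta> (lookup (psi p) \<delta>))"
      by (simp only: g(1) single_sum)
    also have "\<dots> = psi p" by (rule sum_singles[symmetric])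
    finally have "p = (\<Sum>k<d. xy_form c k * Q k)" by (rule psi_inj[symmetric])
    moreover have "\<forall>k\<in>{..<d}. Q k \<in> xy_carrier"
      unfolding Q_def XY_ring_def by (auto simp del: carrier_poly_ring_in intro!: poly_in_sum q(1)[unfolded XY_ring_def])
    ultimately show "p \<in> ?Idl" by blast
  qed
qed

end

section \<open>Valuations and generation of the associated graded algebra\<close>

locale real_valuation =
  fixes val :: "('s::finite, 'k::field) mpoly \<Rightarrow> real"
  assumes val_const: "c \<noteq> 0 \<Longrightarrow> val (const c) = 0"
    and val_mult: "f \<noteq> 0 \<Longrightarrow> g \<noteq> 0 \<Longrightarrow> val (f * g) = val f + val g"
    and val_add: "f \<noteq> 0 \<Longrightarrow> g \<noteq> 0 \<Longrightarrow> f + g \<noteq> 0 \<Longrightarrow> min (val f) (val g) \<le> val (f + g)"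
begin

text \<open>The value of \<open>0\<close> stands for \<open>\<infinity>\<close>.\<close>

definition val_ge :: "real \<Rightarrow> ('s, 'k) mpoly \<Rightarrow> bool" where
  "val_ge a f \<longleftrightarrow> f = 0 \<or> a \<le> val f"

definition val_gt :: "real \<Rightarrow> ('s, 'k) mpoly \<Rightarrow> bool" where
  "val_gt a f \<longleftrightarrow> f = 0 \<or> a < val f"

lemma val_ge_0 [simp]: "val_ge a 0" and val_gt_0 [simp]: "val_gt a 0"
  by (simp_all add: val_ge_def val_gt_def)

lemma val_gt_imp_ge: "val_gt a f \<Longrightarrow> val_ge a f"
  by (auto simp: val_ge_def val_gt_def)

lemma val_ge_add: "val_ge a f \<Longrightarrow> val_ge a g \<Longrightarrow> val_ge a (f + g)"
  using val_add[of f g] unfolding val_ge_def by (cases "f = 0"; cases "g = 0"; cases "f + g = 0") auto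

lemma val_gt_add: "val_gt a f \<Longrightarrow> val_gt a g \<Longrightarrow> val_gt a (f + g)"
  using val_add[of f g] unfolding val_gt_def by (cases "f = 0"; cases "g = 0"; cases "f + g = 0") auto

lemma val_ge_mult: "val_ge a f \<Longrightarrow> val_ge b g \<Longrightarrow> val_ge (a + b) (f * g)"
  using val_mult[of f g] unfolding val_ge_def by (cases "f = 0"; cases "g = 0") auto

lemma val_gt_mult: "val_ge a f \<Longrightarrow> val_gt b g \<Longrightarrow> val_gt (a + b) (f * g)"
  using val_mult[of f g] unfolding val_ge_def val_gt_def by (cases "f = 0"; cases "g = 0") auto

lemma val_ge_const: "val_ge 0 (const c)"
  using val_const[of c] by (cases "c = 0") (auto simp: val_ge_def)

lemma val_ge_1: "val_ge 0 1"
  using val_ge_const[of 1] by simp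

lemma val_ge_uminus: "val_ge a f \<Longrightarrow> val_ge a (- f)"
  using val_ge_mult[OF val_ge_const[of "- 1"], of a f] by (simp add: single_uminus)

lemma val_gt_uminus: "val_gt a f \<Longrightarrow> val_gt a (- f)"
  using val_gt_mult[OF val_ge_const[of "- 1"], of a f] by (simp add: single_uminus)

lemma val_ge_sum: "(\<And>x. x \<in> T \<Longrightarrow> val_ge a (f x)) \<Longrightarrow> val_ge a (sum f T)"
  by (induction T rule: infinite_finite_induct) (auto intro: val_ge_add)

lemma val_gt_sum: "(\<And>x. x \<in> T \<Longrightarrow> val_gt a (f x)) \<Longrightarrow> val_gt a (sum f T)"
  by (induction T rule: infinite_finite_induct) (auto intro: val_gt_add)

lemma carrier_filt_ring: "carrier (filt_ring val) = {F. \<forall>a. val_ge a (lookup F a)}"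
  by (auto simp: filt_ring_def val_ge_def in_keys_iff)

lemma filt_ideal_alt: "filt_ideal val = {F. \<forall>a. val_gt a (lookup F a)}"
  by (auto simp: filt_ideal_def val_gt_def in_keys_iff)

lemma filt_ring_simps:
  "x \<otimes>\<^bsub>filt_ring val\<^esub> y = x * y" "x \<oplus>\<^bsub>filt_ring val\<^esub> y = x + y"
  "\<one>\<^bsub>filt_ring val\<^esub> = 1" "\<zero>\<^bsub>filt_ring val\<^esub> = 0"
  by (simp_all add: filt_ring_def)

lemma lookup_mult_sum:
  fixes F G :: "real \<Rightarrow>\<^sub>0 ('s, 'k) mpoly"
  shows "lookup (F * G) a = (\<Sum>a1\<in>keys F. \<Sum>a2\<in>keys G. if a1 + a2 = a then lookup F a1 * lookup G a2 else 0)"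
proof -
  have "F * G = (\<Sum>a1\<in>keys F. \<Sum>a2\<in>keys G. Poly_Mapping.single a1 (lookup F a1) * Poly_Mapping.single a2 (lookup G a2))"
    by (subst sum_singles[of F], subst sum_singles[of G]) (rule sum_product)
  then show ?thesis by (simp add: lookup_sum mult_single lookup_single when_def)
qed

lemma ring_filt_ring: "ring (filt_ring val)"
proof -
  have "ring (subring_on (carrier (filt_ring val)))"
  proof (rule ring_subring_on)
    show "1 \<in> carrier (filt_ring val)" by (simp add: carrier_filt_ring lookup_one when_def val_ge_1)
    fix F G assume FG: "F \<in> carrier (filt_ring val)" "G \<in> carrier (filt_ring val)"
    show "F + G \<in> carrier (filt_ring val)" using FG by (simp add: carrier_filt_ring lookup_add val_ge_add)
    show "F * G \<in> carrier (filt_ring val)"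
      unfolding carrier_filt_ring mem_Collect_eq lookup_mult_sum
    proof (intro allI val_ge_sum)
      fix a a1 a2
      show "val_ge a (if a1 + a2 = a then lookup F a1 * lookup G a2 else 0)"
        using FG val_ge_mult[of a1 "lookup F a1" a2 "lookup G a2"] by (auto simp: carrier_filt_ring)
    qed
  qed (simp add: carrier_filt_ring val_ge_uminus)
  then show ?thesis by (simp add: filt_ring_def)
qed

lemma filt_ring_minus: "F \<in> carrier (filt_ring val) \<Longrightarrow> \<ominus>\<^bsub>filt_ring val\<^esub> F = - F"
proof -
  interpret ring "filt_ring val" by (rule ring_filt_ring)
  assume "F \<in> carrier (filt_ring val)"
  then show ?thesis by (intro minus_equality) (auto simp: filt_ring_simps carrier_filt_ring val_ge_uminus)
qed

lemma ideal_filt_ideal: "ideal (filt_ideal val) (filt_ring val)"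
proof -
  interpret R: ring "filt_ring val" by (rule ring_filt_ring)
  have sub: "filt_ideal val \<subseteq> carrier (filt_ring val)"
    unfolding filt_ideal_alt carrier_filt_ring using val_gt_imp_ge by blast
  have mult: "F * G \<in> filt_ideal val" if FG: "F \<in> carrier (filt_ring val)" "G \<in> filt_ideal val" for F G
    unfolding filt_ideal_alt mem_Collect_eq lookup_mult_sum
  proof (intro allI val_gt_sum)
    fix a a1 a2
    show "val_gt a (if a1 + a2 = a then lookup F a1 * lookup G a2 else 0)"
      using FG val_gt_mult[of a1 "lookup F a1" a2 "lookup G a2"] by (auto simp: carrier_filt_ring filt_ideal_alt)
  qed
  show ?thesis
  proof (rule idealI[OF ring_filt_ring])
    show "subgroup (filt_ideal val) (add_monoid (filt_ring val))"
    proof (rule R.add.subgroupI[OF sub])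
      show "filt_ideal val \<noteq> {}" by (auto simp: filt_ideal_alt intro!: exI[of _ 0])
      fix F G assume FG: "F \<in> filt_ideal val" "G \<in> filt_ideal val"
      have "\<ominus>\<^bsub>filt_ring val\<^esub> F = - F" using FG(1) sub filt_ring_minus by blast
      then show "\<ominus>\<^bsub>filt_ring val\<^esub> F \<in> filt_ideal val" using FG(1) by (simp add: filt_ideal_alt val_gt_uminus)
      show "F \<oplus>\<^bsub>filt_ring val\<^esub> G \<in> filt_ideal val"
        using FG by (simp add: filt_ring_simps filt_ideal_alt lookup_add val_gt_add)
    qed
    fix F G assume "F \<in> filt_ideal val" "G \<in> carrier (filt_ring val)"
    then show "G \<otimes>\<^bsub>filt_ring val\<^esub> F \<in> filt_ideal val" "F \<otimes>\<^bsub>filt_ring val\<^esub> G \<in> filt_ideal val"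
      using mult[of G F] by (simp_all add: filt_ring_simps mult.commute)
  qed
qed

text \<open>The part of degree \<open>val f\<close> of the graded algebra is spanned by the monomials in the classes of the
  \<open>b\<^sub>j\<close> whose values add up to \<open>val f\<close>.\<close>

lemma approximation:
  fixes b :: "nat \<Rightarrow> ('s, 'k) mpoly"
  assumes b0: "0 \<notin> b ` {..<r}"
    and gen: "generate_ring (gr_ring val) (Set.range (\<lambda>c. gr_class val 0 (const c)) \<union> (\<lambda>b. gr_class val (val b) b) ` b ` {..<r})
          = carrier (gr_ring val)"
    and f: "f \<noteq> 0"
  obtains g where "g \<in> carrier (poly_ring_in {..<r})"
    "\<And>m. m \<in> keys g \<Longrightarrow> expo (\<lambda>j. val (b j)) m = val f" "val_gt (val f) (f - poly_subst const b g)"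
proof -
  let ?R = "filt_ring val" and ?I = "filt_ideal val"
  interpret I: ideal ?I ?R by (rule ideal_filt_ideal)
  interpret h: ring_hom_ring ?R "?R Quot ?I" "(+>\<^bsub>?R\<^esub>) ?I" by (rule I.rcos_ring_hom_ring)
  define H :: "(nat, 'k) mpoly \<Rightarrow> (real \<Rightarrow>\<^sub>0 ('s, 'k) mpoly)" where
    "H = poly_subst (\<lambda>c. const (const c)) (\<lambda>j. Poly_Mapping.single (val (b j)) (b j))"
  let ?P = "carrier (poly_ring_in {..<r}) :: (nat, 'k) mpoly set"
  have H_single: "H (Poly_Mapping.single m a) = Poly_Mapping.single (expo (\<lambda>j. val (b j)) m) (const a * mon_eval b m)" for m a
    unfolding H_def cc_hom.poly_subst_single mon_eval_single_family by (simp add: mult_single)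
  have H_expand: "H g = (\<Sum>m\<in>keys g. Poly_Mapping.single (expo (\<lambda>j. val (b j)) m) (const (lookup g m) * mon_eval b m))" for g
    by (subst sum_singles[of g]) (simp only: H_def cc_hom.poly_subst_sum, simp only: H_def[symmetric] H_single)
  have mon: "val_ge (expo (\<lambda>j. val (b j)) m) (mon_eval b m)" for m
  proof -
    have pw: "val_ge (\<Sum>_<k. val (b j)) (b j ^ k)" for j k
      by (induction k) (auto simp: val_ge_1 lessThan_Suc simp del: sum_constant intro!: val_ge_mult, simp add: val_ge_def)
    have "val_ge (\<Sum>j\<in>T. \<Sum>_<lookup m j. val (b j)) (\<Prod>j\<in>T. b j ^ lookup m j)" for T
      by (induction T rule: infinite_finite_induct) (auto simp: val_ge_1 simp del: sum_constant intro!: val_ge_mult pw)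
    then show ?thesis unfolding expo_def mon_eval_def .
  qed
  have H_car: "H g \<in> carrier ?R" for g
    unfolding carrier_filt_ring mem_Collect_eq H_expand lookup_sum
  proof (intro allI val_ge_sum)
    fix a m
    show "val_ge a (lookup (Poly_Mapping.single (expo (\<lambda>j. val (b j)) m) (const (lookup g m) * mon_eval b m)) a)"
      using val_ge_mult[OF val_ge_const mon[of m], of "lookup g m"] by (auto simp: lookup_single when_def)
  qed
  have cls: "gr_class val a x = ?I +>\<^bsub>?R\<^esub> Poly_Mapping.single a x" for a x by (simp add: gr_class_def)
  have "\<exists>g\<in>?P. z = ?I +>\<^bsub>?R\<^esub> H g"
    if "z \<in> generate_ring (?R Quot ?I) (Set.range (\<lambda>c. gr_class val 0 (const c)) \<union> (\<lambda>b. gr_class val (val b) b) ` b ` {..<r})" for z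
    using that
  proof (induction z rule: generate_ring.induct)
    case one
    have "H 1 = 1" by (simp add: H_def)
    then show ?case using h.hom_one by (intro bexI[of _ 1]) (simp_all add: filt_ring_simps)
  next
    case (incl z)
    then show ?case
    proof (elim UnE rangeE imageE)
      fix c assume "z = gr_class val 0 (const c)"
      then show ?thesis using H_single[of 0 c] by (intro bexI[of _ "const c"]) (auto simp: cls expo_def split: if_splits)
    next
      fix x j assume "z = gr_class val (val x) x" "x = b j" "j \<in> {..<r}"
      then show ?thesis using H_single[of "Poly_Mapping.single j (Suc 0)" 1]
        by (intro bexI[of _ "yvar j"]) (auto simp: cls expo_def)
    qed
  next
    case (a_inv z)
    then obtain g where g: "g \<in> ?P" "z = ?I +>\<^bsub>?R\<^esub> H g" by blast
    have "\<ominus>\<^bsub>?R Quot ?I\<^esub> z = ?I +>\<^bsub>?R\<^esub> H (- g)"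
      using h.hom_a_inv[OF H_car[of g]] filt_ring_minus[OF H_car[of g]]
      by (simp add: g(2) H_def cc_hom.poly_subst_uminus)
    then show ?case using poly_in_uminus[OF g(1)] by blast
  next
    case (eng_add z1 z2)
    then obtain g1 g2 where g: "g1 \<in> ?P" "z1 = ?I +>\<^bsub>?R\<^esub> H g1" "g2 \<in> ?P" "z2 = ?I +>\<^bsub>?R\<^esub> H g2" by blast
    have "z1 \<oplus>\<^bsub>?R Quot ?I\<^esub> z2 = ?I +>\<^bsub>?R\<^esub> H (g1 + g2)"
      using h.hom_add[OF H_car H_car, of g1 g2] by (simp add: g(2,4) H_def cc_hom.poly_subst_add filt_ring_simps)
    then show ?case using poly_in_add[OF g(1,3)] by blast
  next
    case (eng_mult z1 z2)
    then obtain g1 g2 where g: "g1 \<in> ?P" "z1 = ?I +>\<^bsub>?R\<^esub> H g1" "g2 \<in> ?P" "z2 = ?I +>\<^bsub>?R\<^esub> H g2" by blast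
    have "z1 \<otimes>\<^bsub>?R Quot ?I\<^esub> z2 = ?I +>\<^bsub>?R\<^esub> H (g1 * g2)"
      using h.hom_mult[OF H_car H_car, of g1 g2] by (simp add: g(2,4) H_def cc_hom.poly_subst_mult filt_ring_simps)
    then show ?case using poly_in_mult[OF g(1,3)] by blast
  qed
  moreover have sc: "Poly_Mapping.single (val f) f \<in> carrier ?R"
    by (auto simp: carrier_filt_ring lookup_single when_def val_ge_def)
  then have "?I +>\<^bsub>?R\<^esub> Poly_Mapping.single (val f) f \<in> carrier (?R Quot ?I)" by (rule h.hom_closed)
  ultimately obtain g where g: "g \<in> ?P" "?I +>\<^bsub>?R\<^esub> Poly_Mapping.single (val f) f = ?I +>\<^bsub>?R\<^esub> H g"
    using gen unfolding gr_ring_def by blast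
  have "Poly_Mapping.single (val f) f \<ominus>\<^bsub>?R\<^esub> H g \<in> ?I"
    using I.quotient_eq_iff_same_a_r_cos[OF ideal_filt_ideal sc H_car] g(2) by blast
  then have "Poly_Mapping.single (val f) f - H g \<in> ?I"
    unfolding a_minus_def filt_ring_minus[OF H_car] filt_ring_simps by simp
  then have gt: "val_gt (val f) (f - lookup (H g) (val f))"
    unfolding filt_ideal_alt by (auto simp: lookup_minus dest: spec[of _ "val f"])
  define S where "S = {m. expo (\<lambda>j. val (b j)) m = val f}"
  have "lookup (H g) (val f) = (\<Sum>m\<in>keys g. if m \<in> S then const (lookup g m) * mon_eval b m else 0)"
    unfolding H_expand lookup_sum by (rule sum.cong) (auto simp: lookup_single when_def S_def)
  also have "\<dots> = (\<Sum>m\<in>keys g \<inter> S. const (lookup g m) * mon_eval b m)"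
    by (simp add: sum.inter_restrict)
  also have "\<dots> = poly_subst const b (restr S g)"
    unfolding poly_subst_mon_eval keys_restr by (rule sum.cong) (auto simp: lookup_restr)
  finally show thesis using g(1) gt by (intro that[of "restr S g"]) (auto simp: S_def)
qed

end

section \<open>Degrees, adapted bases and termination\<close>

definition total_deg :: "('x \<Rightarrow>\<^sub>0 nat) \<Rightarrow> nat" where
  "total_deg m = (\<Sum>x\<in>keys m. lookup m x)"

lemma total_deg_superset: "finite S \<Longrightarrow> keys m \<subseteq> S \<Longrightarrow> total_deg m = (\<Sum>x\<in>S. lookup m x)"
  unfolding total_deg_def by (rule sum.mono_neutral_left) (auto simp: in_keys_iff)

lemma total_deg_add: "total_deg (m + m') = total_deg m + total_deg m'"
proof -
  let ?S = "keys m \<union> keys m'"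
  have "keys (m + m') \<subseteq> ?S" by (rule keys_add)
  then show ?thesis by (simp add: total_deg_superset[of ?S] lookup_add sum.distrib)
qed

definition homogeneous :: "nat \<Rightarrow> ('x, 'k::comm_ring_1) mpoly \<Rightarrow> bool" where
  "homogeneous N f \<longleftrightarrow> (\<forall>m\<in>keys f. total_deg m = N)"

lemma fibre_alt: "fibre = {f. homogeneous 1 f}"
  by (simp add: fibre_def homogeneous_def total_deg_superset[of UNIV])

lemma homogeneous_1: "homogeneous 0 1"
  by (simp add: homogeneous_def total_deg_def)

lemma homogeneous_const: "homogeneous 0 (const c)"
  by (simp add: homogeneous_def total_deg_def)

lemma homogeneous_mult: "homogeneous N f \<Longrightarrow> homogeneous M g \<Longrightarrow> homogeneous (N + M) (f * g)"
  unfolding homogeneous_def by (metis keys_mult_mem total_deg_add)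

lemma homogeneous_power: "homogeneous 1 f \<Longrightarrow> homogeneous k (f ^ k)"
  using homogeneous_mult[of 1 f] by (induction k) (auto simp: homogeneous_1)

lemma homogeneous_mon_eval:
  assumes "\<And>z. z \<in> keys m \<Longrightarrow> homogeneous 1 (G z)"
  shows "homogeneous (total_deg m) (mon_eval G m)"
proof -
  have "homogeneous (\<Sum>z\<in>T. lookup m z) (\<Prod>z\<in>T. G z ^ lookup m z)" if "finite T" "T \<subseteq> keys m" for T
    using that by (induction T) (auto simp: homogeneous_1 intro!: homogeneous_mult homogeneous_power assms)
  then show ?thesis unfolding total_deg_def mon_eval_def by simp
qed

definition trunc :: "nat \<Rightarrow> ('x, 'k::comm_ring_1) mpoly \<Rightarrow> ('x, 'k) mpoly" where
  "trunc N = restr {m. total_deg m < N}"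

lemma trunc_homogeneous: "homogeneous M f \<Longrightarrow> trunc N f = (if M < N then f else 0)"
  unfolding trunc_def homogeneous_def by (auto intro!: restr_id restr_eq_0)

lemma trunc_sum: "trunc N (sum f T) = (\<Sum>x\<in>T. trunc N (f x))"
  by (simp add: trunc_def restr_sum)

lemma monomial_in_mon_eval: "monomial_in a = mon_eval (\<lambda>b. b) a"
  by (simp add: monomial_in_def mon_eval_def)

interpretation scale_vs: vector_space "scale :: 'k::field \<Rightarrow> ('e::comm_monoid_add \<Rightarrow>\<^sub>0 'k) \<Rightarrow> ('e \<Rightarrow>\<^sub>0 'k)"
  by unfold_locales (simp_all add: scale_def distrib_left distrib_right single_add mult.assoc[symmetric] mult_single)

lemma finite_basis_fibre:
  fixes B :: "('s::finite, 'k::field) mpoly set"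
  assumes "vs_basis fibre B"
  shows "finite B"
proof -
  have "fibre \<subseteq> scale_vs.span (Set.range (yvar :: 's \<Rightarrow> ('s, 'k) mpoly))"
  proof
    fix f :: "('s, 'k) mpoly" assume f: "f \<in> fibre"
    have "Poly_Mapping.single m (lookup f m) \<in> scale_vs.span (Set.range yvar)" if m: "m \<in> keys f" for m
    proof -
      have "(\<Sum>x\<in>UNIV. lookup m x) = 1" using f m by (simp add: fibre_def)
      then obtain x where x: "lookup m x = 1" "\<forall>y. x \<noteq> y \<longrightarrow> lookup m y = 0"
        using sum_eq_Suc0_iff[of UNIV "lookup m"] by auto
      then have "m = Poly_Mapping.single x (Suc 0)"
        by (intro poly_mapping_eqI) (auto simp: lookup_single when_def)
      then have "Poly_Mapping.single m (lookup f m) = scale (lookup f m) (yvar x)"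
        by (simp add: scale_def mult_single)
      then show ?thesis by (simp add: scale_vs.span_scale scale_vs.span_base)
    qed
    then show "f \<in> scale_vs.span (Set.range yvar)"
      by (subst sum_singles[of f]) (rule scale_vs.span_sum)
  qed
  then have "B \<subseteq> scale_vs.span (Set.range (yvar :: 's \<Rightarrow> ('s, 'k) mpoly))" "\<not> scale_vs.dependent B"
    using assms by (auto simp: vs_basis_def)
  then show ?thesis
    using scale_vs.independent_span_bound[of "Set.range (yvar :: 's \<Rightarrow> ('s, 'k) mpoly)" B] by auto
qed

lemma finite_bounded_exponents:
  assumes "finite B" shows "finite {a :: 'b \<Rightarrow>\<^sub>0 nat. keys a \<subseteq> B \<and> total_deg a < N}"
proof (rule finite_imageD)
  let ?A = "{a :: 'b \<Rightarrow>\<^sub>0 nat. keys a \<subseteq> B \<and> total_deg a < N}"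
  let ?f = "\<lambda>a :: 'b \<Rightarrow>\<^sub>0 nat. restrict (lookup a) B"
  have "lookup a x < N" if "a \<in> ?A" "x \<in> B" for a x
  proof -
    have "lookup a x \<le> (\<Sum>x\<in>B. lookup a x)" by (rule member_le_sum) (use that assms in auto)
    also have "\<dots> = total_deg a" using that assms by (simp add: total_deg_superset)
    finally show ?thesis using that by simp
  qed
  then have "?f ` ?A \<subseteq> (\<Pi>\<^sub>E x\<in>B. {..<N})" by auto
  then show "finite (?f ` ?A)" by (rule finite_subset) (intro finite_PiE assms, simp)
  show "inj_on ?f ?A"
  proof (rule inj_onI, rule poly_mapping_eqI)
    fix a a' x assume aa: "a \<in> ?A" "a' \<in> ?A" "?f a = ?f a'"
    show "lookup a x = lookup a' x"
    proof (cases "x \<in> B")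
      case True then show ?thesis using fun_cong[OF aa(3), of x] by simp
    next
      case False then have "x \<notin> keys a" "x \<notin> keys a'" using aa by auto
      then show ?thesis by (simp add: in_keys_iff)
    qed
  qed
qed

lemma adapted_basis_expansion:
  fixes v :: "('s::finite, 'k::field) mpoly \<Rightarrow> real ^ 'm \<Rightarrow> real"
  assumes ad: "adapted_basis v \<sigma> B" and f: "f \<noteq> 0"
  obtains S c where "finite S" "S \<noteq> {}" "\<forall>a\<in>S. keys a \<subseteq> B \<and> c a \<noteq> 0"
    "f = (\<Sum>a\<in>S. scale (c a) (monomial_in a))"
proof -
  let ?M = "{a. keys a \<subseteq> B}"
  have inj: "inj_on monomial_in ?M" and "scale_vs.span (monomial_in ` ?M) = UNIV"
    using ad unfolding adapted_basis_def vs_basis_def by auto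
  then have "f \<in> scale_vs.span (monomial_in ` ?M)" by simp
  then obtain T g where T: "finite T" "T \<subseteq> monomial_in ` ?M" "f = (\<Sum>t\<in>T. scale (g t) t)"
    unfolding scale_vs.span_explicit by auto
  define S where "S = {a\<in>?M. monomial_in a \<in> T \<and> g (monomial_in a) \<noteq> 0}"
  have injS: "inj_on monomial_in S" using inj by (rule inj_on_subset) (auto simp: S_def)
  have img: "monomial_in ` S = {t \<in> T. g t \<noteq> 0}" using T(2) by (auto simp: S_def)
  have "finite (monomial_in ` S)" unfolding img using T(1) by simp
  then have fS: "finite S" using injS by (rule finite_imageD)
  have "f = (\<Sum>t\<in>{t \<in> T. g t \<noteq> 0}. scale (g t) t)"
    unfolding T(3) by (rule sum.mono_neutral_right) (use T(1) in \<open>auto simp: scale_def\<close>)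
  also have "\<dots> = (\<Sum>a\<in>S. scale (g (monomial_in a)) (monomial_in a))"
    unfolding img[symmetric] by (rule sum.reindex_cong[OF injS]) auto
  finally have fe: "f = (\<Sum>a\<in>S. scale (g (monomial_in a)) (monomial_in a))" .
  have "S \<noteq> {}" using fe f by auto
  with fS fe show thesis by (intro that[of S "\<lambda>a. g (monomial_in a)"]) (auto simp: S_def)
qed

text \<open>Monomials in an adapted basis are homogeneous, and the value is the minimum over the monomials
  that occur. Omitting monomials therefore does not lower the value, and in bounded degree only
  finitely many values are possible.\<close>

lemma adapted_basis_trunc:
  fixes v :: "('s::finite, 'k::field) mpoly \<Rightarrow> real ^ 'm \<Rightarrow> real"
  assumes ad: "adapted_basis v \<sigma> B" and x: "x \<in> \<sigma>"
  shows "f \<noteq> 0 \<Longrightarrow> trunc N f \<noteq> 0 \<Longrightarrow> v f x \<le> v (trunc N f) x"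
    and "\<exists>M. \<forall>f. f \<noteq> 0 \<longrightarrow> trunc N f = f \<longrightarrow> v f x \<le> M"
proof -
  have basis: "vs_basis fibre B" using ad unfolding adapted_basis_def by (elim conjE)
  then have B: "B \<subseteq> fibre" by (simp add: vs_basis_def)
  have Min0: "\<forall>S c. finite S \<and> S \<noteq> {} \<and> (\<forall>a\<in>S. keys a \<subseteq> B \<and> c a \<noteq> 0) \<longrightarrow>
      (\<forall>x\<in>\<sigma>. v (\<Sum>a\<in>S. scale (c a) (monomial_in a)) x = Min ((\<lambda>a. v (monomial_in a) x) ` S))"
    using ad unfolding adapted_basis_def by (elim conjE)
  have Min: "v (\<Sum>a\<in>S. scale (c a) (monomial_in a)) x = Min ((\<lambda>a. v (monomial_in a) x) ` S)"
    if "finite S" "S \<noteq> {}" "\<forall>a\<in>S. keys a \<subseteq> B \<and> c a \<noteq> 0" for S c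
    using Min0[THEN spec[of _ S], THEN spec[of _ c]] x that by simp
  have exp: "\<exists>S c S'. finite S \<and> S \<noteq> {} \<and> (\<forall>a\<in>S. keys a \<subseteq> B \<and> c a \<noteq> 0) \<and> S' = {a\<in>S. total_deg a < N} \<and>
      f = (\<Sum>a\<in>S. scale (c a) (monomial_in a)) \<and> trunc N f = (\<Sum>a\<in>S'. scale (c a) (monomial_in a))"
    if f: "f \<noteq> 0" for f
  proof -
    obtain S c where S: "finite S" "S \<noteq> {}" "\<forall>a\<in>S. keys a \<subseteq> B \<and> c a \<noteq> 0" "f = (\<Sum>a\<in>S. scale (c a) (monomial_in a))"
      using adapted_basis_expansion[OF ad f] by blast
    have "trunc N f = (\<Sum>a\<in>S. if total_deg a < N then scale (c a) (monomial_in a) else 0)"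
      unfolding S(4) trunc_sum
    proof (rule sum.cong[OF refl])
      fix a assume a: "a \<in> S"
      have "homogeneous (total_deg a) (mon_eval (\<lambda>b. b) a)"
        by (rule homogeneous_mon_eval) (use a S(3) B in \<open>auto simp: fibre_alt\<close>)
      then have "homogeneous (0 + total_deg a) (scale (c a) (monomial_in a))"
        unfolding monomial_in_mon_eval scale_def by (rule homogeneous_mult[OF homogeneous_const])
      then show "trunc N (scale (c a) (monomial_in a)) = (if total_deg a < N then scale (c a) (monomial_in a) else 0)"
        using trunc_homogeneous[of "total_deg a" "scale (c a) (monomial_in a)" N] by simp
    qed
    also have "\<dots> = (\<Sum>a\<in>{a\<in>S. total_deg a < N}. scale (c a) (monomial_in a))"
      using S(1) by (simp add: sum.inter_filter)
    finally show ?thesis using S by blast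
  qed
  show "v f x \<le> v (trunc N f) x" if f: "f \<noteq> 0" "trunc N f \<noteq> 0"
  proof -
    obtain S c S' where S: "finite S" "S \<noteq> {}" "\<forall>a\<in>S. keys a \<subseteq> B \<and> c a \<noteq> 0" "S' = {a\<in>S. total_deg a < N}"
      "f = (\<Sum>a\<in>S. scale (c a) (monomial_in a))" "trunc N f = (\<Sum>a\<in>S'. scale (c a) (monomial_in a))"
      using exp[OF f(1)] by blast
    have ne: "S' \<noteq> {}" using S(6) f(2) by (metis sum.empty)
    have S': "finite S'" "S' \<noteq> {}" "\<forall>a\<in>S'. keys a \<subseteq> B \<and> c a \<noteq> 0" "S' \<subseteq> S"
      using S(1,3,4) ne by simp_all
    have "v f x = Min ((\<lambda>a. v (monomial_in a) x) ` S)" using Min[OF S(1-3)] S(5) by simp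
    also have "\<dots> \<le> Min ((\<lambda>a. v (monomial_in a) x) ` S')" by (rule Min_antimono) (use S S' in auto)
    also have "\<dots> = v (trunc N f) x" using Min[OF S'(1-3)] S(6) by simp
    finally show ?thesis .
  qed
  let ?F = "{a. keys a \<subseteq> B \<and> total_deg a < N}"
  have "finite B" by (rule finite_basis_fibre[OF basis])
  then have fF: "finite ((\<lambda>a. v (monomial_in a) x) ` ?F)" by (intro finite_imageI finite_bounded_exponents)
  have "v f x \<le> Max ((\<lambda>a. v (monomial_in a) x) ` ?F)" if f: "f \<noteq> 0" "trunc N f = f" for f
  proof -
    obtain S c S' where S: "finite S" "\<forall>a\<in>S. keys a \<subseteq> B \<and> c a \<noteq> 0" "S' = {a\<in>S. total_deg a < N}"
      "trunc N f = (\<Sum>a\<in>S'. scale (c a) (monomial_in a))"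
      using exp[OF f(1)] by blast
    have ne: "S' \<noteq> {}" using S(4) f by (metis sum.empty)
    have S': "finite S'" "S' \<noteq> {}" "\<forall>a\<in>S'. keys a \<subseteq> B \<and> c a \<noteq> 0"
      using S(1-3) ne by simp_all
    obtain a where a: "a \<in> S'" using S'(2) by blast
    have "v f x = Min ((\<lambda>a. v (monomial_in a) x) ` S')" using Min[OF S'] S(4) f(2) by simp
    also have "\<dots> \<le> v (monomial_in a) x" using S'(1) a by simp
    also have "\<dots> \<le> Max ((\<lambda>a. v (monomial_in a) x) ` ?F)" using a S(2,3) by (intro Max_ge[OF fF]) auto
    finally show ?thesis .
  qed
  then show "\<exists>M. \<forall>f. f \<noteq> 0 \<longrightarrow> trunc N f = f \<longrightarrow> v f x \<le> M" by blast
qed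

context rees_data
begin

lemma ev_trunc:
  assumes b: "\<And>j. j < r \<Longrightarrow> b j \<in> fibre" and g: "g \<in> filt A \<delta>"
  shows "ev (trunc N g) = trunc N (ev g)"
proof -
  have t: "trunc N (const a * mon_eval b m) = (if total_deg m < N then const a * mon_eval b m else 0)"
    if "m \<in> keys g" for a m
  proof -
    have "homogeneous (total_deg m) (mon_eval b m)"
      by (rule homogeneous_mon_eval) (use filtD(1)[OF g that] b in \<open>auto simp: fibre_alt\<close>)
    then have "homogeneous (0 + total_deg m) (const a * mon_eval b m)"
      by (rule homogeneous_mult[OF homogeneous_const])
    then show ?thesis using trunc_homogeneous[of "total_deg m" "const a * mon_eval b m" N] by simp
  qed
  have "ev (trunc N g) = (\<Sum>m\<in>keys g \<inter> {m. total_deg m < N}. const (lookup g m) * mon_eval b m)"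
    unfolding ev_def poly_subst_mon_eval trunc_def keys_restr by (rule sum.cong) (auto simp: lookup_restr)
  also have "\<dots> = (\<Sum>m\<in>keys g. trunc N (const (lookup g m) * mon_eval b m))"
    by (simp add: t sum.inter_restrict)
  also have "\<dots> = trunc N (ev g)" unfolding ev_def poly_subst_mon_eval trunc_sum ..
  finally show ?thesis .
qed

lemma expo_real_wt:
  assumes "\<And>j. j < r \<Longrightarrow> real_of_int (u i j) = val (b j)" "keys m \<subseteq> {..<r}"
  shows "expo (\<lambda>j. val (b j)) m = real_of_int (wt (u i) m)"
proof -
  have "expo (\<lambda>j. val (b j)) m = (\<Sum>j\<in>keys m. real (lookup m j) * val (b j))" by (simp add: expo_def)
  also have "\<dots> = (\<Sum>j\<in>keys m. real_of_int (u i j * int (lookup m j)))"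
    by (rule sum.cong) (use assms in \<open>auto simp: subset_eq mult.commute\<close>)
  finally show ?thesis by (simp add: wt_def)
qed

text \<open>Repeated approximation; truncation keeps the degree bounded, and it terminates because the
  integral values are bounded on polynomials of bounded degree.\<close>

lemma single_ray_image:
  assumes val: "real_valuation (\<lambda>f. v f x)"
    and ad: "adapted_basis v \<sigma> B" and x: "x \<in> \<sigma>"
    and b: "\<And>j. j < r \<Longrightarrow> b j \<in> fibre" "0 \<notin> b ` {..<r}"
    and gen: "generate_ring (gr_ring (\<lambda>f. v f x)) (Set.range (\<lambda>c. gr_class (\<lambda>f. v f x) 0 (const c))
        \<union> (\<lambda>b. gr_class (\<lambda>f. v f x) (v b x) b) ` b ` {..<r}) = carrier (gr_ring (\<lambda>f. v f x))"
    and int: "\<And>f. f \<noteq> 0 \<Longrightarrow> v f x \<in> \<int>"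
    and u: "\<And>j. j < r \<Longrightarrow> real_of_int (u i j) = v (b j) x"
  shows "f \<in> ev ` filt {i} (\<lambda>_. a) \<longleftrightarrow> f = 0 \<or> real_of_int a \<le> v f x"
proof -
  interpret real_valuation "\<lambda>f. v f x" by fact
  have "f \<in> ev ` filt {i} (\<lambda>_. a)" if f: "trunc N f = f" "f = 0 \<or> real_of_int a \<le> v f x" for N f
  proof -
    obtain M where M: "\<And>f. f \<noteq> 0 \<Longrightarrow> trunc N f = f \<Longrightarrow> v f x \<le> M"
      using adapted_basis_trunc(2)[OF ad x, of N] by blast
    show ?thesis
      using f
    proof (induction "nat \<lceil>M + 1 - v f x\<rceil>" arbitrary: f rule: less_induct)
      case less
      show ?case
      proof (cases "f = 0")
        case True then show ?thesis by (intro image_eqI[of _ _ 0]) auto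
      next
        case False
        obtain g where g: "g \<in> carrier (poly_ring_in {..<r})"
            "\<And>m. m \<in> keys g \<Longrightarrow> expo (\<lambda>j. v (b j) x) m = v f x" "val_gt (v f x) (f - poly_subst const b g)"
          using approximation[OF b(2) gen False] by blast
        have gf: "g \<in> filt {i} (\<lambda>_. a)"
        proof (rule filtI)
          fix m i' assume m: "m \<in> keys g" "i' \<in> {i}"
          have "real_of_int (wt (u i) m) = v f x" using g(1,2) m(1) expo_real_wt[of i "\<lambda>f. v f x" m, OF u] by auto
          then show "a \<le> wt (u i') m" using less.prems(2) False m(2) by simp
        qed (use g(1) in auto)
        define f' where "f' = trunc N (f - ev g)"
        have f'_eq: "f' = f - ev (trunc N g)"
        proof -
          have "trunc N (f - ev g) = trunc N f - trunc N (ev g)" by (simp add: trunc_def restr_diff)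
          then show ?thesis using less.prems(1) ev_trunc[OF b(1) gf, of N] by (simp add: f'_def)
        qed
        have tg: "trunc N g \<in> filt {i} (\<lambda>_. a)" unfolding trunc_def by (rule filt_restr[OF gf])
        have f': "f' = 0 \<or> v f x < v f' x"
        proof (cases "f' = 0")
          case False
          then have "f - ev g \<noteq> 0" by (auto simp: f'_def trunc_def)
          moreover from this have "v (f - ev g) x \<le> v f' x"
            unfolding f'_def by (rule adapted_basis_trunc(1)[OF ad x]) (use False f'_def in simp)
          ultimately show ?thesis using g(3) unfolding val_gt_def ev_def by auto
        qed simp
        have tf': "trunc N f' = f'" unfolding f'_def trunc_def by (rule restr_id) auto
        have "f' \<in> ev ` filt {i} (\<lambda>_. a)"
        proof (cases "f' = 0")
          case True then show ?thesis by (intro image_eqI[of _ _ 0]) auto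
        next
          case nz: False
          have lt: "v f x < v f' x" using f' nz by simp
          obtain s t where st: "v f x = real_of_int s" "v f' x = real_of_int t"
            using int[OF False] int[OF nz] by (auto elim!: Ints_cases)
          have "s + 1 \<le> t" using lt st by simp
          then have "real_of_int s + 1 \<le> real_of_int t" by linarith
          then have "M + 1 - v f' x \<le> M + 1 - v f x - 1" using st by simp
          then have "\<lceil>M + 1 - v f' x\<rceil> \<le> \<lceil>M + 1 - v f x\<rceil> - 1" by linarith
          moreover have "1 \<le> M + 1 - v f x" using M[OF False less.prems(1)] by simp
          then have "1 \<le> \<lceil>M + 1 - v f x\<rceil>" by linarith
          ultimately have "nat \<lceil>M + 1 - v f' x\<rceil> < nat \<lceil>M + 1 - v f x\<rceil>" by linarith
          moreover have "real_of_int a \<le> v f' x" using lt less.prems(2) False by simp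
          ultimately show ?thesis using less.hyps[of f'] tf' by blast
        qed
        then obtain h where h: "h \<in> filt {i} (\<lambda>_. a)" "f' = ev h" by blast
        have "f = ev (trunc N g + h)" using f'_eq h(2) by (simp add: ev_add)
        then show ?thesis using filt_add[OF tg h(1)] by blast
      qed
    qed
  qed
  moreover have "\<exists>N. trunc N f = f"
  proof -
    have "trunc (Suc (Max (insert 0 (total_deg ` keys f)))) f = f"
      unfolding trunc_def by (rule restr_id) (auto simp: less_Suc_eq_le)
    then show ?thesis by blast
  qed
  moreover have "f = 0 \<or> real_of_int a \<le> v f x" if f_img: "f \<in> ev ` filt {i} (\<lambda>_. a)"
  proof -
    obtain g where g: "g \<in> filt {i} (\<lambda>_. a)" "f = ev g" using f_img by blast
    have "val_ge (real_of_int a) (const (lookup g m) * mon_eval b m)" if m: "m \<in> keys g" for m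
    proof -
      have pw: "val_ge (\<Sum>_<k. v (b j) x) (b j ^ k)" for j k
        by (induction k) (auto simp: val_ge_1 lessThan_Suc simp del: sum_constant intro!: val_ge_mult, simp add: val_ge_def)
      have "val_ge (\<Sum>j\<in>T. \<Sum>_<lookup m j. v (b j) x) (\<Prod>j\<in>T. b j ^ lookup m j)" for T
        by (induction T rule: infinite_finite_induct) (auto simp: val_ge_1 simp del: sum_constant intro!: val_ge_mult pw)
      then have "val_ge (expo (\<lambda>j. v (b j) x) m) (mon_eval b m)" unfolding expo_def mon_eval_def .
      then have "val_ge (0 + real_of_int (wt (u i) m)) (const (lookup g m) * mon_eval b m)"
        using val_ge_mult[OF val_ge_const] expo_real_wt[of i "\<lambda>f. v f x" m, OF u filtD(1)[OF g(1) m]] by simp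
      then show ?thesis using filtD(2)[OF g(1) m, of i] by (auto simp: val_ge_def)
    qed
    then have "val_ge (real_of_int a) f"
      unfolding g(2) ev_def poly_subst_mon_eval by (rule val_ge_sum)
    then show ?thesis by (simp add: val_ge_def)
  qed
  ultimately show ?thesis by blast
qed

end

section \<open>Surjectivity and lowest parts\<close>

definition raise :: "nat \<Rightarrow> (nat \<Rightarrow> int) \<Rightarrow> nat \<Rightarrow> int" where
  "raise i \<delta> = (\<lambda>l. \<delta> l + (if l = i then 1 else 0))"

context weighted_forms
begin

text \<open>In the quotient by the \<open>p\<^sub>k\<close> and \<open>X\<^sub>i\<close> the other variables are nonzero divisors: \<open>f\<close> lies in
  the ideal generated by the \<open>p\<^sub>k\<close> and \<open>X\<^sub>i\<close> if it does so after inverting the other variables.\<close>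

definition cancellable :: "(nat \<Rightarrow> nat \<Rightarrow> 'k::field) \<Rightarrow> nat set \<Rightarrow> nat set \<Rightarrow> nat \<Rightarrow> bool" where
  "cancellable c K A i \<longleftrightarrow> (\<forall>\<delta> f j. f \<in> filt A \<delta> \<longrightarrow> j \<in> rel c K {i} \<delta> \<longrightarrow> f - j \<in> filt {i} (raise i \<delta>) \<longrightarrow>
     (\<exists>j'\<in>rel c K A \<delta>. f - j' \<in> filt A (raise i \<delta>)))"

lemma lead_weight: "m \<in> keys (linear_form r (lead c {i} k)) \<Longrightarrow> wt (u i) m = w k i"
  by (auto simp: keys_linear_form lead_def split: if_splits)

lemma restr_exact_raise: "g \<in> filt {i} (raise i \<delta>) \<Longrightarrow> restr (exact {i} \<delta>) g = 0"
  by (rule restr_eq_0) (force simp: exact_def raise_def filt_def)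

lemma filt_insert_exact:
  "g \<in> filt A \<delta> \<Longrightarrow> keys g \<subseteq> exact {i} \<epsilon> \<Longrightarrow> (\<And>l. l \<in> A \<Longrightarrow> \<eta> l \<le> \<delta> l) \<Longrightarrow> \<eta> i \<le> \<epsilon> i \<Longrightarrow> g \<in> filt (insert i A) \<eta>"
  unfolding filt_def exact_def by (force intro: order_trans)

text \<open>Modulo \<open>X\<^sub>i\<close> only monomials of exact weight \<open>\<delta> i\<close> survive, and \<open>p\<^sub>k\<close> becomes the polynomial
  that belongs to \<open>lead c {i} k\<close>.\<close>

lemma saturated_lead_if_cancellable:
  fixes c :: "nat \<Rightarrow> nat \<Rightarrow> 'k::field"
  assumes i: "i \<in> A" and adm: "admissible c K A" and canc: "cancellable c K A i"
  shows "saturated (lead c {i}) K (A - {i})"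
  unfolding saturated_def
proof (intro allI impI)
  fix \<delta> and f :: "(nat, 'k) mpoly"
  assume f: "f \<in> rel (lead c {i}) K {} \<delta>" "f \<in> filt (A - {i}) \<delta>"
  have A: "insert i (A - {i}) = A" using i by auto
  have admi: "admissible c K {i}" using adm by (rule admissible_mono) (use i in auto)
  obtain g where g: "f = (\<Sum>k\<in>K. linear_form r (lead c {i} k) * g k)" "\<forall>k\<in>K. g k \<in> filt {} (\<lambda>i. \<delta> i - w k i)"
    using f(1) by (rule relE)
  have part: "restr (exact {i} (\<lambda>_. a)) f \<in> rel (lead c {i}) K (A - {i}) \<delta>" for a
  proof -
    define \<delta>a where "\<delta>a = \<delta>(i := a)"
    have ex: "exact {i} (\<lambda>_. a) = exact {i} \<delta>a" by (simp add: exact_def \<delta>a_def)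
    define fa where "fa = restr (exact {i} \<delta>a) f"
    define h where "h = (\<lambda>k. restr (exact {i} (\<lambda>l. \<delta>a l - w k l)) (g k))"
    have hf: "h k \<in> filt {i} (\<lambda>l. \<delta>a l - w k l)" if "k \<in> K" for k
      using filt_insert_exact[OF filt_restr[OF bspec[OF g(2) that]], of _ i "\<lambda>l. \<delta>a l - w k l" "\<lambda>l. \<delta>a l - w k l"]
      by (simp add: h_def)
    have fa: "fa = (\<Sum>k\<in>K. linear_form r (lead c {i} k) * h k)"
      unfolding fa_def g(1) restr_sum h_def
      by (rule sum.cong[OF refl], rule restr_mult) (auto simp: exact_def wt_add lead_weight)
    define j where "j = (\<Sum>k\<in>K. linear_form r (c k) * h k)"
    have j: "j \<in> rel c K {i} \<delta>a" by (rule relI[OF j_def hf])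
    have "fa - j = - (\<Sum>k\<in>K. linear_form r (\<lambda>l. c k l - lead c {i} k l) * h k)"
      unfolding fa j_def linear_form_diff by (simp add: sum_subtractf left_diff_distrib)
    also have "\<dots> \<in> filt {i} (raise i \<delta>a)"
    proof (rule filt_uminus, rule filt_sum)
      fix k assume k: "k \<in> K"
      have "linear_form r (\<lambda>l. c k l - lead c {i} k l) \<in> filt {i} (\<lambda>l. w k l + 1)"
      proof (rule linear_form_filt)
        fix l i' assume l: "l < r" "c k l - lead c {i} k l \<noteq> 0" "i' \<in> {i}"
        then have "c k l \<noteq> 0" "u i l \<noteq> w k i" by (auto simp: lead_def split: if_splits)
        moreover from this have "w k i \<le> u i l" using admi k l(1) unfolding admissible_def by blast
        ultimately show "w k i' + 1 \<le> u i' l" using l(3) by simp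
      qed
      then show "linear_form r (\<lambda>l. c k l - lead c {i} k l) * h k \<in> filt {i} (raise i \<delta>a)"
        by (rule filt_mult'[OF _ hf[OF k]]) (simp add: raise_def)
    qed
    finally have fj: "fa - j \<in> filt {i} (raise i \<delta>a)" .
    have "fa \<in> filt (insert i (A - {i})) \<delta>a"
      by (rule filt_insert_exact[OF filt_restr[OF f(2), of "exact {i} \<delta>a", folded fa_def], of i \<delta>a])
         (auto simp: fa_def \<delta>a_def)
    then have "fa \<in> filt A \<delta>a" unfolding A .
    then obtain j' where j': "j' \<in> rel c K A \<delta>a" "fa - j' \<in> filt A (raise i \<delta>a)"
      using canc j fj unfolding cancellable_def by blast
    obtain t where t: "j' = (\<Sum>k\<in>K. linear_form r (c k) * t k)" "\<forall>k\<in>K. t k \<in> filt A (\<lambda>l. \<delta>a l - w k l)"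
      using j'(1) by (rule relE)
    have "restr (exact {i} \<delta>a) (fa - j') = 0"
      by (rule restr_exact_raise, rule filt_mono[OF j'(2)]) (use i in auto)
    then have "restr (exact {i} \<delta>a) fa = restr (exact {i} \<delta>a) j'" by (simp add: restr_diff)
    moreover have "restr (exact {i} \<delta>a) fa = fa" by (rule restr_id) (simp add: fa_def)
    ultimately have "fa = restr (exact {i} \<delta>a) j'" by simp
    also have "\<dots> = (\<Sum>k\<in>K. linear_form r (lead c {i} k) * restr (exact {i} (\<lambda>l. \<delta>a l - w k l)) (t k))"
      unfolding t(1) restr_sum
    proof (rule sum.cong[OF refl])
      fix k assume k: "k \<in> K"
      have "t k \<in> filt {i} (\<lambda>l. \<delta>a l - w k l)" by (rule filt_mono[OF bspec[OF t(2) k]]) (use i in auto)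
      then show "restr (exact {i} \<delta>a) (linear_form r (c k) * t k) = linear_form r (lead c {i} k) * restr (exact {i} (\<lambda>l. \<delta>a l - w k l)) (t k)"
        by (rule restr_exact_form[OF admi k]) simp
    qed
    finally show ?thesis unfolding ex fa_def[symmetric]
    proof (rule relI)
      fix k assume k: "k \<in> K"
      show "restr (exact {i} (\<lambda>l. \<delta>a l - w k l)) (t k) \<in> filt (A - {i}) (\<lambda>l. \<delta> l - w k l)"
        by (rule filt_mono[OF filt_restr[OF bspec[OF t(2) k]]]) (auto simp: \<delta>a_def)
    qed
  qed
  have "f = (\<Sum>a\<in>wt (u i) ` keys f. restr (exact {i} (\<lambda>_. a)) f)"
  proof (rule poly_mapping_eqI)
    fix m
    have "lookup (\<Sum>a\<in>wt (u i) ` keys f. restr (exact {i} (\<lambda>_. a)) f) m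
       = (\<Sum>a\<in>wt (u i) ` keys f. if a = wt (u i) m then lookup f m else 0)"
      unfolding lookup_sum by (rule sum.cong) (auto simp: lookup_restr exact_def)
    also have "\<dots> = lookup f m" by (auto simp: in_keys_iff)
    finally show "lookup f m = lookup (\<Sum>a\<in>wt (u i) ` keys f. restr (exact {i} (\<lambda>_. a)) f) m" ..
  qed
  then show "f \<in> rel (lead c {i}) K (A - {i}) \<delta>" using rel_sum part by metis
qed

lemma cancellable_if_saturated_lead:
  fixes c :: "nat \<Rightarrow> nat \<Rightarrow> 'k::field"
  assumes i: "i \<in> A" and adm: "admissible c K A" and sat: "saturated (lead c {i}) K (A - {i})"
  shows "cancellable c K A i"
  unfolding cancellable_def
proof (intro allI impI)
  fix \<delta> and f j :: "(nat, 'k) mpoly"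
  assume f: "f \<in> filt A \<delta>" and j: "j \<in> rel c K {i} \<delta>" and fj: "f - j \<in> filt {i} (raise i \<delta>)"
  have A: "insert i (A - {i}) = A" using i by auto
  have admi: "admissible c K {i}" using adm by (rule admissible_mono) (use i in auto)
  let ?E = "exact {i} \<delta>"
  \<comment> \<open>The part that survives modulo \<open>X\<^sub>i\<close>.\<close>
  define fa where "fa = restr ?E f"
  have "restr ?E (f - j) = 0" by (rule restr_exact_raise[OF fj])
  then have "fa = restr ?E j" by (simp add: fa_def restr_diff)
  then have "fa \<in> combos r (lead c {i}) K" using rel_lowest_part[OF admi j] by simp
  moreover have "fa \<in> filt {} \<delta>" unfolding fa_def by (rule filt_restr, rule filt_mono[OF f]) auto
  ultimately have "fa \<in> rel (lead c {i}) K {} \<delta>" using rel_combos by blast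
  moreover have "fa \<in> filt (A - {i}) \<delta>" unfolding fa_def by (rule filt_restr, rule filt_mono[OF f]) auto
  ultimately have "fa \<in> rel (lead c {i}) K (A - {i}) \<delta>" using sat unfolding saturated_def by blast
  then obtain s where s: "fa = (\<Sum>k\<in>K. linear_form r (lead c {i} k) * s k)" "\<forall>k\<in>K. s k \<in> filt (A - {i}) (\<lambda>l. \<delta> l - w k l)"
    by (rule relE)
  define t where "t = (\<lambda>k. restr (exact {i} (\<lambda>l. \<delta> l - w k l)) (s k))"
  have tf: "t k \<in> filt A (\<lambda>l. \<delta> l - w k l)" if "k \<in> K" for k
  proof -
    have "t k \<in> filt (insert i (A - {i})) (\<lambda>l. \<delta> l - w k l)"
      unfolding t_def
      by (rule filt_insert_exact[OF filt_restr[OF bspec[OF s(2) that]], where \<epsilon> = "\<lambda>l. \<delta> l - w k l"]) auto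
    then show ?thesis unfolding A .
  qed
  have "fa = restr ?E fa" by (rule restr_id[symmetric]) (simp add: fa_def)
  also have "\<dots> = (\<Sum>k\<in>K. linear_form r (lead c {i} k) * t k)"
    unfolding s(1) restr_sum t_def
    by (rule sum.cong[OF refl], rule restr_mult) (auto simp: exact_def wt_add lead_weight)
  finally have fa: "fa = (\<Sum>k\<in>K. linear_form r (lead c {i} k) * t k)" .
  define j' where "j' = (\<Sum>k\<in>K. linear_form r (c k) * t k)"
  have j': "j' \<in> rel c K A \<delta>" by (rule relI[OF j'_def tf])
  have "restr ?E j' = (\<Sum>k\<in>K. linear_form r (lead c {i} k) * t k)"
    unfolding j'_def restr_sum
  proof (rule sum.cong[OF refl])
    fix k assume k: "k \<in> K"
    have "t k \<in> filt {i} (\<lambda>l. \<delta> l - w k l)" by (rule filt_mono[OF tf[OF k]]) (use i in auto)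
    then have "restr ?E (linear_form r (c k) * t k) = linear_form r (lead c {i} k) * restr (exact {i} (\<lambda>l. \<delta> l - w k l)) (t k)"
      by (rule restr_exact_form[OF admi k]) simp
    also have "restr (exact {i} (\<lambda>l. \<delta> l - w k l)) (t k) = t k" by (rule restr_id) (simp add: t_def)
    finally show "restr ?E (linear_form r (c k) * t k) = linear_form r (lead c {i} k) * t k" .
  qed
  then have z: "restr ?E (f - j') = 0" using fa by (simp add: restr_diff fa_def)
  have fj': "f - j' \<in> filt A \<delta>" by (rule filt_diff[OF f rel_filt[OF adm j']])
  have "f - j' \<in> filt A (raise i \<delta>)"
  proof (rule filtI)
    fix m l assume m: "m \<in> keys (f - j')" and l: "l \<in> A"
    have "wt (u i) m \<noteq> \<delta> i"
    proof
      assume "wt (u i) m = \<delta> i"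
      then have "m \<in> keys (restr ?E (f - j'))" using m by (simp add: exact_def)
      then show False unfolding z by simp
    qed
    then show "raise i \<delta> l \<le> wt (u l) m"
      using filtD(2)[OF fj' m l] by (cases "l = i") (auto simp: raise_def)
  qed (rule filtD(1)[OF fj'])
  then show "\<exists>j'\<in>rel c K A \<delta>. f - j' \<in> filt A (raise i \<delta>)" using j' by blast
qed

end

context rees_data
begin

text \<open>Preimages of \<open>f\<close> that are good for one ray and for the bounds reached so far differ by a relation.
  Cancelling it raises one bound by one, until all of them are reached. Conversely, surjectivity
  replaces a polynomial with a relation modulo \<open>X\<^sub>i\<close> by one with a higher bound.\<close>

lemma image_iff_saturated_lead:
  assumes adm: "admissible c {..<d} {..<n}" and sat: "saturated c {..<d} {..<n}"
    and L: "\<And>f \<delta>. f \<in> filt {} \<delta> \<Longrightarrow> ev f = 0 \<longleftrightarrow> f \<in> rel c {..<d} {} \<delta>"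
    and surj: "\<And>f. f \<in> ev ` filt {} (\<lambda>_. 0)"
  shows "(\<forall>\<delta> f. (\<forall>i<n. f \<in> ev ` filt {i} \<delta>) \<longrightarrow> f \<in> ev ` filt {..<n} \<delta>) \<longleftrightarrow>
     (\<forall>i<n. saturated (lead c {i}) {..<d} ({..<n} - {i}))" (is "?IMG \<longleftrightarrow> ?SAT")
proof -
  have relL: "f \<in> rel c {..<d} A \<delta>" if "A \<subseteq> {..<n}" "f \<in> filt A \<delta>" "ev f = 0" for f A \<delta>
  proof -
    have "f \<in> rel c {..<d} {} \<delta>" using L[OF filt_mono[OF that(2), of "{}" \<delta>]] that(3) by auto
    then show ?thesis using saturated_mono[OF sat that(1)] that(2) unfolding saturated_def by blast
  qed
  have evL: "ev f = 0" if "f \<in> rel c {..<d} A \<delta>" for f A \<delta>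
  proof -
    have "f \<in> rel c {..<d} {} \<delta>" by (rule rel_mono[OF that]) auto
    moreover from this have "f \<in> filt {} \<delta>" using rel_combos by blast
    ultimately show ?thesis using L by blast
  qed
  have "?IMG \<longleftrightarrow> (\<forall>i<n. cancellable c {..<d} {..<n} i)"
  proof
    assume img: ?IMG
    show "\<forall>i<n. cancellable c {..<d} {..<n} i"
      unfolding cancellable_def
    proof (intro allI impI)
      fix i \<delta> and f j :: "(nat, 'k) mpoly"
      assume i: "i < n" and f: "f \<in> filt {..<n} \<delta>" and j: "j \<in> rel c {..<d} {i} \<delta>"
        and fj: "f - j \<in> filt {i} (raise i \<delta>)"
      have "ev f \<in> ev ` filt {l} (raise i \<delta>)" if l: "l < n" for l
      proof (cases "l = i")
        case True
        have "ev f = ev (f - j)" using evL[OF j] by (simp add: ev_diff)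
        then show ?thesis using fj True by blast
      next
        case False
        have "f \<in> filt {l} (raise i \<delta>)" by (rule filt_mono[OF f]) (use l False in \<open>auto simp: raise_def\<close>)
        then show ?thesis by blast
      qed
      then obtain g where g: "g \<in> filt {..<n} (raise i \<delta>)" "ev f = ev g" using img by blast
      have "g \<in> filt {..<n} \<delta>" by (rule filt_mono[OF g(1)]) (auto simp: raise_def)
      then have "f - g \<in> rel c {..<d} {..<n} \<delta>"
        using relL[OF order_refl filt_diff[OF f]] g(2) by (simp add: ev_diff)
      moreover have "f - (f - g) \<in> filt {..<n} (raise i \<delta>)" using g(1) by simp
      ultimately show "\<exists>j'\<in>rel c {..<d} {..<n} \<delta>. f - j' \<in> filt {..<n} (raise i \<delta>)" by blast
    qed
  next
    assume canc: "\<forall>i<n. cancellable c {..<d} {..<n} i"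
    show ?IMG
    proof (intro allI impI)
      fix \<delta> f assume fi: "\<forall>i<n. f \<in> ev ` filt {i} \<delta>"
      have main: "f \<in> ev ` filt {..<n} \<delta>"
        if "nat (\<Sum>l<n. \<delta> l - \<epsilon> l) = N" "\<forall>l<n. \<epsilon> l \<le> \<delta> l" "f \<in> ev ` filt {..<n} \<epsilon>" for N \<epsilon>
        using that
      proof (induction N arbitrary: \<epsilon> rule: less_induct)
        case (less N)
        show ?case
        proof (cases "\<forall>l<n. \<epsilon> l = \<delta> l")
          case True
          then have "filt {..<n} \<epsilon> \<subseteq> filt {..<n} \<delta>" by (auto intro: filt_mono)
          then show ?thesis using less.prems(3) by blast
        next
          case False
          then obtain i where i: "i < n" "\<epsilon> i < \<delta> i" using less.prems(2) by force
          obtain g where g: "g \<in> filt {..<n} \<epsilon>" "f = ev g" using less.prems(3) by blast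
          obtain h where h: "h \<in> filt {i} \<delta>" "f = ev h" using fi i(1) by blast
          have h': "h \<in> filt {i} (raise i \<epsilon>)" by (rule filt_mono[OF h(1)]) (use i in \<open>auto simp: raise_def\<close>)
          have "g - h \<in> filt {i} \<epsilon>"
            by (rule filt_diff[OF filt_mono[OF g(1)] filt_mono[OF h']]) (use i in \<open>auto simp: raise_def\<close>)
          then have "g - h \<in> rel c {..<d} {i} \<epsilon>" by (rule relL[rotated]) (use i g(2) h(2) in \<open>auto simp: ev_diff\<close>)
          moreover have "g - (g - h) \<in> filt {i} (raise i \<epsilon>)" using h' by simp
          ultimately obtain j' where j': "j' \<in> rel c {..<d} {..<n} \<epsilon>" "g - j' \<in> filt {..<n} (raise i \<epsilon>)"
            using canc i(1) g(1) unfolding cancellable_def by blast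
          have "ev (g - j') = f" using evL[OF j'(1)] g(2) by (simp add: ev_diff)
          then have mem: "f \<in> ev ` filt {..<n} (raise i \<epsilon>)" using j'(2) by blast
          have le: "\<forall>l<n. raise i \<epsilon> l \<le> \<delta> l" using less.prems(2) i by (auto simp: raise_def)
          have "(\<Sum>l<n. \<delta> l - raise i \<epsilon> l) = (\<Sum>l<n. \<delta> l - \<epsilon> l) - (\<Sum>l<n. if l = i then 1 else 0)"
            unfolding sum_subtractf[symmetric] by (rule sum.cong) (auto simp: raise_def)
          then have "(\<Sum>l<n. \<delta> l - raise i \<epsilon> l) = (\<Sum>l<n. \<delta> l - \<epsilon> l) - 1" using i(1) by simp
          moreover have "0 \<le> (\<Sum>l<n. \<delta> l - raise i \<epsilon> l)" by (rule sum_nonneg) (use le in auto)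
          ultimately have "nat (\<Sum>l<n. \<delta> l - raise i \<epsilon> l) < N" using less.prems(1) by linarith
          then show ?thesis using less.IH[OF _ refl le mem] by blast
        qed
      qed
      obtain g where g: "g \<in> filt {} (\<lambda>_. 0)" "f = ev g" using surj[of f] by blast
      \<comment> \<open>Some preimage of \<open>f\<close>, with the bounds that it happens to satisfy.\<close>
      define \<epsilon> where "\<epsilon> = (\<lambda>l. Min (insert (\<delta> l) (wt (u l) ` keys g)))"
      have "g \<in> filt {..<n} \<epsilon>"
        by (rule filtI) (use filtD(1)[OF g(1)] in \<open>auto simp: \<epsilon>_def\<close>)
      then have "f \<in> ev ` filt {..<n} \<epsilon>" using g(2) by blast
      moreover have "\<forall>l<n. \<epsilon> l \<le> \<delta> l" by (simp add: \<epsilon>_def)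
      ultimately show "f \<in> ev ` filt {..<n} \<delta>" using main[OF refl] by blast
    qed
  qed
  also have "\<dots> \<longleftrightarrow> ?SAT"
    using saturated_lead_if_cancellable[OF _ adm] cancellable_if_saturated_lead[OF _ adm] by blast
  finally show ?thesis .
qed

end

section \<open>Toric vector bundles\<close>

lemma lat_in_support:
  assumes "bij_betw \<rho> {..<n} (ray_generators \<Sigma>)" "i < n"
  obtains \<sigma> where "\<sigma> \<in> \<Sigma>" "lat (\<rho> i) \<in> \<sigma>"
proof -
  have "\<rho> i \<in> ray_generators \<Sigma>" using assms by (auto simp: bij_betw_def)
  then have "convex_cone hull {lat (\<rho> i)} \<in> \<Sigma>" by (simp add: ray_generators_def)
  moreover have "lat (\<rho> i) \<in> convex_cone hull {lat (\<rho> i)}" by (rule hull_inc) simp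
  ultimately show thesis by (rule that)
qed

lemma integral_PL_at_lattice_point:
  assumes "\<phi> \<in> integral_PL \<Sigma>" "lat p \<in> \<Union>\<Sigma>"
  shows "\<phi> (lat p) \<in> \<int>"
proof -
  obtain \<tau> where \<tau>: "lat p \<in> \<tau>" "integral_linear_on \<tau> \<phi>"
    using assms unfolding integral_PL_def by blast
  then obtain q where "\<phi> (lat p) = inner (lat q) (lat p)" unfolding integral_linear_on_def by blast
  then show ?thesis by (auto simp: inner_vec_def lat_def intro!: Ints_sum Ints_mult)
qed

lemma integral_PL_at_0:
  assumes "\<phi> \<in> integral_PL \<Sigma>" "0 \<in> \<Union>\<Sigma>"
  shows "\<phi> 0 = 0"
proof -
  obtain \<tau> where \<tau>: "0 \<in> \<tau>" "integral_linear_on \<tau> \<phi>"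
    using assms unfolding integral_PL_def by blast
  then obtain q where "\<forall>x\<in>\<tau>. \<phi> x = inner (lat q) x" unfolding integral_linear_on_def by blast
  then show ?thesis using \<tau>(1) by simp
qed

lemma real_valuation_of_PL_valuation:
  assumes "PL_valuation \<Sigma> v" "x \<in> \<Union>\<Sigma>"
  shows "real_valuation (\<lambda>f. v f x)"
  using assms unfolding PL_valuation_def by unfold_locales auto

lemma phi_eq_Phi:
  "rees_data.phi (\<lambda>i j. ray_val v \<rho> i (b j)) n b = Phi n v \<rho> b"
proof -
  interpret rees_data r "\<lambda>i j. ray_val v \<rho> i (b j)" w n b for r w .
  have "(\<lambda>z. Poly_Mapping.single (xy_expo z) (xy_poly b z)) = (\<lambda>z. case z of
         Xvar i \<Rightarrow> Poly_Mapping.single (Poly_Mapping.single i (-1)) 1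
       | Yvar j \<Rightarrow> Poly_Mapping.single (vhat n v \<rho> (b j)) (b j))"
    by (auto simp: fun_eq_iff xy_expo_def xy_poly_def lattice_pt_def vhat_def split: var.splits)
  then show ?thesis unfolding phi_def Phi_def by simp
qed

theorem proposition6p2:
  fixes \<Sigma> :: "(real ^ 'm) set set"
    and \<rho> :: "nat \<Rightarrow> int ^ 'm"
    and v :: "('s::finite, 'k::alg_closed_field) mpoly \<Rightarrow> real ^ 'm \<Rightarrow> real"
    and b :: "nat \<Rightarrow> ('s, 'k) mpoly"
    and c :: "nat \<Rightarrow> nat \<Rightarrow> 'k"
    and n r d :: nat
  assumes "smooth_fan \<Sigma>"
    and "bij_betw \<rho> {..<n} (ray_generators \<Sigma>)"
    and "toric_vector_bundle \<Sigma> v"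
    and "inj_on b {..<r}"
    and "khovanskii_basis \<Sigma> v (b ` {..<r})"
    and "\<forall>i<n. Min ((\<lambda>j. ray_val v \<rho> i (b j)) ` {..<r}) = 0"
    and "minimal_linear_generators d r c (relation_ideal r b)"
  shows "(Phi n v \<rho> b ` carrier (XY_ring n r) = rees_algebra n v \<rho> \<and>
          Phi_kernel n r v \<rho> b = Idl\<^bsub>XY_ring n r\<^esub> (rel_poly n r v \<rho> b c ` {..<d}))
    \<longleftrightarrow>
         ((\<forall>A. A \<subseteq> {..<n} \<and> A \<noteq> {} \<longrightarrow> d < card A + m_rank d r v \<rho> b c A) \<and>
          (\<forall>B. B \<subseteq> {..<n} \<and> card B \<ge> 2 \<longrightarrow>
             (\<forall>i\<in>B. 1 + m_rank d r v \<rho> b c {i} < card B + m_rank d r v \<rho> b c B)))"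
proof -
  define u where "u = (\<lambda>i j. ray_val v \<rho> i (b j))"
  define w where "w = alpha r v \<rho> b c"
  interpret rees_data r u w n b .
  let ?K = "{..<d}"
  let ?rk = "\<lambda>A s. \<exists>K0\<subseteq>?K. row_indep r (lead c A) K0 \<and> card (?K - K0) < s"
  have ind: "row_indep r c ?K" by (rule minimal_linear_generators_row_indep[OF assms(7)])
  have adm: "admissible c ?K A" for A
    unfolding admissible_def
  proof (intro ballI allI impI)
    fix k j i assume "j < r" "c k j \<noteq> 0"
    then show "w k i \<le> u i j" unfolding w_def u_def alpha_def by (intro Min_le) auto
  qed
  have rank: "?rk A s \<longleftrightarrow> d < s + m_rank d r v \<rho> b c A" for A s
  proof -
    have "M_mat d r v \<rho> b c A = Matrix.mat d r (\<lambda>(k, j). lead c A k j)"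
      unfolding M_mat_def lead_def by (simp add: u_def w_def)
    then show ?thesis unfolding m_rank_def by (simp only: rank_le_iff_row_indep)
  qed

  have PL: "PL_valuation \<Sigma> v" and adapted: "\<And>\<sigma>. \<sigma> \<in> \<Sigma> \<Longrightarrow> \<exists>B. adapted_basis v \<sigma> B"
    using assms(3) by (auto simp: toric_vector_bundle_def)
  have PLv: "f \<noteq> 0 \<Longrightarrow> v f \<in> integral_PL \<Sigma>" for f using PL by (simp add: PL_valuation_def)
  have bf: "\<And>j. j < r \<Longrightarrow> b j \<in> fibre" and b0: "0 \<notin> b ` {..<r}"
    using assms(5) by (auto simp: khovanskii_basis_def)
  have gen: "generate_ring (gr_ring (\<lambda>f. v f x)) (Set.range (\<lambda>c. gr_class (\<lambda>f. v f x) 0 (const c))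
        \<union> (\<lambda>b. gr_class (\<lambda>f. v f x) (v b x) b) ` b ` {..<r}) = carrier (gr_ring (\<lambda>f. v f x))"
    if "x \<in> \<Union>\<Sigma>" for x
    using assms(5) that unfolding khovanskii_basis_def Let_def by blast

  have ray_floor: "real_of_int (ray_val v \<rho> i f) = v f (lat (\<rho> i))" if "i < n" "f \<noteq> 0" for i f
  proof -
    have "lat (\<rho> i) \<in> \<Union>\<Sigma>" using lat_in_support[OF assms(2) \<open>i < n\<close>] by blast
    then have "v f (lat (\<rho> i)) \<in> \<int>" using integral_PL_at_lattice_point PLv[OF \<open>f \<noteq> 0\<close>] by blast
    then show ?thesis by (auto simp: ray_val_def elim: Ints_cases)
  qed
  have ray: "f \<in> ev ` filt {i} \<delta> \<longleftrightarrow> f = 0 \<or> \<delta> i \<le> ray_val v \<rho> i f" if i: "i < n" for i f \<delta>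
  proof -
    obtain \<sigma> where \<sigma>: "\<sigma> \<in> \<Sigma>" "lat (\<rho> i) \<in> \<sigma>" by (rule lat_in_support[OF assms(2) i])
    then have supp: "lat (\<rho> i) \<in> \<Union>\<Sigma>" by blast
    obtain B where B: "adapted_basis v \<sigma> B" using adapted[OF \<sigma>(1)] by blast
    have u: "real_of_int (u i j) = v (b j) (lat (\<rho> i))" if "j < r" for j
    proof -
      have "b j \<noteq> 0" using b0 that by force
      then show ?thesis unfolding u_def by (rule ray_floor[OF i])
    qed
    have "f \<in> ev ` filt {i} (\<lambda>_. \<delta> i) \<longleftrightarrow> f = 0 \<or> real_of_int (\<delta> i) \<le> v f (lat (\<rho> i))"
      by (rule single_ray_image[OF real_valuation_of_PL_valuation[OF PL supp] B \<sigma>(2) bf b0 gen[OF supp] _ u])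
         (auto intro: integral_PL_at_lattice_point[OF PLv supp])
    also have "filt {i} (\<lambda>_. \<delta> i) = (filt {i} \<delta> :: (nat, 'k) mpoly set)" by (simp add: filt_def)
    finally show ?thesis using ray_floor[OF i, of f] by (cases "f = 0") auto
  qed
  \<comment> \<open>At the origin all values are \<open>0\<close>, so that the graded algebra is \<open>Sym(E)\<close> itself.\<close>
  have surj: "f \<in> ev ` filt {} (\<lambda>_. 0)" for f
  proof (cases "f = 0")
    case True then show ?thesis by (intro image_eqI[of _ _ 0]) auto
  next
    case False
    have fan: "is_fan \<Sigma>" using assms(1) by (simp add: smooth_fan_def)
    then have "\<Sigma> \<noteq> {}" by (simp add: is_fan_def)
    then obtain \<sigma> where \<sigma>: "\<sigma> \<in> \<Sigma>" by blast
    then have "rational_cone \<sigma>" using fan by (simp add: is_fan_def)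
    then have "0 \<in> \<sigma>" by (auto simp: rational_cone_def convex_cone_hull_contains_0)
    then have supp: "0 \<in> \<Union>\<Sigma>" using \<sigma> by blast
    interpret real_valuation "\<lambda>f. v f 0" by (rule real_valuation_of_PL_valuation[OF PL supp])
    obtain g where g: "g \<in> carrier (poly_ring_in {..<r})" "val_gt (v f 0) (f - poly_subst const b g)"
      using approximation[OF b0 gen[OF supp] False] by blast
    have "f - ev g = 0"
    proof (rule ccontr)
      assume nz: "f - ev g \<noteq> 0"
      then have "v f 0 < v (f - ev g) 0" using g(2) by (simp add: val_gt_def ev_def)
      then show False using integral_PL_at_0[OF PLv[OF False] supp] integral_PL_at_0[OF PLv[OF nz] supp] by simp
    qed
    moreover have "g \<in> filt {} (\<lambda>_. 0)" using g(1) by (auto simp: filt_def)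
    ultimately show ?thesis by auto
  qed

  have L: "ev f = 0 \<longleftrightarrow> f \<in> rel c ?K {} \<delta>" if f: "f \<in> filt {} \<delta>" for f \<delta>
  proof -
    have fcar: "carrier (poly_ring_in {..<r}) = (filt {} \<epsilon> :: (nat, 'k) mpoly set)" for \<epsilon>
      by (simp add: filt_def)
    have "relation_ideal r b = {f \<in> carrier (poly_ring_in {..<r}). ev f = 0}"
      by (simp add: relation_ideal_def a_kernel_def' ev_def)
    moreover have "relation_ideal r b = {(\<Sum>k\<in>?K. linear_form r (c k) * q k) | q. \<forall>k\<in>?K. q k \<in> carrier (poly_ring_in {..<r})}"
    proof -
      have "linear_form r (c k) \<in> carrier (poly_ring_in {..<r})" for k by (auto simp: keys_linear_form)
      then show ?thesis
        using assms(7) genideal_finite_image[of ?K "\<lambda>k. linear_form r (c k)" "{..<r}"]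
        unfolding minimal_linear_generators_def by simp
    qed
    moreover have "\<dots> = rel c ?K {} \<delta>" by (simp add: rel_def filt_def)
    ultimately show ?thesis using f fcar by blast
  qed

  have ker: "Phi_kernel n r v \<rho> b = Idl\<^bsub>XY_ring n r\<^esub> (rel_poly n r v \<rho> b c ` ?K) \<longleftrightarrow> saturated c ?K {..<n}"
  proof -
    have phi: "phi = Phi n v \<rho> b" unfolding u_def by (rule phi_eq_Phi)
    have form: "rel_poly n r v \<rho> b c = xy_form c"
      unfolding rel_poly_def xy_form_def fun_eq_iff by (simp add: u_def w_def)
    have "Phi_kernel n r v \<rho> b = {p \<in> xy_carrier. phi p = 0}"
      unfolding Phi_kernel_def phi a_kernel_def' by simp
    moreover have "Idl\<^bsub>XY_ring n r\<^esub> (rel_poly n r v \<rho> b c ` ?K) = {(\<Sum>k\<in>?K. xy_form c k * q k) | q. \<forall>k\<in>?K. q k \<in> xy_carrier}"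
      unfolding form XY_ring_def by (rule genideal_finite_image[OF finite_lessThan xy_form_carrier[unfolded XY_ring_def]])
    ultimately show ?thesis using kernel_iff_saturated[OF adm L] by simp
  qed

  have img: "Phi n v \<rho> b ` carrier (XY_ring n r) = rees_algebra n v \<rho> \<longleftrightarrow>
      (\<forall>\<delta> f. (\<forall>i<n. f \<in> ev ` filt {i} \<delta>) \<longrightarrow> f \<in> ev ` filt {..<n} \<delta>)"
  proof -
    have phi: "Phi n v \<rho> b = phi" unfolding u_def by (rule phi_eq_Phi[symmetric])
    have rees: "F \<in> rees_algebra n v \<rho> \<longleftrightarrow> (\<forall>\<delta>\<in>keys F. keys \<delta> \<subseteq> {..<n} \<and> (\<forall>i<n. lookup F \<delta> \<in> ev ` filt {i} (lookup \<delta>)))" for F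
      unfolding rees_algebra_def using ray by (auto simp: in_keys_iff)
    have sub: "phi ` xy_carrier \<subseteq> rees_algebra n v \<rho>"
    proof
      fix F assume "F \<in> phi ` xy_carrier"
      then obtain p where p: "p \<in> xy_carrier" "F = phi p" by blast
      show "F \<in> rees_algebra n v \<rho>"
        unfolding rees
      proof (intro ballI conjI allI impI)
        fix \<delta> assume "\<delta> \<in> keys F"
        then have "\<delta> \<in> keys (psi p)" by (auto simp: p(2) in_keys_iff lookup_phi)
        then show "keys \<delta> \<subseteq> {..<n}" by (rule psi_filt(2)[OF p(1)])
        fix i assume "i < n"
        then have "lookup (psi p) \<delta> \<in> filt {i} (lookup \<delta>)" by (intro filt_mono[OF psi_filt(1)[OF p(1)]]) auto
        then show "lookup F \<delta> \<in> ev ` filt {i} (lookup \<delta>)" by (simp add: p(2) lookup_phi)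
      qed
    qed
    show ?thesis
      unfolding phi
    proof
      assume eq: "phi ` xy_carrier = rees_algebra n v \<rho>"
      show "\<forall>\<delta> f. (\<forall>i<n. f \<in> ev ` filt {i} \<delta>) \<longrightarrow> f \<in> ev ` filt {..<n} \<delta>"
      proof (intro allI impI)
        fix \<delta> f assume f: "\<forall>i<n. f \<in> ev ` filt {i} \<delta>"
        let ?d = "lattice_pt n \<delta>"
        have "filt {i} (lookup ?d) = (filt {i} \<delta> :: (nat, 'k) mpoly set)" if "i < n" for i
          using that by (simp add: filt_def lookup_lattice_pt)
        then have "Poly_Mapping.single ?d f \<in> rees_algebra n v \<rho>"
          unfolding rees using f keys_lattice_pt[of n \<delta>] by simp
        then obtain p where p: "p \<in> xy_carrier" "phi p = Poly_Mapping.single ?d f" using eq by force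
        have "f = ev (lookup (psi p) ?d)" by (simp add: lookup_phi[symmetric] p(2))
        moreover have "lookup (psi p) ?d \<in> filt {..<n} \<delta>"
          by (rule filt_mono[OF psi_filt(1)[OF p(1)]]) (auto simp: lookup_lattice_pt)
        ultimately show "f \<in> ev ` filt {..<n} \<delta>" by blast
      qed
    next
      assume all: "\<forall>\<delta> f. (\<forall>i<n. f \<in> ev ` filt {i} \<delta>) \<longrightarrow> f \<in> ev ` filt {..<n} \<delta>"
      show "phi ` xy_carrier = rees_algebra n v \<rho>"
      proof (rule subset_antisym[OF sub subsetI])
        fix F assume F: "F \<in> rees_algebra n v \<rho>"
        have "\<exists>p. p \<in> xy_carrier \<and> phi p = Poly_Mapping.single \<delta> (lookup F \<delta>)" if \<delta>: "\<delta> \<in> keys F" for \<delta>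
        proof -
          have k: "keys \<delta> \<subseteq> {..<n}" and "\<forall>i<n. lookup F \<delta> \<in> ev ` filt {i} (lookup \<delta>)"
            using F \<delta> unfolding rees by auto
          then obtain g where g: "g \<in> filt {..<n} (lookup \<delta>)" "lookup F \<delta> = ev g" using all by blast
          obtain p where p: "p \<in> xy_carrier" "psi p = Poly_Mapping.single \<delta> g" by (rule psi_surj[OF g(1) k])
          have "phi p = Poly_Mapping.single \<delta> (lookup F \<delta>)"
            by (rule poly_mapping_eqI) (simp add: lookup_phi p(2) g(2) lookup_single when_def)
          then show ?thesis using p(1) by blast
        qed
        then obtain p where p: "\<And>\<delta>. \<delta> \<in> keys F \<Longrightarrow> p \<delta> \<in> xy_carrier"
            "\<And>\<delta>. \<delta> \<in> keys F \<Longrightarrow> phi (p \<delta>) = Poly_Mapping.single \<delta> (lookup F \<delta>)"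
          by metis
        have "phi (\<Sum>\<delta>\<in>keys F. p \<delta>) = F"
          unfolding phi_sum by (subst (2) sum_singles) (rule sum.cong, simp_all add: p(2))
        moreover have "(\<Sum>\<delta>\<in>keys F. p \<delta>) \<in> xy_carrier"
          unfolding XY_ring_def by (rule poly_in_sum) (rule p(1)[unfolded XY_ring_def])
        ultimately show "F \<in> phi ` xy_carrier" by (metis imageI)
      qed
    qed
  qed

  have sat_iff: "saturated c ?K {..<n} \<longleftrightarrow> (\<forall>A. A \<subseteq> {..<n} \<and> A \<noteq> {} \<longrightarrow> ?rk A (card A))"
  proof
    assume sat: "saturated c ?K {..<n}"
    show "\<forall>A. A \<subseteq> {..<n} \<and> A \<noteq> {} \<longrightarrow> ?rk A (card A)"
      using rank_if_saturated[OF _ _ finite_lessThan adm ind saturated_mono[OF sat]] finite_subset by blast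
  next
    assume "\<forall>A. A \<subseteq> {..<n} \<and> A \<noteq> {} \<longrightarrow> ?rk A (card A)"
    then show "saturated c ?K {..<n}"
      by (intro saturated_if_rank adm ind) auto
  qed

  have sat_lead_iff: "saturated (lead c {i}) ?K ({..<n} - {i}) \<longleftrightarrow>
      (\<forall>A. A \<subseteq> {..<n} - {i} \<and> A \<noteq> {} \<longrightarrow> ?rk (insert i A) (card A))"
    if ind_i: "row_indep r (lead c {i}) ?K" for i
  proof -
    have lead2: "lead (lead c {i}) A = lead c (insert i A)" for A
      by (auto simp: lead_def fun_eq_iff)
    have adm_i: "admissible (lead c {i}) ?K A" for A
      using adm[of A] by (auto simp: admissible_def lead_def)
    show ?thesis
    proof
      assume sat: "saturated (lead c {i}) ?K ({..<n} - {i})"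
      show "\<forall>A. A \<subseteq> {..<n} - {i} \<and> A \<noteq> {} \<longrightarrow> ?rk (insert i A) (card A)"
      proof (intro allI impI)
        fix A assume A: "A \<subseteq> {..<n} - {i} \<and> A \<noteq> {}"
        have "finite A" using A finite_subset by blast
        then show "?rk (insert i A) (card A)"
          using rank_if_saturated[OF _ _ finite_lessThan adm_i ind_i saturated_mono[OF sat]] A unfolding lead2 by blast
      qed
    next
      assume "\<forall>A. A \<subseteq> {..<n} - {i} \<and> A \<noteq> {} \<longrightarrow> ?rk (insert i A) (card A)"
      then show "saturated (lead c {i}) ?K ({..<n} - {i})"
        by (intro saturated_if_rank adm_i ind_i, unfold lead2) auto
    qed
  qed

  let ?m = "m_rank d r v \<rho> b c"
  let ?C1 = "\<forall>A. A \<subseteq> {..<n} \<and> A \<noteq> {} \<longrightarrow> d < card A + ?m A"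
  let ?C2 = "\<forall>B. B \<subseteq> {..<n} \<and> card B \<ge> 2 \<longrightarrow> (\<forall>i\<in>B. 1 + ?m {i} < card B + ?m B)"
  have kerC: "Phi_kernel n r v \<rho> b = Idl\<^bsub>XY_ring n r\<^esub> (rel_poly n r v \<rho> b c ` ?K) \<longleftrightarrow> ?C1"
    unfolding ker sat_iff rank ..
  moreover have "Phi n v \<rho> b ` carrier (XY_ring n r) = rees_algebra n v \<rho> \<longleftrightarrow> ?C2" if C1: ?C1
  proof -
    have sat: "saturated c ?K {..<n}" using C1 unfolding sat_iff rank .
    have m_le: "?m A \<le> d" for A using rank[of A 0] by auto
    have m1: "?m {i} = d" if "i < n" for i
    proof -
      have "d < card {i} + ?m {i}" using C1[rule_format, of "{i}"] that by blast
      then show ?thesis using m_le[of "{i}"] by simp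
    qed
    have ind_i: "row_indep r (lead c {i}) ?K" if i: "i < n" for i
    proof -
      have "?rk {i} 1" unfolding rank using m1[OF i] by simp
      then obtain K0 where K0: "K0 \<subseteq> ?K" "row_indep r (lead c {i}) K0" "card (?K - K0) < 1" by blast
      then have "?K - K0 = {}" by simp
      then have "K0 = ?K" using K0(1) by blast
      then show ?thesis using K0(2) by simp
    qed
    have "(Phi n v \<rho> b ` carrier (XY_ring n r) = rees_algebra n v \<rho>) \<longleftrightarrow>
        (\<forall>i<n. saturated (lead c {i}) ?K ({..<n} - {i}))"
      unfolding img by (rule image_iff_saturated_lead[OF adm sat L surj])
    also have "\<dots> \<longleftrightarrow> (\<forall>i<n. \<forall>A. A \<subseteq> {..<n} - {i} \<and> A \<noteq> {} \<longrightarrow> d < card A + ?m (insert i A))"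
      by (rule all_cong1, rule imp_cong[OF refl], rule sat_lead_iff[OF ind_i, unfolded rank])
    also have "\<dots> \<longleftrightarrow> ?C2"
    proof
      assume h: "\<forall>i<n. \<forall>A. A \<subseteq> {..<n} - {i} \<and> A \<noteq> {} \<longrightarrow> d < card A + ?m (insert i A)"
      show ?C2
      proof (intro allI impI ballI)
        fix B i assume B: "B \<subseteq> {..<n} \<and> 2 \<le> card B" and i: "i \<in> B"
        have fB: "finite B" using B finite_subset by blast
        have "i < n" using B i by auto
        have cB: "card B = Suc (card (B - {i}))" using card_Suc_Diff1[OF fB i] by simp
        then have "card (B - {i}) \<noteq> 0" using B by linarith
        then have "B - {i} \<noteq> {}" by (metis card.empty)
        moreover have "B - {i} \<subseteq> {..<n} - {i}" "insert i (B - {i}) = B" using B i by auto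
        ultimately have "d < card (B - {i}) + ?m B" using h \<open>i < n\<close> by metis
        then show "1 + ?m {i} < card B + ?m B" using m1[OF \<open>i < n\<close>] cB by simp
      qed
    next
      assume h: ?C2
      show "\<forall>i<n. \<forall>A. A \<subseteq> {..<n} - {i} \<and> A \<noteq> {} \<longrightarrow> d < card A + ?m (insert i A)"
      proof (intro allI impI)
        fix i A assume i: "i < n" and A: "A \<subseteq> {..<n} - {i} \<and> A \<noteq> {}"
        have fA: "finite A" using A finite_subset by blast
        have "i \<notin> A" using A by auto
        then have cA: "card (insert i A) = Suc (card A)" using fA by simp
        have "0 < card A" using A fA by (simp add: card_gt_0_iff)
        then have "1 + ?m {i} < card (insert i A) + ?m (insert i A)"
          using h[rule_format, of "insert i A" i] A i cA by auto
        then show "d < card A + ?m (insert i A)" using m1[OF i] cA by simp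
      qed
    qed
    finally show ?thesis .
  qed
  ultimately show ?thesis by blast
qed

end
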